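(* For every formula $\varphi$ in BMA of $\mathsf{Comp}$-height $k$ there is a formula $\varphi'$ in BR of $\mathsf{Comp}$-height $k+1$ that is equivalent to $\varphi$ over data words and over data $\omega$-words.
   Context: Data words and data $\omega$-words are finite/infinite sequences over $\Sigma\times\mathcal D$ ($\Sigma$ finite alphabet, $\mathcal D$ infinite); $i\sim j$ iff positions $i,j$ carry the same data value; class successor/predecessor of $i$ is the nearest later/earlier position $j\sim i$. $\mu$-calculus: $\varphi::= x\mid A\mid\neg A\mid \mathsf M\varphi\mid\varphi\vee\varphi\mid\varphi\wedge\varphi\mid\mu x.\varphi\mid\nu x.\varphi$, with fixpoint variables $x$, atoms $A$: letters of $\Sigma$ and zeroary $\mathsf S,\mathsf P,\mathsf{first}^g,\mathsf{last}^g,\mathsf{first}^c,\mathsf{last}^c$; unary modalities $\mathsf M\in\{\mathtt X^g,\mathtt X^c,\mathtt Y^g,\mathtt Y^c\}$ evaluating the argument at the successor, class successor, predecessor, class predecessor respectively (false if nonexistent). Letters hold where they label the position; $\mathsf{first}^g$/$\mathsf{last}^g$ at the first/last position; $\mathsf{first}^c$/$\mathsf{last}^c$ where there is no class predecessor/successor; $\mathsf S$ at $i$ iff $i$ is not last and $i+1$ is the class successor of $i$; $\mathsf P$ at $i$ iff $i\ne1$ and $i-1$ is the class predecessor of $i$; $\mu,\nu$ are least/greatest fixpoints. Two formulas are equivalent over a class of structures if they denote the same set of positions on each of them (under every valuation of free variables). For a set $M$ of unary modalities, $\mathsf{Formulas}(M)$ is the set of formulas whose unary modalities are all in $M$ (all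 atoms allowed). For a set $\Psi$ of formulas: $\mathsf{Comp}^0(\Psi)=\emptyset$; $\mathsf{Comp}^{i+1}(\Psi)=\{\psi(\varphi_1,\dots,\varphi_n)\mid \psi(x_1,\dots,x_n)\in\Psi,\ \varphi_1,\dots,\varphi_n\in\mathsf{Comp}^i(\Psi)\}$ where $\psi(x_1,\dots,x_n)$ has free variables among $x_1,\dots,x_n$, and the substitution does not capture free variables; $\mathsf{Comp}(\Psi)=\bigcup_i\mathsf{Comp}^i(\Psi)$; the $\mathsf{Comp}$-height of $\psi$ is the least $i$ with $\psi\in\mathsf{Comp}^i(\Psi)$. With $M_{\mathtt X}=\{\mathtt X^c,\mathtt X^g\}$, $M_{\mathtt Y}=\{\mathtt Y^c,\mathtt Y^g\}$, $M_g=\{\mathtt X^g,\mathtt Y^g\}$, $M_c=\{\mathtt X^c,\mathtt Y^c\}$: BR $=\mathsf{Comp}(\mathsf{Formulas}(M_{\mathtt X})\cup\mathsf{Formulas}(M_{\mathtt Y}))$ and BMA $=\mathsf{Comp}(\mathsf{Formulas}(M_g)\cup\mathsf{Formulas}(M_c))$; $\mathsf{Comp}$-heights are taken with respect to these respective sets. *)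

theory Defs
  imports Main
begin

section \<open>Data words\<close>

text \<open>The alphabet is the type \<open>'a\<close>, the data domain the type \<open>'d\<close>.
  Positions are counted from 0.\<close>

datatype ('a, 'd) dword =
    FinWord "('a \<times> 'd) list"
  | OmegaWord "nat \<Rightarrow> 'a \<times> 'd"

definition data_words :: "('a, 'd) dword set" where
  "data_words = range FinWord"

definition data_omega_words :: "('a, 'd) dword set" where
  "data_omega_words = range OmegaWord"

fun positions :: "('a, 'd) dword \<Rightarrow> nat set" where
  "positions (FinWord xs) = {..<length xs}"
| "positions (OmegaWord f) = UNIV"

text \<open>Only meaningful at positions of the word.\<close>

fun entry :: "('a, 'd) dword \<Rightarrow> nat \<Rightarrow> 'a \<times> 'd" where
  "entry (FinWord xs) i = xs ! i"
| "entry (OmegaWord f) i = f i"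

definition letter :: "('a, 'd) dword \<Rightarrow> nat \<Rightarrow> 'a" where
  "letter w i = fst (entry w i)"

definition datum :: "('a, 'd) dword \<Rightarrow> nat \<Rightarrow> 'd" where
  "datum w i = snd (entry w i)"

definition same_class :: "('a, 'd) dword \<Rightarrow> nat \<Rightarrow> nat \<Rightarrow> bool" where
  "same_class w i j \<longleftrightarrow> i \<in> positions w \<and> j \<in> positions w \<and> datum w i = datum w j"

text \<open>In the four relations below, the second position is the
  (class) successor/predecessor of the first.\<close>

definition is_succ :: "('a, 'd) dword \<Rightarrow> nat \<Rightarrow> nat \<Rightarrow> bool" where
  "is_succ w i j \<longleftrightarrow> i \<in> positions w \<and> j \<in> positions w \<and> j = Suc i"

definition is_pred :: "('a, 'd) dword \<Rightarrow> nat \<Rightarrow> nat \<Rightarrow> bool" where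
  "is_pred w i j \<longleftrightarrow> i \<in> positions w \<and> j \<in> positions w \<and> Suc j = i"

definition is_class_succ :: "('a, 'd) dword \<Rightarrow> nat \<Rightarrow> nat \<Rightarrow> bool" where
  "is_class_succ w i j \<longleftrightarrow>
     i < j \<and> same_class w i j \<and> (\<forall>k. i < k \<and> k < j \<longrightarrow> \<not> same_class w i k)"

definition is_class_pred :: "('a, 'd) dword \<Rightarrow> nat \<Rightarrow> nat \<Rightarrow> bool" where
  "is_class_pred w i j \<longleftrightarrow>
     j < i \<and> same_class w i j \<and> (\<forall>k. j < k \<and> k < i \<longrightarrow> \<not> same_class w i k)"


section \<open>Syntax\<close>

datatype 'a atom =
    Letter 'a | AtS | AtP | FirstG | LastG | FirstC | LastC

datatype modality = XG | XC | YG | YC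

datatype 'a fm =
    Var nat
  | Atom "'a atom"
  | NegAtom "'a atom"
  | Mod modality "'a fm"
  | Or "'a fm" "'a fm"
  | And "'a fm" "'a fm"
  | Mu nat "'a fm"
  | Nu nat "'a fm"

primrec fv :: "'a fm \<Rightarrow> nat set" where
  "fv (Var x) = {x}"
| "fv (Atom A) = {}"
| "fv (NegAtom A) = {}"
| "fv (Mod m \<phi>) = fv \<phi>"
| "fv (Or \<phi> \<psi>) = fv \<phi> \<union> fv \<psi>"
| "fv (And \<phi> \<psi>) = fv \<phi> \<union> fv \<psi>"
| "fv (Mu x \<phi>) = fv \<phi> - {x}"
| "fv (Nu x \<phi>) = fv \<phi> - {x}"

primrec modalities :: "'a fm \<Rightarrow> modality set" where
  "modalities (Var x) = {}"
| "modalities (Atom A) = {}"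
| "modalities (NegAtom A) = {}"
| "modalities (Mod m \<phi>) = insert m (modalities \<phi>)"
| "modalities (Or \<phi> \<psi>) = modalities \<phi> \<union> modalities \<psi>"
| "modalities (And \<phi> \<psi>) = modalities \<phi> \<union> modalities \<psi>"
| "modalities (Mu x \<phi>) = modalities \<phi>"
| "modalities (Nu x \<phi>) = modalities \<phi>"


section \<open>Semantics\<close>

fun step :: "modality \<Rightarrow> ('a, 'd) dword \<Rightarrow> nat \<Rightarrow> nat \<Rightarrow> bool" where
  "step XG = is_succ"
| "step XC = is_class_succ"
| "step YG = is_pred"
| "step YC = is_class_pred"

fun holds_at :: "('a, 'd) dword \<Rightarrow> 'a atom \<Rightarrow> nat \<Rightarrow> bool" where
  "holds_at w (Letter a) i \<longleftrightarrow> letter w i = a"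
| "holds_at w AtS i \<longleftrightarrow> Suc i \<in> positions w \<and> is_class_succ w i (Suc i)"
| "holds_at w AtP i \<longleftrightarrow> i \<noteq> 0 \<and> is_class_pred w i (i - 1)"
| "holds_at w FirstG i \<longleftrightarrow> i = 0"
| "holds_at w LastG i \<longleftrightarrow> Suc i \<notin> positions w"
| "holds_at w FirstC i \<longleftrightarrow> \<not> (\<exists>j. is_class_pred w i j)"
| "holds_at w LastC i \<longleftrightarrow> \<not> (\<exists>j. is_class_succ w i j)"

text \<open>Fixpoints are taken in the lattice of subsets of \<open>positions w\<close>; intersecting with
  \<open>positions w\<close> achieves this with the fixpoint operators of the full powerset lattice
  (otherwise \<open>Nu x (Var x)\<close> would contain numbers that are not positions).\<close>

primrec sem :: "('a, 'd) dword \<Rightarrow> 'a fm \<Rightarrow> (nat \<Rightarrow> nat set) \<Rightarrow> nat set" where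
  "sem w (Var x) \<rho> = \<rho> x"
| "sem w (Atom A) \<rho> = {i \<in> positions w. holds_at w A i}"
| "sem w (NegAtom A) \<rho> = {i \<in> positions w. \<not> holds_at w A i}"
| "sem w (Mod m \<phi>) \<rho> = {i \<in> positions w. \<exists>j. step m w i j \<and> j \<in> sem w \<phi> \<rho>}"
| "sem w (Or \<phi> \<psi>) \<rho> = sem w \<phi> \<rho> \<union> sem w \<psi> \<rho>"
| "sem w (And \<phi> \<psi>) \<rho> = sem w \<phi> \<rho> \<inter> sem w \<psi> \<rho>"
| "sem w (Mu x \<phi>) \<rho> = lfp (\<lambda>U. positions w \<inter> sem w \<phi> (\<rho>(x := U)))"
| "sem w (Nu x \<phi>) \<rho> = gfp (\<lambda>U. positions w \<inter> sem w \<phi> (\<rho>(x := U)))"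

definition valuation :: "('a, 'd) dword \<Rightarrow> (nat \<Rightarrow> nat set) \<Rightarrow> bool" where
  "valuation w \<rho> \<longleftrightarrow> (\<forall>x. \<rho> x \<subseteq> positions w)"

definition equiv_over :: "('a, 'd) dword set \<Rightarrow> 'a fm \<Rightarrow> 'a fm \<Rightarrow> bool" where
  "equiv_over C \<phi> \<psi> \<longleftrightarrow> (\<forall>w\<in>C. \<forall>\<rho>. valuation w \<rho> \<longrightarrow> sem w \<phi> \<rho> = sem w \<psi> \<rho>)"

lemma sem_mono: "(\<And>x. \<rho> x \<subseteq> \<rho>' x) \<Longrightarrow> sem w \<phi> \<rho> \<subseteq> sem w \<phi> \<rho>'"
proof (induction \<phi> arbitrary: \<rho> \<rho>')
  case (Mod m \<phi>)
  have "sem w \<phi> \<rho> \<subseteq> sem w \<phi> \<rho>'"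
    by (intro Mod.IH Mod.prems)
  then show ?case
    unfolding sem.simps by blast
next
  case (Or \<phi> \<psi>)
  show ?case
    unfolding sem.simps by (intro Un_mono Or.IH Or.prems)
next
  case (And \<phi> \<psi>)
  show ?case
    unfolding sem.simps by (intro Int_mono And.IH And.prems)
next
  case (Mu x \<phi>)
  have "sem w \<phi> (\<rho>(x := U)) \<subseteq> sem w \<phi> (\<rho>'(x := U))" for U
    by (rule Mu.IH) (simp add: Mu.prems)
  then show ?case
    unfolding sem.simps by (intro lfp_mono) blast
next
  case (Nu x \<phi>)
  have "sem w \<phi> (\<rho>(x := U)) \<subseteq> sem w \<phi> (\<rho>'(x := U))" for U
    by (rule Nu.IH) (simp add: Nu.prems)
  then show ?case
    unfolding sem.simps by (intro gfp_mono) blast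
qed simp_all

lemma mono_sem_body: "mono (\<lambda>U. positions w \<inter> sem w \<phi> (\<rho>(x := U)))"
proof (rule monoI)
  fix U V :: "nat set" assume "U \<subseteq> V"
  then have "sem w \<phi> (\<rho>(x := U)) \<subseteq> sem w \<phi> (\<rho>(x := V))"
    by (intro sem_mono) simp
  then show "positions w \<inter> sem w \<phi> (\<rho>(x := U)) \<subseteq> positions w \<inter> sem w \<phi> (\<rho>(x := V))"
    by blast
qed

lemma sem_subset_positions: "valuation w \<rho> \<Longrightarrow> sem w \<phi> \<rho> \<subseteq> positions w"
proof (induction \<phi> arbitrary: \<rho>)
  case (Mu x \<phi>)
  show ?case
    unfolding sem.simps by (subst lfp_unfold[OF mono_sem_body]) blast
next
  case (Nu x \<phi>)
  show ?case
    unfolding sem.simps by (subst gfp_unfold[OF mono_sem_body]) blast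
next
  case (Or \<phi> \<psi>)
  then show ?case by simp
next
  case (And \<phi> \<psi>)
  then show ?case by (simp add: le_infI1)
qed (simp_all add: valuation_def)


section \<open>Composition\<close>

text \<open>Simultaneous substitution for the free occurrences of variables. It does not rename
  bound variables; \<open>no_capture\<close> says that it captures no free variable.\<close>

primrec subst :: "'a fm \<Rightarrow> (nat \<Rightarrow> 'a fm) \<Rightarrow> 'a fm" where
  "subst (Var x) \<sigma> = \<sigma> x"
| "subst (Atom A) \<sigma> = Atom A"
| "subst (NegAtom A) \<sigma> = NegAtom A"
| "subst (Mod m \<phi>) \<sigma> = Mod m (subst \<phi> \<sigma>)"
| "subst (Or \<phi> \<psi>) \<sigma> = Or (subst \<phi> \<sigma>) (subst \<psi> \<sigma>)"
| "subst (And \<phi> \<psi>) \<sigma> = And (subst \<phi> \<sigma>) (subst \<psi> \<sigma>)"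
| "subst (Mu x \<phi>) \<sigma> = Mu x (subst \<phi> (\<sigma>(x := Var x)))"
| "subst (Nu x \<phi>) \<sigma> = Nu x (subst \<phi> (\<sigma>(x := Var x)))"

primrec no_capture :: "'a fm \<Rightarrow> (nat \<Rightarrow> 'a fm) \<Rightarrow> bool" where
  "no_capture (Var x) \<sigma> \<longleftrightarrow> True"
| "no_capture (Atom A) \<sigma> \<longleftrightarrow> True"
| "no_capture (NegAtom A) \<sigma> \<longleftrightarrow> True"
| "no_capture (Mod m \<phi>) \<sigma> \<longleftrightarrow> no_capture \<phi> \<sigma>"
| "no_capture (Or \<phi> \<psi>) \<sigma> \<longleftrightarrow> no_capture \<phi> \<sigma> \<and> no_capture \<psi> \<sigma>"
| "no_capture (And \<phi> \<psi>) \<sigma> \<longleftrightarrow> no_capture \<phi> \<sigma> \<and> no_capture \<psi> \<sigma>"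
| "no_capture (Mu x \<phi>) \<sigma> \<longleftrightarrow>
     (\<forall>y \<in> fv \<phi> - {x}. x \<notin> fv (\<sigma> y)) \<and> no_capture \<phi> (\<sigma>(x := Var x))"
| "no_capture (Nu x \<phi>) \<sigma> \<longleftrightarrow>
     (\<forall>y \<in> fv \<phi> - {x}. x \<notin> fv (\<sigma> y)) \<and> no_capture \<phi> (\<sigma>(x := Var x))"

definition Formulas :: "modality set \<Rightarrow> 'a fm set" where
  "Formulas M = {\<phi>. modalities \<phi> \<subseteq> M}"

text \<open>The variables \<open>x\<^sub>1, \<dots>, x\<^sub>n\<close> of \<open>\<psi>(x\<^sub>1, \<dots>, x\<^sub>n)\<close> are taken to be exactly the free
  variables of \<open>\<psi>\<close>; superfluous ones would not change the result of the substitution.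
  In particular level 1 consists of the closed formulas of \<open>\<Psi>\<close>.\<close>

primrec Comp_level :: "'a fm set \<Rightarrow> nat \<Rightarrow> 'a fm set" where
  "Comp_level \<Psi> 0 = {}"
| "Comp_level \<Psi> (Suc i) =
     {subst \<psi> \<sigma> | \<psi> \<sigma>. \<psi> \<in> \<Psi> \<and> (\<forall>x \<in> fv \<psi>. \<sigma> x \<in> Comp_level \<Psi> i) \<and> no_capture \<psi> \<sigma>}"

definition Comp :: "'a fm set \<Rightarrow> 'a fm set" where
  "Comp \<Psi> = (\<Union>i. Comp_level \<Psi> i)"

text \<open>Only meaningful for formulas in \<open>Comp \<Psi>\<close>.\<close>

definition comp_height :: "'a fm set \<Rightarrow> 'a fm \<Rightarrow> nat" where
  "comp_height \<Psi> \<phi> = (LEAST i. \<phi> \<in> Comp_level \<Psi> i)"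

definition BR_base :: "'a fm set" where
  "BR_base = Formulas {XC, XG} \<union> Formulas {YC, YG}"

definition BMA_base :: "'a fm set" where
  "BMA_base = Formulas {XG, YG} \<union> Formulas {XC, YC}"

definition BR :: "'a fm set" where
  "BR = Comp BR_base"

definition BMA :: "'a fm set" where
  "BMA = Comp BMA_base"

end

theory Submission
  imports Defs "HOL-Library.Ramsey" "HOL-Library.Countable"
begin

text \<open>A formula over the modalities \<open>XG, YG\<close> (or \<open>XC, YC\<close>) sees only the maximal successor (class
  successor) chain through a position, which is a finite or infinite word. Its graph is a regular
  language of such words, so whether it holds at a position depends only on the type of the prefix
  before the position and the type of the suffix from the position on, with respect to a finite
  congruence. By Ramsey's theorem an infinite suffix factorizes into one type followed by
  repetitions of a second type, so each suffix type is expressible with the forward modality alone;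
  prefix types are expressible with the backward modality alone. Hence the formula is a finite
  disjunction of conjunctions of a past and a future formula, and such a combination can be put in
  \<open>BR\<close> with the future on top as well as with the past on top. Choosing at each level of the
  composition the direction that fits the level above, adjacent layers of equal direction merge,
  and only one additional level is needed.

  The future and past formulas may use the complements of the arguments; this is harmless because
  the substituted formulas are closed and have duals of the same height.\<close>

section \<open>Recognizable languages of infinite words\<close>

text \<open>Formulas on a single chain are handled by a detour through monadic second-order logic on
  words. Recognizability is defined by finite congruences instead of automata: complementation then
  keeps the congruence and projection is a plain powerset, so no determinization of Buechi automata
  arises, and fixpoints reduce to set quantifiers. Automata reappear only for the way back: the
  finite quotients are read letter by letter, and Kleene's theorem expresses their runs by
  disjunction, nesting and \<open>Mu\<close> with a single modality.

  The syntax is in negation normal form, while a test for one particular letter must also detect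
  that an argument is false. This is why negative copies of the arguments are carried along.

  The composition argument only bounds the height by k + 1, whereas the claim asks for exactly k +
  1. Therefore an unsatisfiable disjunct with enough changes of direction is added, and a lower
  bound on the level is obtained by counting such changes.\<close>

definition seg :: "(nat \<Rightarrow> 'l) \<Rightarrow> nat \<Rightarrow> nat \<Rightarrow> 'l list" where
  "seg w i j = map w [i..<j]"

lemma length_seg [simp]: "length (seg w i j) = j - i"
  by (simp add: seg_def)

lemma nth_seg: "n < j - i \<Longrightarrow> seg w i j ! n = w (i + n)"
  by (simp add: seg_def)

lemma seg_append: "i \<le> j \<Longrightarrow> j \<le> k \<Longrightarrow> seg w i j @ seg w j k = seg w i k"
  unfolding seg_def by (metis le_add_diff_inverse map_append upt_add_eq_append)

lemma seg_snoc: "i \<le> j \<Longrightarrow> seg w i (Suc j) = seg w i j @ [w j]"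
  by (simp add: seg_def)

lemma seg_Cons: "i < j \<Longrightarrow> seg w i j = w i # seg w (Suc i) j"
  by (simp add: seg_def upt_conv_Cons)

lemma seg_cong: "(\<And>n. i \<le> n \<Longrightarrow> n < j \<Longrightarrow> w n = w' n) \<Longrightarrow> seg w i j = seg w' i j"
  by (simp add: seg_def)

definition multiplicative :: "('l list \<Rightarrow> 'c) \<Rightarrow> bool" where
  "multiplicative h \<longleftrightarrow> (\<forall>u u' v v'. h u = h u' \<longrightarrow> h v = h v' \<longrightarrow> h (u @ v) = h (u' @ v'))"

lemma multiplicativeD: "multiplicative h \<Longrightarrow> h u = h u' \<Longrightarrow> h v = h v' \<Longrightarrow> h (u @ v) = h (u' @ v')"
  unfolding multiplicative_def by blast

text \<open>Omega-regularity in algebraic form: membership depends only on the sequence of types of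
  a factorization into nonempty factors, and the two words may be cut at different places. One
  implication is enough, as the two words can be swapped.\<close>

definition recognizes :: "('l list \<Rightarrow> 'c) \<Rightarrow> (nat \<Rightarrow> 'l) set \<Rightarrow> bool" where
  "recognizes h L \<longleftrightarrow> finite (range h) \<and> multiplicative h \<and>
    (\<forall>w w' f f'. strict_mono f \<longrightarrow> f 0 = 0 \<longrightarrow> strict_mono f' \<longrightarrow> f' 0 = 0 \<longrightarrow>
       (\<forall>k. h (seg w (f k) (f (Suc k))) = h (seg w' (f' k) (f' (Suc k)))) \<longrightarrow>
       w \<in> L \<longrightarrow> w' \<in> L)"

text \<open>A definition cannot quantify over the result type of \<open>h\<close>;
  \<open>nat\<close> has room for every finite range, as \<open>recognizes_imp_recognizable\<close>
  shows.\<close>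

definition recognizable :: "(nat \<Rightarrow> 'l) set \<Rightarrow> bool" where
  "recognizable L \<longleftrightarrow> (\<exists>h :: 'l list \<Rightarrow> nat. recognizes h L)"

lemma recognizesI:
  assumes "finite (range h)"
    and "\<And>u u' v v'. h u = h u' \<Longrightarrow> h v = h v' \<Longrightarrow> h (u @ v) = h (u' @ v')"
    and "\<And>w w' f f'. strict_mono f \<Longrightarrow> f 0 = 0 \<Longrightarrow> strict_mono f' \<Longrightarrow> f' 0 = 0 \<Longrightarrow>
       (\<And>k. h (seg w (f k) (f (Suc k))) = h (seg w' (f' k) (f' (Suc k)))) \<Longrightarrow>
       w \<in> L \<Longrightarrow> w' \<in> L"
  shows "recognizes h L"
  unfolding recognizes_def multiplicative_def using assms by blast

lemma recognizes_finite: "recognizes h L \<Longrightarrow> finite (range h)"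
  by (simp add: recognizes_def)

lemma recognizes_append:
  "recognizes h L \<Longrightarrow> h u = h u' \<Longrightarrow> h v = h v' \<Longrightarrow> h (u @ v) = h (u' @ v')"
  unfolding recognizes_def multiplicative_def by blast

lemma recognizes_mem:
  "recognizes h L \<Longrightarrow> strict_mono f \<Longrightarrow> f 0 = 0 \<Longrightarrow> strict_mono f' \<Longrightarrow> f' 0 = 0 \<Longrightarrow>
    (\<And>k. h (seg w (f k) (f (Suc k))) = h (seg w' (f' k) (f' (Suc k)))) \<Longrightarrow> w \<in> L \<Longrightarrow> w' \<in> L"
  unfolding recognizes_def by blast

lemma recognizes_imp_recognizable:
  fixes h :: "'l list \<Rightarrow> 'c"
  assumes "recognizes h L"
  shows "recognizable L"
proof -
  obtain g :: "'c \<Rightarrow> nat" where g: "inj_on g (range h)"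
    using finite_imp_inj_to_nat_seg[OF recognizes_finite[OF assms]] by blast
  have eq: "g (h u) = g (h v) \<longleftrightarrow> h u = h v" for u v
    using g by (simp add: inj_on_eq_iff)
  have "finite (range (\<lambda>u. g (h u)))"
    using finite_imageI[OF recognizes_finite[OF assms], of g] by (simp add: image_image)
  then have "recognizes (\<lambda>u. g (h u)) L"
    using assms unfolding recognizes_def multiplicative_def eq by blast
  then show ?thesis
    unfolding recognizable_def by blast
qed

text \<open>The membership clause of \<open>recognizes\<close> is symmetric in the two words, so the
  same \<open>h\<close> serves the complement.\<close>

lemma recognizable_compl:
  assumes "recognizable L"
  shows "recognizable (- L)"
proof -
  obtain h :: "_ \<Rightarrow> nat" where h: "recognizes h L"
    using assms unfolding recognizable_def by blast
  have "recognizes h (- L)"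
  proof (rule recognizesI)
    show "finite (range h)"
      by (rule recognizes_finite[OF h])
  next
    fix u u' v v' assume "h u = h u'" "h v = h v'"
    then show "h (u @ v) = h (u' @ v')"
      by (rule recognizes_append[OF h])
  next
    fix w w' and f f' :: "nat \<Rightarrow> nat"
    assume f: "strict_mono f" "f 0 = 0" "strict_mono f'" "f' 0 = 0"
      and "\<And>k. h (seg w (f k) (f (Suc k))) = h (seg w' (f' k) (f' (Suc k)))" "w \<in> - L"
    then show "w' \<in> - L"
      using recognizes_mem[OF h f(3,4,1,2)] by (metis ComplD ComplI)
  qed
  then show ?thesis
    unfolding recognizable_def by blast
qed

lemma recognizable_inter:
  assumes "recognizable L" "recognizable L'"
  shows "recognizable (L \<inter> L')"
proof -
  obtain h h' :: "_ \<Rightarrow> nat" where h: "recognizes h L" and h': "recognizes h' L'"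
    using assms unfolding recognizable_def by blast
  have "recognizes (\<lambda>u. (h u, h' u)) (L \<inter> L')"
  proof (rule recognizesI)
    have "range (\<lambda>u. (h u, h' u)) \<subseteq> range h \<times> range h'"
      by blast
    then show "finite (range (\<lambda>u. (h u, h' u)))"
      using recognizes_finite[OF h] recognizes_finite[OF h'] finite_subset by blast
  next
    fix u u' v v' assume "(h u, h' u) = (h u', h' u')" "(h v, h' v) = (h v', h' v')"
    then show "(h (u @ v), h' (u @ v)) = (h (u' @ v'), h' (u' @ v'))"
      using recognizes_append[OF h, of u u' v v'] recognizes_append[OF h', of u u' v v'] by simp
  next
    fix w w' and f f' :: "nat \<Rightarrow> nat"
    assume f: "strict_mono f" "f 0 = 0" "strict_mono f'" "f' 0 = 0"
      and "\<And>k. (h (seg w (f k) (f (Suc k))), h' (seg w (f k) (f (Suc k)))) =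
        (h (seg w' (f' k) (f' (Suc k))), h' (seg w' (f' k) (f' (Suc k))))" "w \<in> L \<inter> L'"
    then show "w' \<in> L \<inter> L'"
      using recognizes_mem[OF h f, of w w'] recognizes_mem[OF h' f, of w w'] by simp
  qed
  then show ?thesis
    by (rule recognizes_imp_recognizable)
qed

section \<open>Factorizations and closure under projection\<close>

lemma ex_factor:
  fixes f :: "nat \<Rightarrow> nat"
  assumes f: "strict_mono f" "f 0 = 0"
  shows "\<exists>k. f k \<le> n \<and> n < f (Suc k)"
proof (induction n)
  case 0
  have "f 0 < f (Suc 0)"
    by (rule strict_monoD[OF f(1)]) simp
  then show ?case
    using f(2) by (intro exI[of _ 0]) simp
next
  case (Suc n)
  then obtain k where k: "f k \<le> n" "n < f (Suc k)"
    by blast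
  have "f (Suc k) < f (Suc (Suc k))"
    by (rule strict_monoD[OF f(1)]) simp
  then show ?case
    using k by (cases "Suc n < f (Suc k)") (auto intro: exI[of _ k] exI[of _ "Suc k"])
qed

lemma factor_unique:
  fixes f :: "nat \<Rightarrow> nat"
  assumes "strict_mono f" "f k \<le> n" "n < f (Suc k)" "f l \<le> n" "n < f (Suc l)"
  shows "k = l"
proof -
  have "f k < f (Suc l)" "f l < f (Suc k)"
    using assms(2-) by linarith+
  then have "k < Suc l" "l < Suc k"
    using strict_mono_less[OF assms(1)] by blast+
  then show ?thesis
    by simp
qed

text \<open>Powerset construction: the type of a word is the set of types of all words related to it
  letter by letter. A witness for \<open>w\<close> is carried over to \<open>w'\<close> by replacing
  each of its factors by a word of equal type and gluing the pieces.\<close>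

lemma recognizable_proj:
  assumes "recognizable L"
  shows "recognizable {w. \<exists>v \<in> L. \<forall>k. R (w k) (v k)}"
proof -
  obtain h :: "_ \<Rightarrow> nat" where h: "recognizes h L"
    using assms unfolding recognizable_def by blast
  define H where "H u = h ` {v. list_all2 R u v}" for u
  have "recognizes H {w. \<exists>v \<in> L. \<forall>k. R (w k) (v k)}"
  proof (rule recognizesI)
    have "range H \<subseteq> Pow (range h)"
      unfolding H_def by blast
    then show "finite (range H)"
      using recognizes_finite[OF h] finite_subset by blast
  next
    have sub: "H (u @ v) \<subseteq> H (u' @ v')" if *: "H u = H u'" "H v = H v'" for u u' v v'
    proof
      fix x assume "x \<in> H (u @ v)"
      then obtain y z where yz: "x = h (y @ z)" "list_all2 R u y" "list_all2 R v z"
        unfolding H_def by (auto simp: list_all2_append1)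
      then have "h y \<in> H u'" "h z \<in> H v'"
        unfolding *[symmetric] by (auto simp: H_def)
      then obtain y' z' where y'z': "h y' = h y" "h z' = h z" "list_all2 R u' y'" "list_all2 R v' z'"
        unfolding H_def by auto
      have "list_all2 R (u' @ v') (y' @ z')"
        using y'z'(3,4) by (rule list_all2_appendI)
      moreover have "x = h (y' @ z')"
        unfolding yz(1) using y'z'(1,2) by (intro recognizes_append[OF h]) simp_all
      ultimately show "x \<in> H (u' @ v')"
        unfolding H_def by blast
    qed
    show "H (u @ v) = H (u' @ v')" if "H u = H u'" "H v = H v'" for u u' v v'
      using sub[OF that] sub[OF that[symmetric]] by (rule equalityI)
  next
    fix w w' and f f' :: "nat \<Rightarrow> nat"
    assume f: "strict_mono f" "f 0 = 0" "strict_mono f'" "f' 0 = 0"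
      and eq: "\<And>k. H (seg w (f k) (f (Suc k))) = H (seg w' (f' k) (f' (Suc k)))"
      and "w \<in> {w. \<exists>v \<in> L. \<forall>k. R (w k) (v k)}"
    then obtain v where v: "v \<in> L" "\<And>k. R (w k) (v k)"
      by blast
    have "\<exists>u. h u = h (seg v (f k) (f (Suc k))) \<and> list_all2 R (seg w' (f' k) (f' (Suc k))) u" for k
    proof -
      have "list_all2 R (seg w (f k) (f (Suc k))) (seg v (f k) (f (Suc k)))"
        by (simp add: list_all2_conv_all_nth nth_seg v(2))
      then have "h (seg v (f k) (f (Suc k))) \<in> H (seg w' (f' k) (f' (Suc k)))"
        unfolding eq[symmetric] by (simp add: H_def)
      then show ?thesis
        unfolding H_def by force
    qed
    then obtain u where u: "\<And>k. h (u k) = h (seg v (f k) (f (Suc k)))"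
      "\<And>k. list_all2 R (seg w' (f' k) (f' (Suc k))) (u k)"
      by metis
    \<comment> \<open>\<open>K n\<close> is the factor of \<open>w'\<close> that contains position
      n; it serves to glue the words \<open>u k\<close> into one infinite word.\<close>
    define K where "K n = (SOME k. f' k \<le> n \<and> n < f' (Suc k))" for n
    have K: "f' (K n) \<le> n" "n < f' (Suc (K n))" for n
      using someI_ex[OF ex_factor[OF f(3,4), of n]] unfolding K_def by auto
    define v' where "v' n = u (K n) ! (n - f' (K n))" for n
    have len: "length (u k) = f' (Suc k) - f' k" for k
      using list_all2_lengthD[OF u(2)[of k]] by simp
    have K_eq: "K (f' k + n) = k" if "n < f' (Suc k) - f' k" for k n
      using factor_unique[OF f(3) K[of "f' k + n"], of k] that by simp
    have "seg v' (f' k) (f' (Suc k)) = u k" for k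
      by (rule nth_equalityI) (simp_all add: len nth_seg v'_def K_eq)
    then have "v' \<in> L"
      using u(1) by (intro recognizes_mem[OF h f _ v(1)]) simp
    moreover have "R (w' n) (v' n)" for n
      using list_all2_nthD[OF u(2)[of "K n"], of "n - f' (K n)"] K[of n]
      by (simp add: v'_def nth_seg diff_less_mono)
    ultimately show "w' \<in> {w. \<exists>v \<in> L. \<forall>k. R (w k) (v k)}"
      by blast
  qed
  then show ?thesis
    by (rule recognizes_imp_recognizable)
qed

text \<open>The type of a nonempty word records its first and last value under \<open>g\<close> and
  whether its inner pairs satisfy \<open>Q\<close>; a pair across a cut is seen by the last value on
  its left and the first value on its right. Letters come from an infinite type later on, so the
  finite target of \<open>g\<close> is what keeps the range of \<open>h\<close> finite.\<close>

lemma recognizable_local: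
  fixes g :: "'l \<Rightarrow> 'c::finite"
  shows "recognizable {w. \<forall>k. Q (g (w k)) (g (w (Suc k)))}"
proof -
  define ok where "ok u \<longleftrightarrow> (\<forall>i. Suc i < length u \<longrightarrow> Q (g (u ! i)) (g (u ! Suc i)))" for u
  define h where "h u = (if u = [] then None else Some (g (hd u), g (last u), ok u))" for u
  have ok_append: "ok (u @ v) \<longleftrightarrow> ok u \<and> ok v \<and> Q (g (last u)) (g (hd v))"
    if ne: "u \<noteq> []" "v \<noteq> []" for u v
  proof safe
    assume ok: "ok (u @ v)"
    show "ok u"
      unfolding ok_def
    proof safe
      fix i assume "Suc i < length u"
      then show "Q (g (u ! i)) (g (u ! Suc i))"
        using ok[unfolded ok_def, rule_format, of i] by (simp add: nth_append)
    qed
    show "ok v"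
      unfolding ok_def
    proof safe
      fix i assume "Suc i < length v"
      then show "Q (g (v ! i)) (g (v ! Suc i))"
        using ok[unfolded ok_def, rule_format, of "length u + i"] by (simp add: nth_append)
    qed
    show "Q (g (last u)) (g (hd v))"
      using ok[unfolded ok_def, rule_format, of "length u - 1"] ne
      by (simp add: nth_append last_conv_nth hd_conv_nth)
  next
    assume *: "ok u" "ok v" "Q (g (last u)) (g (hd v))"
    show "ok (u @ v)"
      unfolding ok_def
    proof safe
      fix i assume i: "Suc i < length (u @ v)"
      consider "Suc i < length u" | "Suc i = length u" | "length u \<le> i"
        by linarith
      then show "Q (g ((u @ v) ! i)) (g ((u @ v) ! Suc i))"
      proof cases
        case 1
        then show ?thesis
          using *(1) by (simp add: ok_def nth_append)
      next
        case 2
        then have "(u @ v) ! i = last u" "(u @ v) ! Suc i = hd v"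
          using ne by (simp_all add: nth_append last_conv_nth hd_conv_nth flip: 2)
        then show ?thesis
          using *(3) by simp
      next
        case 3
        then show ?thesis
          using *(2)[unfolded ok_def, rule_format, of "i - length u"] i
          by (simp add: nth_append Suc_diff_le)
      qed
    qed
  qed
  have "recognizes h {w. \<forall>k. Q (g (w k)) (g (w (Suc k)))}"
  proof (rule recognizesI)
    show "finite (range h)"
      by (rule finite)
  next
    fix u u' v v' assume "h u = h u'" "h v = h v'"
    then show "h (u @ v) = h (u' @ v')"
      by (auto simp: h_def ok_append split: if_splits)
  next
    fix w w' and f f' :: "nat \<Rightarrow> nat"
    assume f: "strict_mono f" "f 0 = 0" "strict_mono f'" "f' 0 = 0"
      and eq: "\<And>k. h (seg w (f k) (f (Suc k))) = h (seg w' (f' k) (f' (Suc k)))"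
      and "w \<in> {w. \<forall>k. Q (g (w k)) (g (w (Suc k)))}"
    then have w: "Q (g (w k)) (g (w (Suc k)))" for k
      by blast
    have lt: "f k < f (Suc k)" "f' k < f' (Suc k)" for k
      using f by (simp_all add: strict_monoD)
    have h_seg: "h (seg v i j) = Some (g (v i), g (v (j - 1)), ok (seg v i j))"
      if "i < j" for i j and v :: "nat \<Rightarrow> 'l"
      using that by (simp add: h_def seg_def hd_map last_map)
    have eq': "g (w (f k)) = g (w' (f' k))" "g (w (f (Suc k) - 1)) = g (w' (f' (Suc k) - 1))"
      "ok (seg w (f k) (f (Suc k))) = ok (seg w' (f' k) (f' (Suc k)))" for k
      using eq[of k] unfolding h_seg[OF lt(1)] h_seg[OF lt(2)] by simp_all
    have "Q (g (w' n)) (g (w' (Suc n)))" for n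
    proof -
      obtain k where k: "f' k \<le> n" "n < f' (Suc k)"
        using ex_factor[OF f(3,4)] by blast
      show ?thesis
      proof (cases "Suc n < f' (Suc k)")
        case True
        have "ok (seg w (f k) (f (Suc k)))"
          by (simp add: ok_def nth_seg w)
        then have "Q (g (seg w' (f' k) (f' (Suc k)) ! (n - f' k)))
            (g (seg w' (f' k) (f' (Suc k)) ! Suc (n - f' k)))"
          using k True unfolding eq'(3) by (simp add: ok_def)
        then show ?thesis
          using k True by (simp add: nth_seg)
      next
        \<comment> \<open>Position n is the last of its factor, so the pair straddles the cut before
          factor \<open>Suc k\<close>.\<close>
        case False
        then have "f' (Suc k) = Suc n"
          using k by simp
        then have "g (w' n) = g (w (f (Suc k) - 1))" "g (w' (Suc n)) = g (w (f (Suc k)))"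
          using eq'(2)[of k] eq'(1)[of "Suc k"] by simp_all
        then show ?thesis
          using w[of "f (Suc k) - 1"] lt(1)[of k] by simp
      qed
    qed
    then show "w' \<in> {w. \<forall>k. Q (g (w k)) (g (w (Suc k)))}"
      by blast
  qed
  then show ?thesis
    by (rule recognizes_imp_recognizable)
qed

lemma recognizable_pointwise: "recognizable {w. \<forall>k. Q (w k)}"
  using recognizable_local[where g = Q and Q = "\<lambda>a b. a"] by simp

lemma recognizable_init: "recognizable {w. Q (w 0)}"
proof -
  define h where "h u = (if u = [] then None else Some (Q (hd u)))" for u
  have "recognizes h {w. Q (w 0)}"
  proof (rule recognizesI)
    show "finite (range h)"
      by (rule finite)
  next
    fix u u' v v' assume "h u = h u'" "h v = h v'"
    then show "h (u @ v) = h (u' @ v')"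
      by (auto simp: h_def split: if_splits)
  next
    fix w w' and f f' :: "nat \<Rightarrow> nat"
    assume f: "strict_mono f" "f 0 = 0" "strict_mono f'" "f' 0 = 0"
      and eq: "\<And>k. h (seg w (f k) (f (Suc k))) = h (seg w' (f' k) (f' (Suc k)))"
      and w: "w \<in> {w. Q (w 0)}"
    have "f 0 < f (Suc 0)" "f' 0 < f' (Suc 0)"
      by (rule strict_monoD[OF f(1)] strict_monoD[OF f(3)], simp)+
    then show "w' \<in> {w. Q (w 0)}"
      using eq[of 0] w f by (simp add: h_def seg_def hd_map split: if_splits)
  qed
  then show ?thesis
    by (rule recognizes_imp_recognizable)
qed

section \<open>Graphs of formulas on a chain are recognizable\<close>

text \<open>A chain, with the atoms and the valuation on it, is encoded as an infinite word of letters
  that are sets of bits; a finite chain is padded with letters that lack \<open>Alive\<close>.\<close>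

datatype 'a bit = Alive | AtomBit "'a atom" | VarBit nat

definition bits :: "(nat \<Rightarrow> 'b set) \<Rightarrow> 'b \<Rightarrow> nat set" where
  "bits w b = {k. b \<in> w k}"

definition upd :: "(nat \<Rightarrow> 'b set) \<Rightarrow> 'b \<Rightarrow> nat set \<Rightarrow> nat \<Rightarrow> 'b set" where
  "upd w b U = (\<lambda>k. if k \<in> U then insert b (w k) else w k - {b})"

lemma mem_bits [simp]: "k \<in> bits w b \<longleftrightarrow> b \<in> w k"
  by (simp add: bits_def)

lemma bits_upd [simp]: "bits (upd w b U) c = (if c = b then U else bits w c)"
  by (auto simp: bits_def upd_def)

lemma mem_upd: "c \<in> upd w b U k \<longleftrightarrow> (if c = b then k \<in> U else c \<in> w k)"
  by (simp add: upd_def)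

text \<open>Quantifying over a set is projection along the relation of agreeing outside the track
  \<open>b\<close>. With complement and intersection this provides the connectives and set
  quantifiers of monadic second-order logic.\<close>

lemma recognizable_ex:
  assumes "recognizable L"
  shows "recognizable {w. \<exists>U. upd w b U \<in> L}"
proof -
  have "(\<exists>U. upd w b U \<in> L) \<longleftrightarrow> (\<exists>v \<in> L. \<forall>k. w k - {b} = v k - {b})" for w
  proof
    assume "\<exists>U. upd w b U \<in> L"
    then obtain U where "upd w b U \<in> L"
      by blast
    then show "\<exists>v \<in> L. \<forall>k. w k - {b} = v k - {b}"
      by (rule bexI[rotated]) (auto simp: upd_def)
  next
    assume "\<exists>v \<in> L. \<forall>k. w k - {b} = v k - {b}"
    then obtain v where v: "v \<in> L" "\<And>k. w k - {b} = v k - {b}"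
      by blast
    have "upd w b (bits v b) = v"
    proof
      fix k
      show "upd w b (bits v b) k = v k"
        using v(2)[of k] by (auto simp: upd_def)
    qed
    then show "\<exists>U. upd w b U \<in> L"
      using v(1) by metis
  qed
  then show ?thesis
    using recognizable_proj[OF assms, of "\<lambda>a a'. a - {b} = a' - {b}"] by simp
qed

text \<open>Semantics on an encoded chain: the global and the class modality of one direction become
  the same shift of the index, and atoms and variables are read from tracks of the word. The
  backward case is guarded against index 0 because 0 - 1 = 0 in the naturals.\<close>

primrec csem :: "'a fm \<Rightarrow> (nat \<Rightarrow> 'a bit set) \<Rightarrow> nat set" where
  "csem (Var x) w = bits w Alive \<inter> bits w (VarBit x)"
| "csem (Atom A) w = bits w Alive \<inter> bits w (AtomBit A)"
| "csem (NegAtom A) w = bits w Alive - bits w (AtomBit A)"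
| "csem (Mod m \<phi>) w = {k \<in> bits w Alive.
     if m \<in> {XG, XC} then Suc k \<in> csem \<phi> w else k \<noteq> 0 \<and> k - 1 \<in> csem \<phi> w}"
| "csem (Or \<phi> \<psi>) w = csem \<phi> w \<union> csem \<psi> w"
| "csem (And \<phi> \<psi>) w = csem \<phi> w \<inter> csem \<psi> w"
| "csem (Mu x \<phi>) w = lfp (\<lambda>U. csem \<phi> (upd w (VarBit x) U))"
| "csem (Nu x \<phi>) w = gfp (\<lambda>U. csem \<phi> (upd w (VarBit x) U))"

lemma csem_mono:
  assumes "bits w Alive = bits w' Alive" "\<And>A. bits w (AtomBit A) = bits w' (AtomBit A)"
    "\<And>x. x \<in> fv \<phi> \<Longrightarrow> bits w (VarBit x) \<subseteq> bits w' (VarBit x)"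
  shows "csem \<phi> w \<subseteq> csem \<phi> w'"
  using assms
proof (induction \<phi> arbitrary: w w')
  case (Mod m \<phi>)
  have "csem \<phi> w \<subseteq> csem \<phi> w'"
    by (rule Mod.IH) (use Mod.prems in simp_all)
  then show ?case
    using Mod.prems(1) by (auto split: if_splits)
next
  case (Or \<phi> \<psi>)
  have "csem \<phi> w \<subseteq> csem \<phi> w'"
    by (rule Or.IH) (use Or.prems in simp_all)
  moreover have "csem \<psi> w \<subseteq> csem \<psi> w'"
    by (rule Or.IH) (use Or.prems in simp_all)
  ultimately show ?case
    by auto
next
  case (And \<phi> \<psi>)
  have "csem \<phi> w \<subseteq> csem \<phi> w'"
    by (rule And.IH) (use And.prems in simp_all)
  moreover have "csem \<psi> w \<subseteq> csem \<psi> w'"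
    by (rule And.IH) (use And.prems in simp_all)
  ultimately show ?case
    by auto
next
  case (Mu x \<phi>)
  have "csem \<phi> (upd w (VarBit x) U) \<subseteq> csem \<phi> (upd w' (VarBit x) U)" for U
    by (rule Mu.IH) (use Mu.prems in simp_all)
  then show ?case
    by (simp add: lfp_mono)
next
  case (Nu x \<phi>)
  have "csem \<phi> (upd w (VarBit x) U) \<subseteq> csem \<phi> (upd w' (VarBit x) U)" for U
    by (rule Nu.IH) (use Nu.prems in simp_all)
  then show ?case
    by (simp add: gfp_mono)
qed auto

lemma csem_cong:
  assumes "bits w Alive = bits w' Alive" "\<And>A. bits w (AtomBit A) = bits w' (AtomBit A)"
    "\<And>x. x \<in> fv \<phi> \<Longrightarrow> bits w (VarBit x) = bits w' (VarBit x)"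
  shows "csem \<phi> w = csem \<phi> w'"
  by (intro equalityI csem_mono) (simp_all add: assms)

lemma mono_csem: "mono (\<lambda>U. csem \<phi> (upd w (VarBit x) U))"
  by (intro monoI csem_mono) simp_all

lemma csem_subset_alive: "csem \<phi> w \<subseteq> bits w Alive"
proof (induction \<phi> arbitrary: w)
  case (Mu x \<phi>)
  show ?case
    unfolding csem.simps by (subst lfp_unfold[OF mono_csem]) (use Mu in fastforce)
next
  case (Nu x \<phi>)
  show ?case
    unfolding csem.simps by (subst gfp_unfold[OF mono_csem]) (use Nu in fastforce)
qed auto

lemma csem_upd_fresh: "y \<notin> fv \<phi> \<Longrightarrow> csem \<phi> (upd w (VarBit y) U) = csem \<phi> w"
  by (rule csem_cong) auto

text \<open>Bound variables are included because \<open>Mu x\<close> and \<open>Nu x\<close>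
  overwrite the track of x: a track that stores a result must differ from every binder
  below.\<close>

primrec vars :: "'a fm \<Rightarrow> nat set" where
  "vars (Var x) = {x}"
| "vars (Atom A) = {}"
| "vars (NegAtom A) = {}"
| "vars (Mod m \<phi>) = vars \<phi>"
| "vars (Or \<phi> \<psi>) = vars \<phi> \<union> vars \<psi>"
| "vars (And \<phi> \<psi>) = vars \<phi> \<union> vars \<psi>"
| "vars (Mu x \<phi>) = insert x (vars \<phi>)"
| "vars (Nu x \<phi>) = insert x (vars \<phi>)"

lemma finite_vars: "finite (vars \<phi>)"
  by (induction \<phi>) simp_all

lemma fv_subset_vars: "fv \<phi> \<subseteq> vars \<phi>"
  by (induction \<phi>) auto

lemma finite_fv: "finite (fv \<phi>)"
  using finite_subset[OF fv_subset_vars finite_vars] .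

lemma ex_fresh: "finite (A :: nat set) \<Longrightarrow> \<exists>x. x \<notin> A"
  using ex_new_if_finite[OF infinite_UNIV_nat] .

abbreviation graph :: "'a fm \<Rightarrow> nat \<Rightarrow> (nat \<Rightarrow> 'a bit set) set" where
  "graph \<phi> y \<equiv> {w. bits w (VarBit y) = csem \<phi> w}"

text \<open>A formula may be used as a set term: a fresh track z is quantified and constrained to
  the graph of \<phi>, so its only possible value is \<open>csem \<phi> w\<close>.\<close>

lemma recognizable_subst:
  assumes "z \<notin> fv \<phi>" "recognizable (graph \<phi> z)" "recognizable K"
  shows "recognizable {w. upd w (VarBit z) (csem \<phi> w) \<in> K}"
proof -
  have "{w. \<exists>U. upd w (VarBit z) U \<in> graph \<phi> z \<inter> K} = {w. upd w (VarBit z) (csem \<phi> w) \<in> K}"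
    using csem_upd_fresh[OF assms(1)] by auto
  then show ?thesis
    using recognizable_ex[OF recognizable_inter[OF assms(2,3)], of "VarBit z"] by simp
qed

text \<open>Knaster-Tarski in a form with a single set quantifier, which
  \<open>recognizable_ex\<close> and complementation can express.\<close>

lemma lfp_eq_iff:
  assumes "mono f"
  shows "Y = lfp f \<longleftrightarrow> f Y = Y \<and> (\<forall>U. f U \<subseteq> U \<longrightarrow> Y \<subseteq> U)"
proof
  assume "Y = lfp f"
  then show "f Y = Y \<and> (\<forall>U. f U \<subseteq> U \<longrightarrow> Y \<subseteq> U)"
    using lfp_fixpoint[OF assms] lfp_lowerbound[of f] by auto
next
  assume Y: "f Y = Y \<and> (\<forall>U. f U \<subseteq> U \<longrightarrow> Y \<subseteq> U)"
  show "Y = lfp f"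
    by (rule equalityI) (use Y lfp_greatest[of f Y] lfp_lowerbound[of f Y] in auto)
qed

lemma gfp_eq_iff:
  assumes "mono f"
  shows "Y = gfp f \<longleftrightarrow> f Y = Y \<and> (\<forall>U. U \<subseteq> f U \<longrightarrow> U \<subseteq> Y)"
proof
  assume "Y = gfp f"
  then show "f Y = Y \<and> (\<forall>U. U \<subseteq> f U \<longrightarrow> U \<subseteq> Y)"
    using gfp_fixpoint[OF assms] gfp_upperbound[of _ f] by auto
next
  assume Y: "f Y = Y \<and> (\<forall>U. U \<subseteq> f U \<longrightarrow> U \<subseteq> Y)"
  show "Y = gfp f"
    by (rule equalityI) (use Y gfp_least[of f Y] gfp_upperbound[of Y f] in auto)
qed

lemma recognizable_subset_bits: "recognizable {w. bits w b \<subseteq> bits w c}"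
  using recognizable_pointwise[of "\<lambda>a. b \<in> a \<longrightarrow> c \<in> a"] by (simp add: subset_iff)

lemma recognizable_eq_bits: "recognizable {w. bits w b = bits w c}"
  using recognizable_pointwise[of "\<lambda>a. b \<in> a \<longleftrightarrow> c \<in> a"] by (simp add: set_eq_iff)

text \<open>The induction follows the translation of the \<mu>-calculus into monadic second-order
  logic: subformulas are evaluated into fresh tracks, and the outermost operator becomes a condition
  on these tracks.\<close>

lemma recognizable_graph: "y \<notin> vars \<phi> \<Longrightarrow> recognizable (graph \<phi> y)"
proof (induction \<phi> arbitrary: y)
  case (Var x)
  show ?case
    using recognizable_pointwise[of "\<lambda>a. VarBit y \<in> a \<longleftrightarrow> Alive \<in> a \<and> VarBit x \<in> a"]
    by (simp add: set_eq_iff)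
next
  case (Atom A)
  show ?case
    using recognizable_pointwise[of "\<lambda>a. VarBit y \<in> a \<longleftrightarrow> Alive \<in> a \<and> AtomBit A \<in> a"]
    by (simp add: set_eq_iff)
next
  case (NegAtom A)
  show ?case
    using recognizable_pointwise[of "\<lambda>a. VarBit y \<in> a \<longleftrightarrow> Alive \<in> a \<and> AtomBit A \<notin> a"]
    by (simp add: set_eq_iff)
next
  case (Mod m \<phi>)
  obtain z where z: "z \<notin> insert y (vars \<phi>)"
    using ex_fresh[of "insert y (vars \<phi>)"] finite_vars by auto
  define g where "g a = (VarBit y \<in> a, Alive \<in> a, VarBit z \<in> a)" for a :: "'a bit set"
  \<comment> \<open>The track z will hold the value of the argument. Failure of a backward modality
    at index 0 is a separate condition, because the local condition constrains \<open>Suc k\<close>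
    only.\<close>
  define K :: "(nat \<Rightarrow> 'a bit set) set" where "K = (if m \<in> {XG, XC}
    then {w. \<forall>k. VarBit y \<in> w k \<longleftrightarrow> Alive \<in> w k \<and> VarBit z \<in> w (Suc k)}
    else {w. VarBit y \<notin> w 0} \<inter>
      {w. \<forall>k. VarBit y \<in> w (Suc k) \<longleftrightarrow> Alive \<in> w (Suc k) \<and> VarBit z \<in> w k})"
  have "recognizable K"
    using recognizable_local[where g = g and Q = "\<lambda>(a, b, c) (a', b', c'). a \<longleftrightarrow> b \<and> c'"]
      recognizable_inter[OF recognizable_init[of "\<lambda>a. VarBit y \<notin> a"]
        recognizable_local[where g = g and Q = "\<lambda>(a, b, c) (a', b', c'). a' \<longleftrightarrow> b' \<and> c"]]
    by (auto simp: K_def g_def)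
  moreover have "upd w (VarBit z) (csem \<phi> w) \<in> K \<longleftrightarrow> w \<in> graph (Mod m \<phi>) y" for w
  proof (cases "m \<in> {XG, XC}")
    case True
    then show ?thesis
      using z by (auto simp: K_def mem_upd set_eq_iff)
  next
    case False
    have "(\<forall>k. VarBit y \<in> w k \<longleftrightarrow> Alive \<in> w k \<and> k \<noteq> 0 \<and> k - 1 \<in> csem \<phi> w) \<longleftrightarrow>
      VarBit y \<notin> w 0 \<and> (\<forall>k. VarBit y \<in> w (Suc k) \<longleftrightarrow> Alive \<in> w (Suc k) \<and> k \<in> csem \<phi> w)"
      (is "All ?P \<longleftrightarrow> ?Q")
    proof
      assume ?Q
      then have "?P k" for k
        by (cases k) simp_all
      then show "All ?P" ..
    qed (use spec[of ?P 0] spec[of ?P "Suc _"] in auto)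
    with False show ?thesis
      using z by (auto simp: K_def mem_upd set_eq_iff)
  qed
  moreover have "z \<notin> fv \<phi>" "recognizable (graph \<phi> z)"
    using z Mod.IH[of z] fv_subset_vars[of \<phi>] by auto
  ultimately show ?case
    using recognizable_subst[of z \<phi> K] by simp
next
  case (Or \<phi> \<psi>)
  obtain z where z: "z \<notin> insert y (vars \<phi> \<union> vars \<psi>)"
    using ex_fresh[of "insert y (vars \<phi> \<union> vars \<psi>)"] finite_vars by auto
  obtain z' where z': "z' \<notin> insert z (insert y (vars \<phi> \<union> vars \<psi>))"
    using ex_fresh[of "insert z (insert y (vars \<phi> \<union> vars \<psi>))"] finite_vars by auto
  have fr: "z \<notin> fv \<phi>" "z \<notin> fv \<psi>" "z' \<notin> fv \<psi>"
    using z z' fv_subset_vars[of \<phi>] fv_subset_vars[of \<psi>] by auto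
  have "recognizable {w. bits w (VarBit y) = bits w (VarBit z) \<union> bits w (VarBit z')}"
    using recognizable_pointwise[of "\<lambda>a. VarBit y \<in> a \<longleftrightarrow> VarBit z \<in> a \<or> VarBit z' \<in> a"]
    by (simp add: set_eq_iff)
  from recognizable_subst[OF fr(3) _ this]
  have "recognizable {w. bits w (VarBit y) = bits w (VarBit z) \<union> csem \<psi> w}"
    using Or.IH(2)[of z'] z z' by simp
  from recognizable_subst[OF fr(1) _ this] show ?case
    using Or.IH(1)[of z] z by (simp add: csem_upd_fresh[OF fr(2)])
next
  case (And \<phi> \<psi>)
  obtain z where z: "z \<notin> insert y (vars \<phi> \<union> vars \<psi>)"
    using ex_fresh[of "insert y (vars \<phi> \<union> vars \<psi>)"] finite_vars by auto
  obtain z' where z': "z' \<notin> insert z (insert y (vars \<phi> \<union> vars \<psi>))"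
    using ex_fresh[of "insert z (insert y (vars \<phi> \<union> vars \<psi>))"] finite_vars by auto
  have fr: "z \<notin> fv \<phi>" "z \<notin> fv \<psi>" "z' \<notin> fv \<psi>"
    using z z' fv_subset_vars[of \<phi>] fv_subset_vars[of \<psi>] by auto
  have "recognizable {w. bits w (VarBit y) = bits w (VarBit z) \<inter> bits w (VarBit z')}"
    using recognizable_pointwise[of "\<lambda>a. VarBit y \<in> a \<longleftrightarrow> VarBit z \<in> a \<and> VarBit z' \<in> a"]
    by (simp add: set_eq_iff)
  from recognizable_subst[OF fr(3) _ this]
  have "recognizable {w. bits w (VarBit y) = bits w (VarBit z) \<inter> csem \<psi> w}"
    using And.IH(2)[of z'] z z' by simp
  from recognizable_subst[OF fr(1) _ this] show ?case
    using And.IH(1)[of z] z by (simp add: csem_upd_fresh[OF fr(2)])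
next
  case (Mu x \<phi>)
  obtain z where z: "z \<notin> insert x (insert y (vars \<phi>))"
    using ex_fresh[of "insert x (insert y (vars \<phi>))"] finite_vars by auto
  have fr: "y \<noteq> x" "y \<notin> fv \<phi>" "z \<notin> fv \<phi>" "z \<noteq> x" "z \<noteq> y"
    using z Mu.prems fv_subset_vars[of \<phi>] by auto
  \<comment> \<open>\<open>A\<close> says that the track y is a fixpoint, and \<open>B\<close> that
    some prefixed point on the track x does not contain it.\<close>
  define A where "A = {w. \<exists>U. upd w (VarBit x) U \<in>
    graph \<phi> y \<inter> {w. bits w (VarBit x) = bits w (VarBit y)}}"
  define B where "B = {w. \<exists>U. upd w (VarBit x) U \<in> {w. upd w (VarBit z) (csem \<phi> w) \<in>
    {w. bits w (VarBit z) \<subseteq> bits w (VarBit x)} \<inter> - {w. bits w (VarBit y) \<subseteq> bits w (VarBit x)}}}"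
  have "recognizable (A \<inter> - B)"
    unfolding A_def B_def
    by (intro recognizable_inter recognizable_compl recognizable_ex recognizable_eq_bits
      recognizable_subset_bits recognizable_subst Mu.IH) (use fr z Mu.prems in auto)
  moreover have "w \<in> A \<inter> - B \<longleftrightarrow> w \<in> graph (Mu x \<phi>) y" for w
    using fr by (auto simp: A_def B_def lfp_eq_iff[OF mono_csem])
  ultimately show ?case
    by (simp only: set_eqI[of "A \<inter> - B" "graph (Mu x \<phi>) y"])
next
  case (Nu x \<phi>)
  obtain z where z: "z \<notin> insert x (insert y (vars \<phi>))"
    using ex_fresh[of "insert x (insert y (vars \<phi>))"] finite_vars by auto
  have fr: "y \<noteq> x" "y \<notin> fv \<phi>" "z \<notin> fv \<phi>" "z \<noteq> x" "z \<noteq> y"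
    using z Nu.prems fv_subset_vars[of \<phi>] by auto
  define A where "A = {w. \<exists>U. upd w (VarBit x) U \<in>
    graph \<phi> y \<inter> {w. bits w (VarBit x) = bits w (VarBit y)}}"
  define B where "B = {w. \<exists>U. upd w (VarBit x) U \<in> {w. upd w (VarBit z) (csem \<phi> w) \<in>
    {w. bits w (VarBit x) \<subseteq> bits w (VarBit z)} \<inter> - {w. bits w (VarBit x) \<subseteq> bits w (VarBit y)}}}"
  have "recognizable (A \<inter> - B)"
    unfolding A_def B_def
    by (intro recognizable_inter recognizable_compl recognizable_ex recognizable_eq_bits
      recognizable_subset_bits recognizable_subst Nu.IH) (use fr z Nu.prems in auto)
  moreover have "w \<in> A \<inter> - B \<longleftrightarrow> w \<in> graph (Nu x \<phi>) y" for w
    using fr by (auto simp: A_def B_def gfp_eq_iff[OF mono_csem])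
  ultimately show ?case
    by (simp only: set_eqI[of "A \<inter> - B" "graph (Nu x \<phi>) y"])
qed

section \<open>Decomposition at a position\<close>

text \<open>With a single marked position this language asks whether \<phi> holds there, so a
  property of positions becomes a property of words.\<close>

lemma recognizable_query:
  assumes "z \<notin> fv \<phi>"
  shows "recognizable {w. bits w (VarBit z) \<subseteq> csem \<phi> w}"
proof -
  obtain y where y: "y \<notin> insert z (vars \<phi>)"
    using ex_fresh[of "insert z (vars \<phi>)"] finite_vars by auto
  then have "y \<notin> fv \<phi>"
    using fv_subset_vars by auto
  from recognizable_subst[OF this recognizable_graph recognizable_subset_bits[of "VarBit z" "VarBit y"]]
  show ?thesis
    using y by simp
qed

text \<open>Ramsey's theorem for the colouring of pairs of positions by the type of the factor
  between them. All cuts lie beyond k, so that a marked position k stays in the initial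
  factor.\<close>

lemma ramsey_factorization:
  fixes h :: "'l list \<Rightarrow> nat"
  assumes "finite (range h)"
  shows "\<exists>f e. strict_mono f \<and> k < f 0 \<and> (\<forall>i. h (seg w (f i) (f (Suc i))) = e)"
proof -
  obtain b where b: "\<And>u. h u < b"
    using assms finite_nat_set_iff_bounded[of "range h"] by auto
  define col where "col S = h (seg w (Min S) (Max S))" for S
  have "infinite {k<..}"
    by (simp add: infinite_Ioi)
  then obtain Y e where Y: "Y \<subseteq> {k<..}" "infinite Y"
    and e: "\<forall>x \<in> Y. \<forall>y \<in> Y. x \<noteq> y \<longrightarrow> col {x, y} = e"
    using Ramsey2[of "{k<..}" col b] b by (auto simp: col_def)
  have "strict_mono (enumerate Y)"
    using Y(2) by (simp add: strict_mono_enumerate)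
  moreover have "k < enumerate Y 0"
    using Y enumerate_in_set[OF Y(2), of 0] by auto
  moreover have "h (seg w (enumerate Y i) (enumerate Y (Suc i))) = e" for i
  proof -
    have lt: "enumerate Y i < enumerate Y (Suc i)"
      using Y(2) by (rule enumerate_step)
    then have "col {enumerate Y i, enumerate Y (Suc i)} = e"
      using e enumerate_in_set[OF Y(2)] less_imp_neq by blast
    then show ?thesis
      using lt by (simp add: col_def max_def min_def)
  qed
  ultimately show ?thesis
    by blast
qed

text \<open>The bit \<open>VarBit z\<close> marks the position \<open>k\<close> at which \<open>\<phi>\<close> is evaluated; the second
  equivalence treats the words that encode a chain with \<open>n\<close> positions.\<close>

lemma csem_decomposition:
  fixes \<phi> :: "'a fm"
  assumes z: "z \<notin> fv \<phi>"
  shows "\<exists>(h :: 'a bit set list \<Rightarrow> nat) G G'. finite (range h) \<and> multiplicative h \<and>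
    (\<forall>w k. bits w (VarBit z) = {} \<longrightarrow> (k \<in> csem \<phi> w \<longleftrightarrow>
      (\<exists>s e f. (h (seg w 0 k), s, e) \<in> G \<and> strict_mono f \<and> k < f 0 \<and>
        h (insert (VarBit z) (w k) # seg w (Suc k) (f 0)) = s \<and>
        (\<forall>i. h (seg w (f i) (f (Suc i))) = e)))) \<and>
    (\<forall>w k n. bits w (VarBit z) = {} \<longrightarrow> k < n \<longrightarrow> (\<forall>i \<ge> n. w i = {}) \<longrightarrow>
      (k \<in> csem \<phi> w \<longleftrightarrow> (h (seg w 0 k), h (insert (VarBit z) (w k) # seg w (Suc k) n)) \<in> G'))"
proof -
  define L where "L = {w. bits w (VarBit z) \<subseteq> csem \<phi> w}"
  obtain h :: "'a bit set list \<Rightarrow> nat" where h: "recognizes h L"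
    using recognizable_query[OF z] unfolding L_def recognizable_def by blast
  \<comment> \<open>Here t is the type of the strict prefix, s that of the marked position together
    with the rest up to \<open>f 0\<close>, and e the type that repeats from \<open>f 0\<close>
    on.\<close>
  define split where "split w k t s e f \<longleftrightarrow> bits w (VarBit z) = {} \<and> h (seg w 0 k) = t \<and>
    strict_mono f \<and> k < f 0 \<and> h (insert (VarBit z) (w k) # seg w (Suc k) (f 0)) = s \<and>
    (\<forall>i. h (seg w (f i) (f (Suc i))) = e)" for w k t s e and f :: "nat \<Rightarrow> nat"
  have invariant: "k' \<in> csem \<phi> w'"
    if "split w k t s e f" "split w' k' t s e f'" "k \<in> csem \<phi> w" for w k w' k' t s e f f'
  proof -
    have mark: "upd w (VarBit z) {k} \<in> L \<longleftrightarrow> k \<in> csem \<phi> w" for w k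
      by (simp add: L_def csem_upd_fresh[OF z])
    \<comment> \<open>\<open>case_nat 0 f\<close> adds 0 as the first cut. The first factor then
      consists of the prefix and the marked part, and its type is determined by t and s.\<close>
    have mono: "strict_mono (case_nat 0 f)" if "split w k t s e f" for w k f
    proof -
      have "strict_mono f" "0 < f 0"
        using that by (auto simp: split_def)
      then show ?thesis
        by (auto simp: strict_mono_Suc_iff split: nat.split)
    qed
    have fresh: "upd w (VarBit z) {k} n = w n" if "split w k t s e f" "n \<noteq> k" for w k f n
      using that by (auto simp: split_def upd_def bits_def)
    have first: "h (seg (upd w (VarBit z) {k}) 0 (f 0)) = h (seg w 0 k @ (insert (VarBit z) (w k) # seg w (Suc k) (f 0)))"
      if sp: "split w k t s e f" for w k f
    proof -
      have k: "k < f 0"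
        using sp by (simp add: split_def)
      have "seg (upd w (VarBit z) {k}) 0 (f 0) = seg (upd w (VarBit z) {k}) 0 k @
          seg (upd w (VarBit z) {k}) k (Suc k) @ seg (upd w (VarBit z) {k}) (Suc k) (f 0)"
        using k by (simp add: seg_append)
      also have "\<dots> = seg w 0 k @ (insert (VarBit z) (w k) # seg w (Suc k) (f 0))"
        using fresh[OF sp] by (simp add: seg_def upd_def)
      finally show ?thesis
        by simp
    qed
    have rest: "h (seg (upd w (VarBit z) {k}) (f i) (f (Suc i))) = e"
      if sp: "split w k t s e f" for w k f i
    proof -
      have "k < f i"
        using sp by (metis split_def le0 strict_mono_less_eq order_less_le_trans)
      then have "seg (upd w (VarBit z) {k}) (f i) (f (Suc i)) = seg w (f i) (f (Suc i))"
        using fresh[OF sp] by (intro seg_cong) simp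
      then show ?thesis
        using sp by (simp add: split_def)
    qed
    have "upd w' (VarBit z) {k'} \<in> L"
    proof (rule recognizes_mem[OF h mono[OF that(1)] _ mono[OF that(2)]])
      show "upd w (VarBit z) {k} \<in> L"
        using that(3) by (simp add: mark)
      show "h (seg (upd w (VarBit z) {k}) (case_nat 0 f i) (case_nat 0 f (Suc i))) =
          h (seg (upd w' (VarBit z) {k'}) (case_nat 0 f' i) (case_nat 0 f' (Suc i)))" for i
      proof (cases i)
        case 0
        have "h (seg w 0 k @ (insert (VarBit z) (w k) # seg w (Suc k) (f 0))) =
          h (seg w' 0 k' @ (insert (VarBit z) (w' k') # seg w' (Suc k') (f' 0)))"
          using that(1,2) by (intro recognizes_append[OF h]) (simp_all add: split_def)
        then show ?thesis
          using 0 first[OF that(1)] first[OF that(2)] by simp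
      next
        case (Suc n)
        then show ?thesis
          using rest[OF that(1)] rest[OF that(2)] by simp
      qed
    qed simp_all
    then show ?thesis
      by (simp add: mark)
  qed
  \<comment> \<open>The triples realized by at least one satisfied position; by
    \<open>invariant\<close>, such a triple guarantees satisfaction wherever it is realized.\<close>
  define G where "G = {(t, s, e). \<exists>w k f. split w k t s e f \<and> k \<in> csem \<phi> w}"
  define G' where "G' = {(t, s). \<exists>w k n. bits w (VarBit z) = {} \<and> k < n \<and> (\<forall>i \<ge> n. w i = {}) \<and>
    h (seg w 0 k) = t \<and> h (insert (VarBit z) (w k) # seg w (Suc k) n) = s \<and> k \<in> csem \<phi> w}"
  show ?thesis
  proof (intro exI[of _ h] exI[of _ G] exI[of _ G'] conjI allI impI)
    show "finite (range h)"
      by (rule recognizes_finite[OF h])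
    show "multiplicative h"
      using h by (simp add: recognizes_def)
  next
    fix w :: "nat \<Rightarrow> 'a bit set" and k
    assume w: "bits w (VarBit z) = {}"
    obtain f e where f: "strict_mono f" "k < f 0" "\<And>i. h (seg w (f i) (f (Suc i))) = e"
      using ramsey_factorization[OF recognizes_finite[OF h]] by blast
    show "k \<in> csem \<phi> w \<longleftrightarrow>
      (\<exists>s e f. (h (seg w 0 k), s, e) \<in> G \<and> strict_mono f \<and> k < f 0 \<and>
        h (insert (VarBit z) (w k) # seg w (Suc k) (f 0)) = s \<and>
        (\<forall>i. h (seg w (f i) (f (Suc i))) = e))"
    proof
      assume k: "k \<in> csem \<phi> w"
      have "split w k (h (seg w 0 k)) (h (insert (VarBit z) (w k) # seg w (Suc k) (f 0))) e f"
        using w f by (simp add: split_def)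
      then have "(h (seg w 0 k), h (insert (VarBit z) (w k) # seg w (Suc k) (f 0)), e) \<in> G"
        using k unfolding G_def by blast
      then show "\<exists>s e f. (h (seg w 0 k), s, e) \<in> G \<and> strict_mono f \<and> k < f 0 \<and>
        h (insert (VarBit z) (w k) # seg w (Suc k) (f 0)) = s \<and>
        (\<forall>i. h (seg w (f i) (f (Suc i))) = e)"
        using f by blast
    next
      assume "\<exists>s e f. (h (seg w 0 k), s, e) \<in> G \<and> strict_mono f \<and> k < f 0 \<and>
        h (insert (VarBit z) (w k) # seg w (Suc k) (f 0)) = s \<and>
        (\<forall>i. h (seg w (f i) (f (Suc i))) = e)"
      then obtain s e f where "(h (seg w 0 k), s, e) \<in> G" "split w k (h (seg w 0 k)) s e f"
        using w by (auto simp: split_def)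
      then show "k \<in> csem \<phi> w"
        unfolding G_def using invariant by blast
    qed
  next
    fix w :: "nat \<Rightarrow> 'a bit set" and k n
    assume w: "bits w (VarBit z) = {}" "k < n" "\<forall>i \<ge> n. w i = {}"
    \<comment> \<open>The cuts \<open>(+) n\<close> split the padding into single empty letters. The
      repeated type is thus the constant \<open>h [{}]\<close> and need not be recorded in
      \<open>G'\<close>.\<close>
    have sp: "split w k (h (seg w 0 k)) (h (insert (VarBit z) (w k) # seg w (Suc k) n)) (h [{}]) ((+) n)"
      if "bits w (VarBit z) = {}" "k < n" "\<forall>i \<ge> n. w i = {}" for w k n
      using that by (simp add: split_def strict_mono_def seg_def)
    show "k \<in> csem \<phi> w \<longleftrightarrow>
      (h (seg w 0 k), h (insert (VarBit z) (w k) # seg w (Suc k) n)) \<in> G'"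
    proof
      assume "k \<in> csem \<phi> w"
      then show "(h (seg w 0 k), h (insert (VarBit z) (w k) # seg w (Suc k) n)) \<in> G'"
        unfolding G'_def using w by blast
    next
      assume "(h (seg w 0 k), h (insert (VarBit z) (w k) # seg w (Suc k) n)) \<in> G'"
      then obtain w' k' n' where w': "bits w' (VarBit z) = {}" "k' < n'" "\<forall>i \<ge> n'. w' i = {}"
        "h (seg w' 0 k') = h (seg w 0 k)"
        "h (insert (VarBit z) (w' k') # seg w' (Suc k') n') = h (insert (VarBit z) (w k) # seg w (Suc k) n)"
        "k' \<in> csem \<phi> w'"
        unfolding G'_def mem_Collect_eq case_prod_conv by (elim exE conjE)
      have "split w' k' (h (seg w 0 k)) (h (insert (VarBit z) (w k) # seg w (Suc k) n))
        (h [{}]) ((+) n')"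
        using sp[OF w'(1-3)] w'(4,5) by simp
      then show "k \<in> csem \<phi> w"
        using sp[OF w] w'(6) by (rule invariant)
    qed
  qed
qed

section \<open>Definable relations and Kleene's theorem\<close>

text \<open>A formula with free variables in \<open>X\<close> is rephrased over twice as many variables:
  \<open>2 * x\<close> stands for \<open>x\<close> and \<open>2 * x + 1\<close> for its complement.\<close>

definition doubled :: "nat set \<Rightarrow> nat set" where
  "doubled X = (\<lambda>x. 2 * x) ` X \<union> (\<lambda>x. 2 * x + 1) ` X"

definition complementary :: "('a, 'd) dword \<Rightarrow> nat set \<Rightarrow> (nat \<Rightarrow> nat set) \<Rightarrow> bool" where
  "complementary W X \<rho> \<longleftrightarrow> (\<forall>x \<in> X. \<rho> (2 * x + 1) = positions W - \<rho> (2 * x))"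

text \<open>Only variables from \<open>X\<close> are recorded: with a finite alphabet and finite
  \<open>X\<close> the letters come from a finite set, which makes every property of letters
  definable.\<close>

definition labelling :: "('a, 'd) dword \<Rightarrow> nat set \<Rightarrow> (nat \<Rightarrow> nat set) \<Rightarrow> nat \<Rightarrow> 'a bit set" where
  "labelling W X \<rho> i = insert Alive (AtomBit ` {A. holds_at W A i} \<union> VarBit ` {x \<in> X. i \<in> \<rho> (2 * x)})"

definition bits_over :: "nat set \<Rightarrow> 'a bit set" where
  "bits_over X = insert Alive (range AtomBit \<union> VarBit ` X)"

lemma labelling_subset: "labelling W X \<rho> i \<subseteq> bits_over X"
  by (auto simp: labelling_def bits_over_def)

lemma labelling_simps [simp]:
  "Alive \<in> labelling W X \<rho> i"
  "AtomBit A \<in> labelling W X \<rho> i \<longleftrightarrow> holds_at W A i"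
  "VarBit x \<in> labelling W X \<rho> i \<longleftrightarrow> x \<in> X \<and> i \<in> \<rho> (2 * x)"
  by (auto simp: labelling_def)

lemma finite_bits_over:
  assumes "finite X"
  shows "finite (bits_over X :: 'a::finite bit set)"
proof -
  have "A \<in> range Letter \<union> {AtS, AtP, FirstG, LastG, FirstC, LastC}" for A :: "'a atom"
    by (cases A) auto
  then have "finite (UNIV :: 'a atom set)"
    by (intro finite_subset[of UNIV "range Letter \<union> {AtS, AtP, FirstG, LastG, FirstC, LastC}"]) auto
  then show ?thesis
    using assms by (simp add: bits_over_def)
qed

lemma complementary_fresh: "x \<notin> doubled X \<Longrightarrow> complementary W X (\<rho>(x := U)) \<longleftrightarrow> complementary W X \<rho>"
  by (auto simp: complementary_def doubled_def)

lemma labelling_fresh: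
  assumes "x \<notin> doubled X"
  shows "labelling W X (\<rho>(x := U)) = labelling W X \<rho>"
proof -
  have "2 * y \<noteq> x" if "y \<in> X" for y
    using that assms by (auto simp: doubled_def)
  then have "{y \<in> X. i \<in> (\<rho>(x := U)) (2 * y)} = {y \<in> X. i \<in> \<rho> (2 * y)}" for i
    by auto
  then show ?thesis
    by (simp add: labelling_def fun_eq_iff)
qed

lemma sem_cong: "(\<And>x. x \<in> fv \<phi> \<Longrightarrow> \<rho> x = \<rho>' x) \<Longrightarrow> sem w \<phi> \<rho> = sem w \<phi> \<rho>'"
proof (induction \<phi> arbitrary: \<rho> \<rho>')
  case (Mod m \<phi>)
  have "sem w \<phi> \<rho> = sem w \<phi> \<rho>'"
    by (rule Mod.IH) (simp add: Mod.prems)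
  then show ?case
    by simp
next
  case (Or \<phi> \<psi>)
  have "sem w \<phi> \<rho> = sem w \<phi> \<rho>'" "sem w \<psi> \<rho> = sem w \<psi> \<rho>'"
    by (rule Or.IH; simp add: Or.prems)+
  then show ?case
    by simp
next
  case (And \<phi> \<psi>)
  have "sem w \<phi> \<rho> = sem w \<phi> \<rho>'" "sem w \<psi> \<rho> = sem w \<psi> \<rho>'"
    by (rule And.IH; simp add: And.prems)+
  then show ?case
    by simp
next
  case (Mu x \<phi>)
  have "sem w \<phi> (\<rho>(x := U)) = sem w \<phi> (\<rho>'(x := U))" for U
    by (rule Mu.IH) (simp add: Mu.prems)
  then show ?case
    by simp
next
  case (Nu x \<phi>)
  have "sem w \<phi> (\<rho>(x := U)) = sem w \<phi> (\<rho>'(x := U))" for U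
    by (rule Nu.IH) (simp add: Nu.prems)
  then show ?case
    by simp
qed simp_all

section \<open>Modality-free tests of the letter at a position\<close>

definition top_fm :: "'a fm" where
  "top_fm = Or (Atom FirstG) (NegAtom FirstG)"

definition bot_fm :: "'a fm" where
  "bot_fm = And (Atom FirstG) (NegAtom FirstG)"

lemma top_fm_simps [simp]:
  "sem w top_fm \<rho> = positions w" "fv top_fm = {}" "modalities top_fm = {}"
  by (auto simp: top_fm_def)

lemma bot_fm_simps [simp]:
  "sem w bot_fm \<rho> = {}" "fv bot_fm = {}" "modalities bot_fm = {}"
  by (auto simp: bot_fm_def)

text \<open>The argument of type \<open>itself\<close> fixes the data domain, which occurs in no
  other argument; the same device is used below.\<close>

definition testable :: "('a, 'd) dword itself \<Rightarrow> nat set \<Rightarrow> ('a bit set \<Rightarrow> bool) \<Rightarrow> bool" where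
  "testable _ X P \<longleftrightarrow> (\<exists>\<chi>. modalities \<chi> = {} \<and> fv \<chi> \<subseteq> doubled X \<and>
    (\<forall>(W :: ('a, 'd) dword) \<rho>. valuation W \<rho> \<longrightarrow> complementary W X \<rho> \<longrightarrow>
      sem W \<chi> \<rho> = {i \<in> positions W. P (labelling W X \<rho> i)}))"

lemma testable_const: "testable T X (\<lambda>_. b)"
  unfolding testable_def by (rule exI[of _ "if b then top_fm else bot_fm"]) simp

lemma testable_conj:
  assumes "testable T X P" "testable T X Q"
  shows "testable T X (\<lambda>a. P a \<and> Q a)"
proof -
  from assms obtain \<chi> \<chi>' where "modalities \<chi> = {}" "fv \<chi> \<subseteq> doubled X"
    "modalities \<chi>' = {}" "fv \<chi>' \<subseteq> doubled X"
    "\<And>(W :: ('a, 'b) dword) \<rho>. valuation W \<rho> \<Longrightarrow> complementary W X \<rho> \<Longrightarrow>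
      sem W \<chi> \<rho> = {i \<in> positions W. P (labelling W X \<rho> i)}"
    "\<And>(W :: ('a, 'b) dword) \<rho>. valuation W \<rho> \<Longrightarrow> complementary W X \<rho> \<Longrightarrow>
      sem W \<chi>' \<rho> = {i \<in> positions W. Q (labelling W X \<rho> i)}"
    unfolding testable_def by blast
  then show ?thesis
    unfolding testable_def by (intro exI[of _ "And \<chi> \<chi>'"]) auto
qed

lemma testable_disj:
  assumes "testable T X P" "testable T X Q"
  shows "testable T X (\<lambda>a. P a \<or> Q a)"
proof -
  from assms obtain \<chi> \<chi>' where "modalities \<chi> = {}" "fv \<chi> \<subseteq> doubled X"
    "modalities \<chi>' = {}" "fv \<chi>' \<subseteq> doubled X"
    "\<And>(W :: ('a, 'b) dword) \<rho>. valuation W \<rho> \<Longrightarrow> complementary W X \<rho> \<Longrightarrow>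
      sem W \<chi> \<rho> = {i \<in> positions W. P (labelling W X \<rho> i)}"
    "\<And>(W :: ('a, 'b) dword) \<rho>. valuation W \<rho> \<Longrightarrow> complementary W X \<rho> \<Longrightarrow>
      sem W \<chi>' \<rho> = {i \<in> positions W. Q (labelling W X \<rho> i)}"
    unfolding testable_def by blast
  then show ?thesis
    unfolding testable_def by (intro exI[of _ "Or \<chi> \<chi>'"]) auto
qed

text \<open>This is where the complement variables are used: the absence of a variable bit is not a
  negated atom and is expressed by the variable of odd index.\<close>

lemma testable_bit:
  assumes "b \<in> bits_over X"
  shows "testable T X (\<lambda>a. b \<in> a \<longleftrightarrow> c)"
proof (cases b)
  case Alive
  then show ?thesis
    unfolding testable_def by (intro exI[of _ "if c then top_fm else bot_fm"]) simp
next
  case (AtomBit A)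
  then show ?thesis
    unfolding testable_def by (intro exI[of _ "if c then Atom A else NegAtom A"]) auto
next
  case (VarBit x)
  then have "x \<in> X"
    using assms by (auto simp: bits_over_def)
  then have "2 * x \<in> doubled X" "2 * x + 1 \<in> doubled X"
    "complementary W X \<rho> \<Longrightarrow> \<rho> (Suc (2 * x)) = positions W - \<rho> (2 * x)" for W :: "('a, 'b) dword" and \<rho>
    by (auto simp: doubled_def complementary_def)
  then show ?thesis
    unfolding testable_def using VarBit \<open>x \<in> X\<close>
    by (intro exI[of _ "if c then Var (2 * x) else Var (2 * x + 1)"]) (auto simp: valuation_def)
qed

lemma testable_ball:
  assumes "finite I" "\<And>i. i \<in> I \<Longrightarrow> testable T X (P i)"
  shows "testable T X (\<lambda>a. \<forall>i \<in> I. P i a)"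
  using assms by (induction I) (simp_all add: testable_const testable_conj)

lemma testable_bex:
  assumes "finite I" "\<And>i. i \<in> I \<Longrightarrow> testable T X (P i)"
  shows "testable T X (\<lambda>a. \<exists>i \<in> I. P i a)"
  using assms by (induction I) (simp_all add: testable_const testable_disj)

text \<open>Disjunctive normal form over the finitely many bits.\<close>

lemma testable_any:
  fixes T :: "('a::finite, 'd) dword itself"
  assumes "finite X"
  shows "testable T X P"
proof -
  have "testable T X (\<lambda>a. \<exists>a' \<in> {a' \<in> Pow (bits_over X). P a'}. \<forall>b \<in> bits_over X. b \<in> a \<longleftrightarrow> b \<in> a')"
    by (intro testable_bex testable_ball testable_bit) (simp_all add: finite_bits_over assms)
  moreover have "(\<exists>a' \<in> {a' \<in> Pow (bits_over X). P a'}. \<forall>b \<in> bits_over X. b \<in> labelling W X \<rho> i \<longleftrightarrow> b \<in> a') \<longleftrightarrow>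
      P (labelling W X \<rho> i)" for W :: "('a, 'd) dword" and \<rho> i
  proof
    assume "\<exists>a' \<in> {a' \<in> Pow (bits_over X). P a'}. \<forall>b \<in> bits_over X. b \<in> labelling W X \<rho> i \<longleftrightarrow> b \<in> a'"
    then obtain a' where a': "a' \<subseteq> bits_over X" "P a'"
      "\<forall>b \<in> bits_over X. b \<in> labelling W X \<rho> i \<longleftrightarrow> b \<in> a'"
      by blast
    then have "labelling W X \<rho> i = a'"
      using labelling_subset[of W X \<rho> i] by blast
    then show "P (labelling W X \<rho> i)"
      using a'(2) by simp
  next
    assume "P (labelling W X \<rho> i)"
    then show "\<exists>a' \<in> {a' \<in> Pow (bits_over X). P a'}. \<forall>b \<in> bits_over X. b \<in> labelling W X \<rho> i \<longleftrightarrow> b \<in> a'"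
      using labelling_subset[of W X \<rho> i] by blast
  qed
  ultimately show ?thesis
    by (simp add: testable_def)
qed

section \<open>Formula contexts as diamonds of dynamic logic\<close>

type_synonym ('a, 'd) prel = "('a, 'd) dword \<Rightarrow> (nat \<Rightarrow> 'a bit set) \<Rightarrow> nat rel"

text \<open>\<open>F\<close> is a context around a formula, like the diamond of a program in
  propositional dynamic logic. The argument is arbitrary, so contexts can be nested and can be
  applied to a fixpoint variable.\<close>

definition diamond :: "modality \<Rightarrow> nat set \<Rightarrow> ('a, 'd) prel \<Rightarrow> ('a fm \<Rightarrow> 'a fm) \<Rightarrow> bool" where
  "diamond m X r F \<longleftrightarrow> (\<forall>\<phi>. modalities (F \<phi>) \<subseteq> insert m (modalities \<phi>) \<and>
    fv (F \<phi>) \<subseteq> doubled X \<union> fv \<phi> \<and>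
    (\<forall>W \<rho>. valuation W \<rho> \<longrightarrow> complementary W X \<rho> \<longrightarrow>
      sem W (F \<phi>) \<rho> = {i. \<exists>j. (i, j) \<in> r W (labelling W X \<rho>) \<and> j \<in> sem W \<phi> \<rho>}))"

definition definable :: "modality \<Rightarrow> nat set \<Rightarrow> ('a, 'd) prel \<Rightarrow> bool" where
  "definable m X r \<longleftrightarrow> (\<exists>F. diamond m X r F)"

lemma diamond_modalities: "diamond m X r F \<Longrightarrow> modalities (F \<phi>) \<subseteq> insert m (modalities \<phi>)"
  unfolding diamond_def by blast

lemma diamond_fv: "diamond m X r F \<Longrightarrow> fv (F \<phi>) \<subseteq> doubled X \<union> fv \<phi>"
  unfolding diamond_def by blast

lemma diamond_sem:
  "diamond m X r F \<Longrightarrow> valuation W \<rho> \<Longrightarrow> complementary W X \<rho> \<Longrightarrow>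
    sem W (F \<phi>) \<rho> = {i. \<exists>j. (i, j) \<in> r W (labelling W X \<rho>) \<and> j \<in> sem W \<phi> \<rho>}"
  unfolding diamond_def by blast

lemma definable_empty: "definable m X (\<lambda>W l. {})"
  unfolding definable_def diamond_def by (intro exI[of _ "\<lambda>_. bot_fm"]) simp

lemma definable_Id: "definable m X (\<lambda>W l. Id)"
  unfolding definable_def diamond_def by (intro exI[of _ id]) auto

lemma definable_Un:
  assumes "definable m X r" "definable m X s"
  shows "definable m X (\<lambda>W l. r W l \<union> s W l)"
proof -
  obtain F G where "diamond m X r F" "diamond m X s G"
    using assms unfolding definable_def by blast
  then have "diamond m X (\<lambda>W l. r W l \<union> s W l) (\<lambda>\<phi>. Or (F \<phi>) (G \<phi>))"
    unfolding diamond_def by auto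
  then show ?thesis
    unfolding definable_def by blast
qed

lemma definable_UN:
  assumes "finite I" "\<And>i. i \<in> I \<Longrightarrow> definable m X (r i)"
  shows "definable m X (\<lambda>W l. \<Union>i \<in> I. r i W l)"
  using assms by (induction I) (simp_all add: definable_empty definable_Un)

lemma definable_relcomp:
  fixes r s :: "('a, 'd) prel"
  assumes "definable m X r" "definable m X s"
  shows "definable m X (\<lambda>W l. r W l O s W l)"
proof -
  obtain F G where F: "diamond m X r F" and G: "diamond m X s G"
    using assms unfolding definable_def by blast
  have "diamond m X (\<lambda>W l. r W l O s W l) (\<lambda>\<phi>. F (G \<phi>))"
    unfolding diamond_def
  proof (intro allI conjI impI)
    fix \<phi>
    show "modalities (F (G \<phi>)) \<subseteq> insert m (modalities \<phi>)"
      using diamond_modalities[OF F, of "G \<phi>"] diamond_modalities[OF G, of \<phi>] by blast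
    show "fv (F (G \<phi>)) \<subseteq> doubled X \<union> fv \<phi>"
      using diamond_fv[OF F, of "G \<phi>"] diamond_fv[OF G, of \<phi>] by blast
    fix W :: "('a, 'd) dword" and \<rho> assume "valuation W \<rho>" "complementary W X \<rho>"
    then show "sem W (F (G \<phi>)) \<rho> = {i. \<exists>j. (i, j) \<in> r W (labelling W X \<rho>) O s W (labelling W X \<rho>) \<and>
      j \<in> sem W \<phi> \<rho>}"
      by (auto simp: diamond_sem[OF F] diamond_sem[OF G])
  qed
  then show ?thesis
    unfolding definable_def by blast
qed

text \<open>The diamond of the iterated relation is the least solution x of
  \<open>Or \<phi> (F (Var x))\<close>. The bound variable depends on the argument, in which it must
  not occur free.\<close>

lemma definable_rtrancl:
  fixes r :: "('a, 'd) prel"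
  assumes "finite X" "definable m X r"
  shows "definable m X (\<lambda>W l. (r W l)\<^sup>*)"
proof -
  obtain F where F: "diamond m X r F"
    using assms unfolding definable_def by blast
  define x where "x \<phi> = (SOME x. x \<notin> doubled X \<union> fv \<phi>)" for \<phi> :: "'a fm"
  have "finite (doubled X \<union> fv \<phi>)" for \<phi> :: "'a fm"
    using assms(1) finite_fv by (simp add: doubled_def)
  then have x: "x \<phi> \<notin> doubled X" "x \<phi> \<notin> fv \<phi>" for \<phi>
    using someI_ex[OF ex_fresh[of "doubled X \<union> fv \<phi>"]] unfolding x_def by auto
  define S where "S \<phi> = Mu (x \<phi>) (Or \<phi> (F (Var (x \<phi>))))" for \<phi>
  have "diamond m X (\<lambda>W l. (r W l)\<^sup>*) S"
    unfolding diamond_def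
  proof (intro allI conjI impI)
    fix \<phi>
    show "modalities (S \<phi>) \<subseteq> insert m (modalities \<phi>)"
      using diamond_modalities[OF F, of "Var (x \<phi>)"] by (auto simp: S_def)
    show "fv (S \<phi>) \<subseteq> doubled X \<union> fv \<phi>"
      using diamond_fv[OF F, of "Var (x \<phi>)"] by (auto simp: S_def)
    fix W :: "('a, 'd) dword" and \<rho> assume val: "valuation W \<rho>" and compl: "complementary W X \<rho>"
    define R where "R = r W (labelling W X \<rho>)"
    define V where "V = {i. \<exists>j. (i, j) \<in> R\<^sup>* \<and> j \<in> sem W \<phi> \<rho>}"
    \<comment> \<open>The meaning of \<open>F\<close> is known for valuations only, hence the
      restriction to subsets of \<open>positions W\<close>; both \<open>V\<close> and the least
      fixpoint satisfy it.\<close>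
    have F_sem: "sem W (F (Var (x \<phi>))) (\<rho>(x \<phi> := U)) = {i. \<exists>j. (i, j) \<in> R \<and> j \<in> U}"
      and F_pos: "{i. \<exists>j. (i, j) \<in> R \<and> j \<in> U} \<subseteq> positions W"
      if "U \<subseteq> positions W" for U
    proof -
      have val': "valuation W (\<rho>(x \<phi> := U))"
        using val that by (simp add: valuation_def)
      show *: "sem W (F (Var (x \<phi>))) (\<rho>(x \<phi> := U)) = {i. \<exists>j. (i, j) \<in> R \<and> j \<in> U}"
        using diamond_sem[OF F val'] x[of \<phi>] compl
        by (simp add: complementary_fresh labelling_fresh R_def)
      show "{i. \<exists>j. (i, j) \<in> R \<and> j \<in> U} \<subseteq> positions W"
        using sem_subset_positions[OF val'] by (simp flip: *)
    qed
    have phi: "sem W \<phi> (\<rho>(x \<phi> := U)) = sem W \<phi> \<rho>" for U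
      using x(2)[of \<phi>] by (intro sem_cong) auto
    have phi_pos: "sem W \<phi> \<rho> \<subseteq> positions W"
      by (rule sem_subset_positions[OF val])
    define f where "f U = positions W \<inter> sem W (Or \<phi> (F (Var (x \<phi>)))) (\<rho>(x \<phi> := U))" for U
    have f: "f U = sem W \<phi> \<rho> \<union> {i. \<exists>j. (i, j) \<in> R \<and> j \<in> U}" if "U \<subseteq> positions W" for U
      using F_sem[OF that] F_pos[OF that] phi phi_pos by (auto simp: f_def)
    have mono: "mono f"
      unfolding f_def by (rule mono_sem_body)
    have V_pos: "V \<subseteq> positions W"
    proof
      fix i assume "i \<in> V"
      then obtain j where "(i, j) \<in> R\<^sup>*" "j \<in> sem W \<phi> \<rho>"
        by (auto simp: V_def)
      \<comment> \<open>\<open>F_pos\<close> for a singleton says that an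
        \<open>R\<close>-predecessor of a position is a position.\<close>
      then show "i \<in> positions W"
        by (induction rule: converse_rtrancl_induct) (use phi_pos F_pos[of "{_}"] in auto)
    qed
    have "f V \<subseteq> V"
      unfolding f[OF V_pos] by (auto simp: V_def intro: converse_rtrancl_into_rtrancl)
    then have "lfp f \<subseteq> V"
      by (rule lfp_lowerbound)
    moreover have "V \<subseteq> lfp f"
    proof
      have fix_f: "f (lfp f) = lfp f"
        by (rule lfp_fixpoint[OF mono])
      have "lfp f \<subseteq> positions W"
        by (subst fix_f[symmetric]) (simp add: f_def)
      note unfold_f = f[OF this, unfolded fix_f]
      fix i assume "i \<in> V"
      then obtain j where "(i, j) \<in> R\<^sup>*" "j \<in> sem W \<phi> \<rho>"
        by (auto simp: V_def)
      then show "i \<in> lfp f"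
      proof (induction rule: converse_rtrancl_induct)
        case base
        then show ?case
          by (subst unfold_f) simp
      next
        case (step y z)
        then show ?case
          by (subst unfold_f) blast
      qed
    qed
    ultimately have "lfp f = V"
      by (rule equalityI)
    then show "sem W (S \<phi>) \<rho> = {i. \<exists>j. (i, j) \<in> (r W (labelling W X \<rho>))\<^sup>* \<and> j \<in> sem W \<phi> \<rho>}"
      unfolding S_def sem.simps(7) f_def V_def R_def .
  qed
  then show ?thesis
    unfolding definable_def by blast
qed

lemma step_positions: "step m W i j \<Longrightarrow> i \<in> positions W \<and> j \<in> positions W"
  by (cases m) (auto simp: is_succ_def is_pred_def is_class_succ_def is_class_pred_def same_class_def)

lemma definable_test:
  fixes P :: "'a::finite bit set \<Rightarrow> bool"
  assumes "finite X"
  shows "definable m X (\<lambda>(W :: ('a, 'd) dword) l. {(i, i) | i. i \<in> positions W \<and> P (l i)})"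
proof -
  obtain \<chi> where "modalities \<chi> = {}" "fv \<chi> \<subseteq> doubled X"
    "\<And>(W :: ('a, 'd) dword) \<rho>. valuation W \<rho> \<Longrightarrow> complementary W X \<rho> \<Longrightarrow>
      sem W \<chi> \<rho> = {i \<in> positions W. P (labelling W X \<rho> i)}"
    using testable_any[OF assms, of "TYPE(('a, 'd) dword)" P] unfolding testable_def by blast
  then have "diamond m X (\<lambda>(W :: ('a, 'd) dword) l. {(i, i) | i. i \<in> positions W \<and> P (l i)}) (And \<chi>)"
    unfolding diamond_def by auto
  then show ?thesis
    unfolding definable_def by blast
qed

lemma definable_step: "definable m X (\<lambda>W l. {(i, j). step m W i j})"
proof -
  have "diamond m X (\<lambda>W l. {(i, j). step m W i j}) (Mod m)"
    unfolding diamond_def using step_positions by auto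
  then show ?thesis
    unfolding definable_def by blast
qed

lemma definable_step_test:
  fixes P :: "'a::finite bit set \<Rightarrow> bool"
  assumes "finite X"
  shows "definable m X (\<lambda>(W :: ('a, 'd) dword) l. {(i, j). step m W i j \<and> P (l j)})"
proof -
  have eq: "{(i, j). step m W i j} O {(i, i) | i. i \<in> positions W \<and> P (l i)} =
      {(i, j). step m W i j \<and> P (l j)}" for W :: "('a, 'd) dword" and l
    using step_positions by blast
  have "definable m X (\<lambda>(W :: ('a, 'd) dword) l.
      {(i, j). step m W i j} O {(i, i) | i. i \<in> positions W \<and> P (l i)})"
    by (intro definable_relcomp definable_step definable_test assms)
  then show ?thesis
    by (simp only: eq)
qed

text \<open>A move consumes the letter of the position it arrives at, so the letter of the starting
  position is not read. \<open>K\<close> restricts the states that a run may leave, the initial one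
  included.\<close>

definition transitions ::
    "modality \<Rightarrow> ('s \<Rightarrow> 'a bit set \<Rightarrow> 's) \<Rightarrow> 's set \<Rightarrow> ('a, 'd) dword \<Rightarrow> (nat \<Rightarrow> 'a bit set) \<Rightarrow> ('s \<times> nat) rel" where
  "transitions m \<delta> K W l = {((s, i), (s', j)). s \<in> K \<and> step m W i j \<and> s' = \<delta> s (l j)}"

definition link ::
    "modality \<Rightarrow> ('s \<Rightarrow> 'a bit set \<Rightarrow> 's) \<Rightarrow> 's set \<Rightarrow> 's \<Rightarrow> 's \<Rightarrow> ('a, 'd) prel" where
  "link m \<delta> K s s' W l = {(i, j). ((s, i), (s', j)) \<in> (transitions m \<delta> K W l)\<^sup>*}"

text \<open>A run is cut at its departures from q: it reaches q by moves from \<open>K\<close>,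
  iterates excursions back to q, and departs for the last time. The union over \<open>T\<close>
  ranges over the state entered by the departing move; it is finite when \<open>T\<close>
  is.\<close>

lemma link_insert:
  fixes \<delta> :: "'s \<Rightarrow> 'a bit set \<Rightarrow> 's" and K :: "'s set" and m :: modality
  assumes closed: "\<And>s a. s \<in> T \<Longrightarrow> \<delta> s a \<in> T" and q: "q \<in> T"
  defines "leave \<equiv> \<lambda>s' W l. \<Union>p \<in> T. {(i, j). step m W i j \<and> p = \<delta> q (l j)} O link m \<delta> K p s' W l"
  shows "link m \<delta> (insert q K) s s' W l =
    link m \<delta> K s s' W l \<union> link m \<delta> K s q W l O (leave q W l)\<^sup>* O leave s' W l"
proof -
  let ?E = "transitions m \<delta> (insert q K) W l"
  have K: "(transitions m \<delta> K W l)\<^sup>* \<subseteq> ?E\<^sup>*"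
    by (rule rtrancl_mono) (auto simp: transitions_def)
  have "((s, i), (s', j)) \<in> ?E\<^sup>*" if "(i, j) \<in> link m \<delta> K s s' W l" for s s' i j
    using that K unfolding link_def by blast
  moreover have leave: "((q, i), (s', j)) \<in> ?E\<^sup>*" if "(i, j) \<in> leave s' W l" for s' i j
  proof -
    obtain k where "step m W i k" "(k, j) \<in> link m \<delta> K (\<delta> q (l k)) s' W l"
      using \<open>(i, j) \<in> leave s' W l\<close> unfolding leave_def by blast
    then have "((q, i), (\<delta> q (l k), k)) \<in> ?E" "((\<delta> q (l k), k), (s', j)) \<in> ?E\<^sup>*"
      using K by (auto simp: transitions_def link_def)
    then show ?thesis
      by (rule converse_rtrancl_into_rtrancl)
  qed
  moreover have "((q, i), (q, j)) \<in> ?E\<^sup>*" if "(i, j) \<in> (leave q W l)\<^sup>*" for i j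
    using that by (induction rule: rtrancl_induct) (auto dest: leave)
  ultimately have "link m \<delta> K s s' W l \<union> link m \<delta> K s q W l O (leave q W l)\<^sup>* O leave s' W l
      \<subseteq> link m \<delta> (insert q K) s s' W l"
    unfolding link_def[of m \<delta> "insert q K"] by (auto intro: rtrancl_trans) (meson rtrancl_trans)
  moreover have "(i, j) \<in> link m \<delta> K s s' W l \<union> link m \<delta> K s q W l O (leave q W l)\<^sup>* O leave s' W l"
    if "((s, i), (s', j)) \<in> ?E\<^sup>*" for i j
    using that
  proof (induction "(s', j)" arbitrary: s' j rule: rtrancl_induct)
    case base
    then show ?case
      by (simp add: link_def)
  next
    case (step y s'' k)
    obtain s' j where y: "y = (s', j)"
      by (cases y)
    with step.hyps(2) have e: "s' \<in> insert q K" "step m W j k" "s'' = \<delta> s' (l k)"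
      by (auto simp: transitions_def)
    have IH: "(i, j) \<in> link m \<delta> K s s' W l \<union> link m \<delta> K s q W l O (leave q W l)\<^sup>* O leave s' W l"
      by (rule step.hyps(3)[OF y])
    have extend: "(x, k) \<in> link m \<delta> K p s'' W l" if "(x, j) \<in> link m \<delta> K p s' W l" "s' \<in> K" for x p
    proof -
      have "((s', j), (s'', k)) \<in> transitions m \<delta> K W l"
        using e that(2) by (simp add: transitions_def)
      with that(1) show ?thesis
        unfolding link_def by (auto intro: rtrancl_into_rtrancl)
    qed
    have leave_q: "(j, k) \<in> leave s'' W l" if "s' = q"
      using e(2,3) that closed[OF q] unfolding leave_def link_def by blast
    show ?case
    proof (cases "s' \<in> K")
      case True
      have "(x, k) \<in> leave s'' W l" if "(x, j) \<in> leave s' W l" for x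
        using that extend[OF _ True] unfolding leave_def by blast
      then show ?thesis
        using IH extend[OF _ True] by blast
    next
      case False
      then have "s' = q"
        using e(1) by simp
      from IH show ?thesis
      proof
        assume "(i, j) \<in> link m \<delta> K s s' W l"
        then show ?thesis
          using leave_q[OF \<open>s' = q\<close>] \<open>s' = q\<close> by blast
      next
        assume "(i, j) \<in> link m \<delta> K s q W l O (leave q W l)\<^sup>* O leave s' W l"
        then have "(i, j) \<in> link m \<delta> K s q W l O (leave q W l)\<^sup>*"
          using \<open>s' = q\<close> by (auto intro: rtrancl_into_rtrancl)
        then show ?thesis
          using leave_q[OF \<open>s' = q\<close>] by blast
      qed
    qed
  qed
  ultimately show ?thesis
    unfolding link_def[of m \<delta> "insert q K"] by blast
qed

text \<open>The inductive step is that of Kleene's theorem, adding one more state that a run may pass through.\<close>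

lemma definable_link:
  fixes \<delta> :: "'s \<Rightarrow> 'a::finite bit set \<Rightarrow> 's"
  assumes X: "finite X" and T: "finite T" and closed: "\<And>s a. s \<in> T \<Longrightarrow> \<delta> s a \<in> T"
  shows "definable m X (link m \<delta> T s s' :: ('a, 'd) prel)"
proof -
  have "definable m X (link m \<delta> K s s' :: ('a, 'd) prel)" if "K \<subseteq> T" for K s s'
    using finite_subset[OF that T] that
  proof (induction K arbitrary: s s')
    case empty
    have "transitions m \<delta> {} W l = {}" for W :: "('a, 'd) dword" and l
      by (simp add: transitions_def)
    then have "link m \<delta> {} s s' = (\<lambda>(W :: ('a, 'd) dword) l. if s = s' then Id else {})"
      by (auto simp: link_def fun_eq_iff)
    then show ?case
      by (simp add: definable_Id definable_empty)
  next
    case (insert q K)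
    define leave :: "'s \<Rightarrow> ('a, 'd) prel"
      where "leave = (\<lambda>s' W l. \<Union>p \<in> T. {(i, j). step m W i j \<and> p = \<delta> q (l j)} O link m \<delta> K p s' W l)"
    have "definable m X (leave s')" for s'
      unfolding leave_def
      using insert by (intro definable_UN definable_relcomp definable_step_test X T) auto
    then have "definable m X (\<lambda>W l. link m \<delta> K s s' W l \<union>
        link m \<delta> K s q W l O (leave q W l)\<^sup>* O leave s' W l)"
      using insert by (intro definable_Un definable_relcomp definable_rtrancl X) auto
    moreover have "link m \<delta> (insert q K) s s' = (\<lambda>W l. link m \<delta> K s s' W l \<union>
        link m \<delta> K s q W l O (leave q W l)\<^sup>* O leave s' W l)"
      unfolding leave_def using insert.prems
      by (intro ext link_insert[where \<delta> = \<delta>, OF closed]) auto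
    ultimately have "definable m X (link m \<delta> (insert q K) s s' :: ('a, 'd) prel)"
      by simp
    then show ?case .
  qed
  then show ?thesis
    by simp
qed

section \<open>Chains of a data word\<close>

text \<open>Global and class chains share the later arguments through this bundle of a forward
  modality, its converse and the atoms that mark the two ends.\<close>

definition opposite :: "modality \<Rightarrow> modality \<Rightarrow> 'a atom \<Rightarrow> 'a atom \<Rightarrow> bool" where
  "opposite mf mb afirst alast \<longleftrightarrow>
    (mf, mb, afirst, alast) = (XG, YG, FirstG, LastG) \<or> (mf, mb, afirst, alast) = (XC, YC, FirstC, LastC)"

lemma step_opposite: "opposite mf mb afirst alast \<Longrightarrow> step mb W i j \<longleftrightarrow> step mf W j i"
  by (auto simp: opposite_def is_succ_def is_pred_def is_class_succ_def is_class_pred_def same_class_def)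

lemma step_less: "opposite mf mb afirst alast \<Longrightarrow> step mf W i j \<Longrightarrow> i < j"
  by (auto simp: opposite_def is_succ_def is_class_succ_def)

lemma step_functional:
  assumes "opposite mf mb afirst alast" "step mf W i j" "step mf W i j'"
  shows "j = j'"
proof (rule ccontr)
  assume "j \<noteq> j'"
  then consider "j < j'" | "j' < j"
    by linarith
  then show False
    by cases (use assms in \<open>auto simp: opposite_def is_succ_def is_class_succ_def\<close>)
qed

lemma step_injective:
  assumes "opposite mf mb afirst alast" "step mf W i j" "step mf W i' j"
  shows "i = i'"
proof (rule ccontr)
  assume "i \<noteq> i'"
  then consider "i < i'" | "i' < i"
    by linarith
  then show False
  proof cases
    case 1
    then show ?thesis
      using assms by (auto simp: opposite_def is_succ_def is_class_succ_def same_class_def) metis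
  next
    case 2
    then show ?thesis
      using assms by (auto simp: opposite_def is_succ_def is_class_succ_def same_class_def) metis
  qed
qed

lemma holds_first:
  assumes "opposite mf mb afirst alast" "i \<in> positions W"
  shows "holds_at W afirst i \<longleftrightarrow> (\<nexists>j. step mf W j i)"
proof -
  have "Suc j \<in> positions W \<Longrightarrow> j \<in> positions W" for j
    by (cases W) auto
  then have "(\<nexists>j. is_succ W j i) \<longleftrightarrow> i = 0"
    using assms(2) by (cases i) (auto simp: is_succ_def)
  moreover have "is_class_pred W i j \<longleftrightarrow> is_class_succ W j i" for j
    using step_opposite[of XC YC FirstC LastC W i j] by (simp add: opposite_def)
  ultimately show ?thesis
    using assms(1) by (auto simp: opposite_def)
qed

lemma holds_last:
  assumes "opposite mf mb afirst alast" "i \<in> positions W"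
  shows "holds_at W alast i \<longleftrightarrow> (\<nexists>j. step mf W i j)"
  using assms by (auto simp: opposite_def is_succ_def)

text \<open>\<open>D\<close> is the index set of the chain, an initial segment of the naturals that
  may be infinite; outside \<open>D\<close> the values of \<open>c\<close> are arbitrary. Maximality
  is expressed by \<open>no_pred\<close> at the start and by \<open>Suc_mem\<close> at the
  end.\<close>

locale chain =
  fixes mf mb :: modality and afirst alast :: "'a::finite atom"
    and W :: "('a, 'd) dword" and c :: "nat \<Rightarrow> nat" and D :: "nat set"
  assumes opp: "opposite mf mb afirst alast"
    and zero: "0 \<in> D" and down: "Suc k \<in> D \<Longrightarrow> k \<in> D"
    and pos: "k \<in> D \<Longrightarrow> c k \<in> positions W"
    and step_Suc: "Suc k \<in> D \<Longrightarrow> step mf W (c k) (c (Suc k))"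
    and Suc_mem: "k \<in> D \<Longrightarrow> step mf W (c k) i \<Longrightarrow> Suc k \<in> D"
    and no_pred: "\<not> step mf W i (c 0)"

text \<open>The chain starts at the least position from which i is reachable, since a predecessor of
  it would be smaller. It continues by iterating a choice of successor, and \<open>D\<close> ends
  where the chosen value is no longer a successor.\<close>

lemma chain_exists:
  assumes opp: "opposite mf mb (afirst :: 'a::finite atom) alast" and i: "i \<in> positions W"
  shows "\<exists>c D k. chain mf mb afirst alast W c D \<and> k \<in> D \<and> c k = i"
proof -
  let ?R = "{(i, j). step mf W i j}"
  define r where "r = (LEAST r. (r, i) \<in> ?R\<^sup>*)"
  have r: "(r, i) \<in> ?R\<^sup>*"
    unfolding r_def by (rule LeastI[of _ i]) simp
  have no_pred: "\<not> step mf W j r" for j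
  proof
    assume j: "step mf W j r"
    then have "(j, i) \<in> ?R\<^sup>*"
      using r by (intro converse_rtrancl_into_rtrancl[of j r]) auto
    then have "r \<le> j"
      unfolding r_def by (rule Least_le)
    then show False
      using step_less[OF opp j] by simp
  qed
  define nxt where "nxt i = (SOME j. step mf W i j)" for i
  have nxt: "j = nxt i" if "step mf W i j" for i j
    using step_functional[OF opp that someI[of "step mf W i", OF that]] by (simp add: nxt_def)
  define c where "c k = (nxt ^^ k) r" for k
  define D where "D = {k. \<forall>l<k. step mf W (c l) (c (Suc l))}"
  have r_pos: "r \<in> positions W"
    using r by (cases rule: converse_rtranclE) (use i step_positions in auto)
  have chain: "chain mf mb afirst alast W c D"
  proof
    show "opposite mf mb afirst alast"
      by (rule opp)
    show "0 \<in> D"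
      by (simp add: D_def)
    show "k \<in> D" if "Suc k \<in> D" for k
      using that by (simp add: D_def)
    show step: "step mf W (c k) (c (Suc k))" if "Suc k \<in> D" for k
      using that by (simp add: D_def)
    show "c k \<in> positions W" if "k \<in> D" for k
    proof (cases k)
      case 0
      then show ?thesis
        using r_pos by (simp add: c_def)
    next
      case (Suc l)
      then show ?thesis
        using step_positions[OF step[of l]] that by simp
    qed
    show "Suc k \<in> D" if "k \<in> D" "step mf W (c k) i" for k i
      using that nxt[OF that(2)] by (auto simp: D_def c_def less_Suc_eq)
    show "\<not> step mf W i (c 0)" for i
      using no_pred by (simp add: c_def)
  qed
  have "\<exists>k. k \<in> D \<and> c k = i"
    using r
  proof (induction rule: rtrancl_induct)
    case base
    show ?case
      by (intro exI[of _ 0]) (simp add: D_def c_def)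
  next
    case (step y z)
    then obtain k where k: "k \<in> D" "c k = y" "step mf W y z"
      by auto
    then have "z = c (Suc k)"
      using nxt[OF k(3)] by (simp add: c_def)
    moreover have "Suc k \<in> D"
      using chain.Suc_mem[OF chain k(1)] k(2,3) by simp
    ultimately show ?case
      by blast
  qed
  then show ?thesis
    using chain by blast
qed

context chain
begin

lemma mem_mono: "j \<in> D \<Longrightarrow> k \<le> j \<Longrightarrow> k \<in> D"
  by (induction j) (auto dest: down simp: le_Suc_eq)

lemma step_iff: "k \<in> D \<Longrightarrow> step mf W (c k) i \<longleftrightarrow> Suc k \<in> D \<and> i = c (Suc k)"
  using Suc_mem step_Suc step_functional[OF opp] by blast

lemma step_back_iff: "k \<in> D \<Longrightarrow> step mb W (c k) i \<longleftrightarrow> k \<noteq> 0 \<and> i = c (k - 1)"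
  unfolding step_opposite[OF opp]
  using no_pred step_Suc[of "k - 1"] step_injective[OF opp, of W i "c k" "c (k - 1)"] by (cases k) auto

lemma holds_first_iff: "k \<in> D \<Longrightarrow> holds_at W afirst (c k) \<longleftrightarrow> k = 0"
  using holds_first[OF opp pos, of k] no_pred step_Suc[of "k - 1"] by (cases k) auto

lemma holds_last_iff: "k \<in> D \<Longrightarrow> holds_at W alast (c k) \<longleftrightarrow> Suc k \<notin> D"
  using holds_last[OF opp pos, of k] step_iff[of k] by auto

text \<open>Restriction to a chain commutes with fixpoints as soon as it commutes with the
  operators, although f acts on sets of positions and g on sets of indices.\<close>

lemma preimage_lfp:
  assumes "mono f" "mono g" and eq: "\<And>U. {k \<in> D. c k \<in> f U} = g {k \<in> D. c k \<in> U}"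
  shows "{k \<in> D. c k \<in> lfp f} = lfp g"
proof
  show "lfp g \<subseteq> {k \<in> D. c k \<in> lfp f}"
    by (rule lfp_lowerbound) (simp flip: eq add: lfp_fixpoint[OF assms(1)])
  \<comment> \<open>The largest set whose preimage under c lies in \<open>lfp g\<close>; being a
    prefixed point of f, it contains \<open>lfp f\<close>.\<close>
  define K where "K = {i. \<forall>k \<in> D. c k = i \<longrightarrow> k \<in> lfp g}"
  have "g {k \<in> D. c k \<in> K} \<subseteq> g (lfp g)"
    by (rule monoD[OF assms(2)]) (auto simp: K_def)
  then have "{k \<in> D. c k \<in> f K} \<subseteq> lfp g"
    by (simp add: eq lfp_fixpoint[OF assms(2)])
  then have "f K \<subseteq> K"
    by (auto simp: K_def)
  then have "lfp f \<subseteq> K"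
    by (rule lfp_lowerbound)
  then show "{k \<in> D. c k \<in> lfp f} \<subseteq> lfp g"
    by (auto simp: K_def)
qed

text \<open>Dually, the image under c is the left adjoint of the preimage, and the image of
  \<open>gfp g\<close> turns out to be a postfixed point of f.\<close>

lemma preimage_gfp:
  assumes "mono f" "mono g" and eq: "\<And>U. {k \<in> D. c k \<in> f U} = g {k \<in> D. c k \<in> U}"
    and sub: "\<And>V. g V \<subseteq> D"
  shows "{k \<in> D. c k \<in> gfp f} = gfp g"
proof
  show "{k \<in> D. c k \<in> gfp f} \<subseteq> gfp g"
    by (rule gfp_upperbound) (simp flip: eq add: gfp_fixpoint[OF assms(1)])
  have D: "gfp g \<subseteq> D"
    using sub[of "gfp g"] by (simp add: gfp_fixpoint[OF assms(2)])
  have "g (gfp g) \<subseteq> g {k \<in> D. c k \<in> c ` gfp g}"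
    by (rule monoD[OF assms(2)]) (use D in auto)
  then have "gfp g \<subseteq> {k \<in> D. c k \<in> f (c ` gfp g)}"
    by (simp add: eq gfp_fixpoint[OF assms(2)])
  then have "c ` gfp g \<subseteq> f (c ` gfp g)"
    by blast
  then have "c ` gfp g \<subseteq> gfp f"
    by (rule gfp_upperbound)
  then show "gfp g \<subseteq> {k \<in> D. c k \<in> gfp f}"
    using D by blast
qed

text \<open>Modalities among mf and mb never leave the chain, so the truth of \<phi> along the chain
  is determined by the encoding alone.\<close>

lemma csem_transfer:
  assumes "modalities \<phi> \<subseteq> {mf, mb}" "bits w Alive = D"
    and "\<And>k A. k \<in> D \<Longrightarrow> AtomBit A \<in> w k \<longleftrightarrow> holds_at W A (c k)"
    and "\<And>k x. k \<in> D \<Longrightarrow> x \<in> fv \<phi> \<Longrightarrow> VarBit x \<in> w k \<longleftrightarrow> c k \<in> \<rho> x"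
  shows "csem \<phi> w = {k \<in> D. c k \<in> sem W \<phi> \<rho>}"
  using assms
proof (induction \<phi> arbitrary: w \<rho>)
  case (Mod m \<phi>)
  have IH: "csem \<phi> w = {k \<in> D. c k \<in> sem W \<phi> \<rho>}"
    by (rule Mod.IH) (use Mod.prems in simp_all)
  have m: "(m \<in> {XG, XC} \<longrightarrow> m = mf) \<and> (m \<notin> {XG, XC} \<longrightarrow> m = mb)"
    using Mod.prems(1) opp by (auto simp: opposite_def)
  have "(if m \<in> {XG, XC} then Suc k \<in> csem \<phi> w else k \<noteq> 0 \<and> k - 1 \<in> csem \<phi> w) \<longleftrightarrow>
      c k \<in> sem W (Mod m \<phi>) \<rho>" if k: "k \<in> D" for k
  proof (cases "m \<in> {XG, XC}")
    case True
    then show ?thesis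
      using m pos[OF k] by (auto simp: IH step_iff[OF k])
  next
    case False
    then show ?thesis
      using m pos[OF k] mem_mono[OF k, of "k - 1"] by (auto simp: IH step_back_iff[OF k])
  qed
  then show ?case
    unfolding csem.simps Mod.prems(2) by blast
next
  case (Or \<phi> \<psi>)
  have "csem \<phi> w = {k \<in> D. c k \<in> sem W \<phi> \<rho>}" "csem \<psi> w = {k \<in> D. c k \<in> sem W \<psi> \<rho>}"
    by (rule Or.IH; use Or.prems in simp)+
  then show ?case
    by auto
next
  case (And \<phi> \<psi>)
  have "csem \<phi> w = {k \<in> D. c k \<in> sem W \<phi> \<rho>}" "csem \<psi> w = {k \<in> D. c k \<in> sem W \<psi> \<rho>}"
    by (rule And.IH; use And.prems in simp)+
  then show ?case
    by auto
next
  case (Mu x \<phi>)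
  have IH: "csem \<phi> (upd w (VarBit x) {k \<in> D. c k \<in> U}) = {k \<in> D. c k \<in> sem W \<phi> (\<rho>(x := U))}" for U
    by (rule Mu.IH) (use Mu.prems in \<open>auto simp: mem_upd\<close>)
  show ?case
    unfolding sem.simps csem.simps
    by (rule preimage_lfp[symmetric, OF mono_sem_body mono_csem]) (use IH pos in auto)
next
  case (Nu x \<phi>)
  have IH: "csem \<phi> (upd w (VarBit x) {k \<in> D. c k \<in> U}) = {k \<in> D. c k \<in> sem W \<phi> (\<rho>(x := U))}" for U
    by (rule Nu.IH) (use Nu.prems in \<open>auto simp: mem_upd\<close>)
  have "csem \<phi> (upd w (VarBit x) V) \<subseteq> D" for V
    using csem_subset_alive[of \<phi> "upd w (VarBit x) V"] Nu.prems(2) by simp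
  then show ?case
    unfolding sem.simps csem.simps
    by (intro preimage_gfp[symmetric, OF mono_sem_body mono_csem]) (use IH pos in auto)
qed (use pos in auto)

end

definition chain_word ::
    "('a, 'd) dword \<Rightarrow> (nat \<Rightarrow> nat) \<Rightarrow> nat set \<Rightarrow> nat set \<Rightarrow> (nat \<Rightarrow> nat set) \<Rightarrow> nat \<Rightarrow> 'a bit set" where
  "chain_word W c D X \<rho> k = (if k \<in> D then labelling W X \<rho> (c k) else {})"

lemma (in chain) csem_chain_word:
  assumes "modalities \<phi> \<subseteq> {mf, mb}" "fv \<phi> \<subseteq> X"
  shows "csem \<phi> (chain_word W c D X \<rho>) = {k \<in> D. c k \<in> sem W \<phi> (\<lambda>x. \<rho> (2 * x))}"
  by (rule csem_transfer) (use assms in \<open>auto simp: chain_word_def split: if_splits\<close>)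

section \<open>Separation into past and future\<close>

text \<open>The types become the states of an automaton: a letter is appended to a representative,
  and \<open>multiplicative\<close> makes the choice of the representative irrelevant.
  \<open>cons_state\<close> is the counterpart for reading from right to left.\<close>

definition snoc_state :: "('l list \<Rightarrow> 's) \<Rightarrow> 's \<Rightarrow> 'l \<Rightarrow> 's" where
  "snoc_state h s a = h ((SOME u. h u = s) @ [a])"

definition cons_state :: "('l list \<Rightarrow> 's) \<Rightarrow> 's \<Rightarrow> 'l \<Rightarrow> 's" where
  "cons_state h s a = h (a # (SOME u. h u = s))"

lemma snoc_state: "multiplicative h \<Longrightarrow> snoc_state h (h u) a = h (u @ [a])"
  unfolding snoc_state_def by (rule multiplicativeD) (auto intro: someI)

lemma cons_state: "multiplicative h \<Longrightarrow> cons_state h (h u) a = h (a # u)"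
  unfolding cons_state_def
  by (rule multiplicativeD[of h "[a]" "[a]", simplified]) (auto intro: someI)

context chain
begin

text \<open>State \<open>h u\<close> at \<open>c k\<close> stands for a word u that already accounts
  for index k, so the run adds the letters from \<open>Suc k\<close> to j.\<close>

lemma link_forward:
  fixes h :: "'a bit set list \<Rightarrow> nat" and X :: "nat set" and \<rho> :: "nat \<Rightarrow> nat set"
  assumes h: "multiplicative h" and k: "k \<in> D"
  defines "w \<equiv> chain_word W c D X \<rho>"
  shows "(c k, x) \<in> link mf (snoc_state h) (range h) (h u) s W (labelling W X \<rho>) \<longleftrightarrow>
    (\<exists>j \<in> D. k \<le> j \<and> x = c j \<and> s = h (u @ seg w (Suc k) (Suc j)))"
proof
  let ?E = "transitions mf (snoc_state h) (range h) W (labelling W X \<rho>)"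
  assume "(c k, x) \<in> link mf (snoc_state h) (range h) (h u) s W (labelling W X \<rho>)"
  then have "((h u, c k), (s, x)) \<in> ?E\<^sup>*"
    by (simp add: link_def)
  then show "\<exists>j \<in> D. k \<le> j \<and> x = c j \<and> s = h (u @ seg w (Suc k) (Suc j))"
  proof (induction "(s, x)" arbitrary: s x rule: rtrancl_induct)
    case base
    show ?case
      using k by (intro bexI[of _ k]) (simp_all add: seg_def)
  next
    case (step y s' x')
    obtain s x where y: "y = (s, x)"
      by (cases y)
    then obtain j where j: "j \<in> D" "k \<le> j" "x = c j" "s = h (u @ seg w (Suc k) (Suc j))"
      using step.hyps(3) by blast
    have "step mf W (c j) x'" "s' = snoc_state h s (labelling W X \<rho> x')"
      using step.hyps(2) j y by (auto simp: transitions_def)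
    then have "Suc j \<in> D" "x' = c (Suc j)" "s' = h (u @ seg w (Suc k) (Suc j) @ [w (Suc j)])"
      using step_iff[OF j(1)] by (auto simp: j(4) snoc_state[OF h] w_def chain_word_def)
    then show ?case
      using j(2) by (intro bexI[of _ "Suc j"]) (simp_all add: seg_snoc)
  qed
next
  let ?E = "transitions mf (snoc_state h) (range h) W (labelling W X \<rho>)"
  assume "\<exists>j \<in> D. k \<le> j \<and> x = c j \<and> s = h (u @ seg w (Suc k) (Suc j))"
  then obtain j where j: "k \<le> j" "j \<in> D" "x = c j" "s = h (u @ seg w (Suc k) (Suc j))"
    by blast
  have "((h u, c k), (h (u @ seg w (Suc k) (Suc j)), c j)) \<in> ?E\<^sup>*"
    using j(1,2)
  proof (induction j rule: dec_induct)
    case base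
    show ?case
      by (simp add: seg_def)
  next
    case (step j)
    have "((h (u @ seg w (Suc k) (Suc j)), c j), (h (u @ seg w (Suc k) (Suc (Suc j))), c (Suc j))) \<in> ?E"
      using step step_Suc
      by (auto simp: transitions_def snoc_state[OF h] w_def chain_word_def seg_snoc)
    then show ?case
      using step down by (auto intro: rtrancl_into_rtrancl)
  qed
  then show "(c k, x) \<in> link mf (snoc_state h) (range h) (h u) s W (labelling W X \<rho>)"
    by (simp add: link_def j)
qed

text \<open>The letters from j to k - 1 are put in front of u. The letter at k itself is excluded,
  which is what the type of a strict prefix needs.\<close>

lemma link_backward:
  fixes h :: "'a bit set list \<Rightarrow> nat" and X :: "nat set" and \<rho> :: "nat \<Rightarrow> nat set"
  assumes h: "multiplicative h" and k: "k \<in> D"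
  defines "w \<equiv> chain_word W c D X \<rho>"
  shows "(c k, x) \<in> link mb (cons_state h) (range h) (h u) s W (labelling W X \<rho>) \<longleftrightarrow>
    (\<exists>j \<le> k. x = c j \<and> s = h (seg w j k @ u))"
proof
  let ?E = "transitions mb (cons_state h) (range h) W (labelling W X \<rho>)"
  assume "(c k, x) \<in> link mb (cons_state h) (range h) (h u) s W (labelling W X \<rho>)"
  then have "((h u, c k), (s, x)) \<in> ?E\<^sup>*"
    by (simp add: link_def)
  then show "\<exists>j \<le> k. x = c j \<and> s = h (seg w j k @ u)"
  proof (induction "(s, x)" arbitrary: s x rule: rtrancl_induct)
    case base
    show ?case
      by (intro exI[of _ k]) (simp add: seg_def)
  next
    case (step y s' x')
    obtain s x where y: "y = (s, x)"
      by (cases y)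
    then obtain j where j: "j \<le> k" "x = c j" "s = h (seg w j k @ u)"
      using step.hyps(3) by blast
    have jD: "j \<in> D"
      using mem_mono[OF k j(1)] .
    have "step mb W (c j) x'" "s' = cons_state h s (labelling W X \<rho> x')"
      using step.hyps(2) j y by (auto simp: transitions_def)
    then obtain i where i: "j = Suc i" "x' = c i" "s' = h (w i # seg w (Suc i) k @ u)"
      using step_back_iff[OF jD] down[of "j - 1"] jD
      by (cases j) (auto simp: j(3) cons_state[OF h] w_def chain_word_def)
    moreover have "w i # seg w (Suc i) k = seg w i k"
      using i(1) j(1) by (simp add: seg_Cons)
    ultimately show ?case
      using j(1) by (intro exI[of _ i]) (auto simp flip: append_Cons)
  qed
next
  let ?E = "transitions mb (cons_state h) (range h) W (labelling W X \<rho>)"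
  assume "\<exists>j \<le> k. x = c j \<and> s = h (seg w j k @ u)"
  then obtain j where j: "j \<le> k" "x = c j" "s = h (seg w j k @ u)"
    by blast
  have "((h u, c k), (h (seg w j k @ u), c j)) \<in> ?E\<^sup>*"
    using j(1)
  proof (induction j rule: inc_induct)
    case base
    show ?case
      by (simp add: seg_def)
  next
    case (step j)
    have j: "j \<in> D" "Suc j \<in> D"
      using mem_mono[OF k] step.hyps by auto
    have "w j # seg w (Suc j) k = seg w j k"
      using step.hyps by (simp add: seg_Cons)
    then have "((h (seg w (Suc j) k @ u), c (Suc j)), (h (seg w j k @ u), c j)) \<in> ?E"
      using j step_back_iff[OF j(2)]
      by (auto simp: transitions_def cons_state[OF h] w_def chain_word_def simp flip: append_Cons)
    then show ?case
      using step.IH by (auto intro: rtrancl_into_rtrancl)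
  qed
  then show "(c k, x) \<in> link mb (cons_state h) (range h) (h u) s W (labelling W X \<rho>)"
    by (simp add: link_def j)
qed

end

lemma snoc_state_range: "snoc_state h s a \<in> range h"
  by (simp add: snoc_state_def)

lemma cons_state_range: "cons_state h s a \<in> range h"
  by (simp add: cons_state_def)

section \<open>Types of prefixes and suffixes as formulas\<close>

definition expresses ::
    "('a, 'd) dword itself \<Rightarrow> modality \<Rightarrow> modality \<Rightarrow> 'a::finite atom \<Rightarrow> 'a atom \<Rightarrow> nat set \<Rightarrow> 'a fm \<Rightarrow>
      (nat set \<Rightarrow> (nat \<Rightarrow> 'a bit set) \<Rightarrow> nat \<Rightarrow> bool) \<Rightarrow> bool" where
  "expresses _ mf mb afirst alast X F Q \<longleftrightarrow> (\<forall>(W :: ('a, 'd) dword) c D \<rho> k.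
    chain mf mb afirst alast W c D \<longrightarrow> valuation W \<rho> \<longrightarrow> complementary W X \<rho> \<longrightarrow> k \<in> D \<longrightarrow>
    (c k \<in> sem W F \<rho> \<longleftrightarrow> Q D (chain_word W c D X \<rho>) k))"

lemma expressesI:
  assumes "\<And>(W :: ('a::finite, 'd) dword) c D \<rho> k. chain mf mb afirst alast W c D \<Longrightarrow> valuation W \<rho> \<Longrightarrow>
      complementary W X \<rho> \<Longrightarrow> k \<in> D \<Longrightarrow> c k \<in> sem W F \<rho> \<longleftrightarrow> Q D (chain_word W c D X \<rho>) k"
  shows "expresses TYPE(('a, 'd) dword) mf mb afirst alast X F Q"
  unfolding expresses_def using assms by blast

lemma expressesD:
  fixes W :: "('a::finite, 'd) dword"
  shows "expresses TYPE(('a, 'd) dword) mf mb afirst alast X F Q \<Longrightarrow>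
    chain mf mb afirst alast W c D \<Longrightarrow> valuation W \<rho> \<Longrightarrow> complementary W X \<rho> \<Longrightarrow> k \<in> D \<Longrightarrow>
    c k \<in> sem W F \<rho> \<longleftrightarrow> Q D (chain_word W c D X \<rho>) k"
  unfolding expresses_def by blast

text \<open>A backward run from the state \<open>h []\<close> to the start of the chain, which
  \<open>afirst\<close> identifies, computes the type of the strict prefix.\<close>

lemma past_formula:
  fixes h :: "'a::finite bit set list \<Rightarrow> nat" and afirst alast :: "'a atom"
  assumes opp: "opposite mf mb afirst alast" and X: "finite X"
    and h: "finite (range h)" "multiplicative h"
  shows "\<exists>P. modalities P \<subseteq> {mb} \<and> fv P \<subseteq> doubled X \<and>
    expresses TYPE(('a, 'd) dword) mf mb afirst alast X P (\<lambda>D w k. h (seg w 0 k) = t)"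
proof -
  have "definable mb X (link mb (cons_state h) (range h) (h []) t :: ('a, 'd) prel)"
    by (rule definable_link[OF X h(1) cons_state_range])
  then obtain F where F: "diamond mb X (link mb (cons_state h) (range h) (h []) t :: ('a, 'd) prel) F"
    unfolding definable_def by blast
  have "c k \<in> sem W (F (Atom afirst)) \<rho> \<longleftrightarrow> h (seg (chain_word W c D X \<rho>) 0 k) = t"
    if ch: "chain mf mb afirst alast W c D" and val: "valuation W \<rho>" "complementary W X \<rho>"
      and k: "k \<in> D" for W :: "('a, 'd) dword" and c D \<rho> k
  proof -
    interpret chain mf mb afirst alast W c D
      by (rule ch)
    show ?thesis
      using pos holds_first_iff mem_mono[OF k] zero
      by (auto simp: diamond_sem[OF F val] link_backward[OF h(2) k])
  qed
  then have "expresses TYPE(('a, 'd) dword) mf mb afirst alast X (F (Atom afirst))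
      (\<lambda>D w k. h (seg w 0 k) = t)"
    by (rule expressesI)
  then show ?thesis
    using diamond_modalities[OF F, of "Atom afirst"] diamond_fv[OF F, of "Atom afirst"]
    by (intro exI[of _ "F (Atom afirst)"]) simp
qed

text \<open>An until that demands type s for the factor from k to j. The first letter is transformed
  by g: it gets the mark in the factor where evaluation takes place and is left alone in the
  repeated factors.\<close>

definition until_operator ::
    "('a, 'd) dword itself \<Rightarrow> modality \<Rightarrow> modality \<Rightarrow> 'a::finite atom \<Rightarrow> 'a atom \<Rightarrow> nat set \<Rightarrow>
      ('a bit set list \<Rightarrow> nat) \<Rightarrow> ('a bit set \<Rightarrow> 'a bit set) \<Rightarrow> nat \<Rightarrow> ('a fm \<Rightarrow> 'a fm) \<Rightarrow> bool" where
  "until_operator _ mf mb afirst alast X h g s F \<longleftrightarrow>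
    (\<forall>\<phi>. modalities (F \<phi>) \<subseteq> insert mf (modalities \<phi>) \<and> fv (F \<phi>) \<subseteq> doubled X \<union> fv \<phi> \<and>
      (\<forall>(W :: ('a, 'd) dword) c D \<rho> k. chain mf mb afirst alast W c D \<longrightarrow> valuation W \<rho> \<longrightarrow>
        complementary W X \<rho> \<longrightarrow> k \<in> D \<longrightarrow>
        (c k \<in> sem W (F \<phi>) \<rho> \<longleftrightarrow> (\<exists>j \<in> D. k \<le> j \<and> c j \<in> sem W \<phi> \<rho> \<and>
          h (g (chain_word W c D X \<rho> k) # seg (chain_word W c D X \<rho>) (Suc k) (Suc j)) = s))))"

lemma until_modalities:
  "until_operator T mf mb afirst alast X h g s F \<Longrightarrow> modalities (F \<phi>) \<subseteq> insert mf (modalities \<phi>)"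
  unfolding until_operator_def by blast

lemma until_fv: "until_operator T mf mb afirst alast X h g s F \<Longrightarrow> fv (F \<phi>) \<subseteq> doubled X \<union> fv \<phi>"
  unfolding until_operator_def by blast

lemma until_sem:
  fixes W :: "('a::finite, 'd) dword"
  shows "until_operator TYPE(('a, 'd) dword) mf mb afirst alast X h g s F \<Longrightarrow>
    chain mf mb afirst alast W c D \<Longrightarrow> valuation W \<rho> \<Longrightarrow> complementary W X \<rho> \<Longrightarrow> k \<in> D \<Longrightarrow>
    c k \<in> sem W (F \<phi>) \<rho> \<longleftrightarrow> (\<exists>j \<in> D. k \<le> j \<and> c j \<in> sem W \<phi> \<rho> \<and>
      h (g (chain_word W c D X \<rho> k) # seg (chain_word W c D X \<rho>) (Suc k) (Suc j)) = s)"
  unfolding until_operator_def by simp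

lemma until_formula:
  fixes h :: "'a::finite bit set list \<Rightarrow> nat" and afirst alast :: "'a atom" and g :: "'a bit set \<Rightarrow> 'a bit set"
  assumes opp: "opposite mf mb afirst alast" and X: "finite X"
    and h: "finite (range h)" "multiplicative h"
  shows "\<exists>F. until_operator TYPE(('a, 'd) dword) mf mb afirst alast X h g s F"
proof -
  \<comment> \<open>Runs do not read their starting letter, so a test first determines its type p,
    and the run starts in state p.\<close>
  define r :: "('a, 'd) prel" where "r W l = (\<Union>p \<in> range h.
    {(i, i) | i. i \<in> positions W \<and> h [g (l i)] = p} O link mf (snoc_state h) (range h) p s W l)" for W l
  have "definable mf X r"
    unfolding r_def[abs_def]
    by (intro definable_UN definable_relcomp definable_test definable_link X h snoc_state_range)
  then obtain F where F: "diamond mf X r F"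
    unfolding definable_def by blast
  have "c k \<in> sem W (F \<phi>) \<rho> \<longleftrightarrow> (\<exists>j \<in> D. k \<le> j \<and> c j \<in> sem W \<phi> \<rho> \<and>
      h (g (chain_word W c D X \<rho> k) # seg (chain_word W c D X \<rho>) (Suc k) (Suc j)) = s)"
    if ch: "chain mf mb afirst alast W c D" and val: "valuation W \<rho>" "complementary W X \<rho>"
      and k: "k \<in> D" for W :: "('a, 'd) dword" and c D \<rho> k \<phi>
  proof -
    interpret chain mf mb afirst alast W c D
      by (rule ch)
    have "(c k, x) \<in> r W (labelling W X \<rho>) \<longleftrightarrow>
        (c k, x) \<in> link mf (snoc_state h) (range h) (h [g (labelling W X \<rho> (c k))]) s W (labelling W X \<rho>)" for x
      using pos[OF k] unfolding r_def by auto
    then show ?thesis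
      using k by (auto simp: diamond_sem[OF F val] link_forward[OF h(2) k] chain_word_def)
  qed
  then have "until_operator TYPE(('a, 'd) dword) mf mb afirst alast X h g s F"
    using diamond_modalities[OF F] diamond_fv[OF F] by (simp add: until_operator_def)
  then show ?thesis
    by blast
qed

text \<open>An until that ends at \<open>alast\<close> reads the whole remaining chain, and it fails
  on infinite chains.\<close>

lemma finite_future_formula:
  fixes h :: "'a::finite bit set list \<Rightarrow> nat" and afirst alast :: "'a atom"
  assumes opp: "opposite mf mb afirst alast" and X: "finite X"
    and h: "finite (range h)" "multiplicative h"
  shows "\<exists>F. modalities F \<subseteq> {mf} \<and> fv F \<subseteq> doubled X \<and>
    expresses TYPE(('a, 'd) dword) mf mb afirst alast X F (\<lambda>D w k. \<exists>n. D = {..<n} \<and> k < n \<and>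
      h (insert b (w k) # seg w (Suc k) n) = s)"
proof -
  obtain F where F: "until_operator TYPE(('a, 'd) dword) mf mb afirst alast X h (insert b) s F"
    using until_formula[OF assms] by blast
  have "c k \<in> sem W (F (Atom alast)) \<rho> \<longleftrightarrow> (\<exists>n. D = {..<n} \<and> k < n \<and>
      h (insert b (chain_word W c D X \<rho> k) # seg (chain_word W c D X \<rho>) (Suc k) n) = s)"
    if ch: "chain mf mb afirst alast W c D" and val: "valuation W \<rho>" "complementary W X \<rho>"
      and k: "k \<in> D" for W :: "('a, 'd) dword" and c D \<rho> k
  proof -
    interpret chain mf mb afirst alast W c D
      by (rule ch)
    have alast: "c j \<in> sem W (Atom alast) \<rho> \<longleftrightarrow> D = {..<Suc j}" if j: "j \<in> D" for j
    proof -
      have "c j \<in> sem W (Atom alast) \<rho> \<longleftrightarrow> Suc j \<notin> D"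
        using pos[OF j] holds_last_iff[OF j] by simp
      also have "\<dots> \<longleftrightarrow> D = {..<Suc j}"
      proof
        assume "Suc j \<notin> D"
        then have "x < Suc j" if "x \<in> D" for x
          using mem_mono[OF that, of "Suc j"] by linarith
        then show "D = {..<Suc j}"
          using mem_mono[OF j] by (auto simp: less_Suc_eq_le)
      qed simp
      finally show ?thesis .
    qed
    show ?thesis
      unfolding until_sem[OF F ch val k]
    proof
      assume "\<exists>j \<in> D. k \<le> j \<and> c j \<in> sem W (Atom alast) \<rho> \<and>
        h (insert b (chain_word W c D X \<rho> k) # seg (chain_word W c D X \<rho>) (Suc k) (Suc j)) = s"
      then obtain j where "j \<in> D" "k \<le> j" "D = {..<Suc j}"
        "h (insert b (chain_word W c D X \<rho> k) # seg (chain_word W c D X \<rho>) (Suc k) (Suc j)) = s"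
        using alast by blast
      then show "\<exists>n. D = {..<n} \<and> k < n \<and>
          h (insert b (chain_word W c D X \<rho> k) # seg (chain_word W c D X \<rho>) (Suc k) n) = s"
        by (intro exI[of _ "Suc j"]) simp
    next
      assume "\<exists>n. D = {..<n} \<and> k < n \<and>
          h (insert b (chain_word W c D X \<rho> k) # seg (chain_word W c D X \<rho>) (Suc k) n) = s"
      then obtain n where n: "D = {..<n}" "k < n"
        "h (insert b (chain_word W c D X \<rho> k) # seg (chain_word W c D X \<rho>) (Suc k) n) = s"
        by blast
      then obtain j where "n = Suc j"
        by (cases n) auto
      then show "\<exists>j \<in> D. k \<le> j \<and> c j \<in> sem W (Atom alast) \<rho> \<and>
          h (insert b (chain_word W c D X \<rho> k) # seg (chain_word W c D X \<rho>) (Suc k) (Suc j)) = s"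
        using n alast[of j] by (intro bexI[of _ j]) auto
    qed
  qed
  then have "expresses TYPE(('a, 'd) dword) mf mb afirst alast X (F (Atom alast))
      (\<lambda>D w k. \<exists>n. D = {..<n} \<and> k < n \<and> h (insert b (w k) # seg w (Suc k) n) = s)"
    by (rule expressesI)
  then show ?thesis
    using until_modalities[OF F, of "Atom alast"] until_fv[OF F, of "Atom alast"] by (intro exI[of _ "F (Atom alast)"]) simp
qed

text \<open>An endless sequence of factors of type e is a greatest fixpoint of an until for a single
  such factor; an outer until supplies the initial factor of type s.\<close>

lemma infinite_future_formula:
  fixes h :: "'a::finite bit set list \<Rightarrow> nat" and afirst alast :: "'a atom"
  assumes opp: "opposite mf mb afirst alast" and X: "finite X"
    and h: "finite (range h)" "multiplicative h"
  shows "\<exists>F. modalities F \<subseteq> {mf} \<and> fv F \<subseteq> doubled X \<and>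
    expresses TYPE(('a, 'd) dword) mf mb afirst alast X F (\<lambda>D w k. D = UNIV \<and>
      (\<exists>f. strict_mono f \<and> k < f 0 \<and> h (insert b (w k) # seg w (Suc k) (f 0)) = s \<and>
        (\<forall>i. h (seg w (f i) (f (Suc i))) = e)))"
proof -
  obtain F where F: "until_operator TYPE(('a, 'd) dword) mf mb afirst alast X h (insert b) s F"
    using until_formula[OF assms] by blast
  obtain F' where F': "until_operator TYPE(('a, 'd) dword) mf mb afirst alast X h (\<lambda>a. a) e F'"
    using until_formula[OF assms] by blast
  obtain x where x: "x \<notin> doubled X"
    using ex_fresh[of "doubled X"] X by (auto simp: doubled_def)
  \<comment> \<open>The until stops at the last index of a factor, and \<open>Mod mf\<close> moves
    on to the first index of the next one.\<close>
  define \<psi> where "\<psi> = Nu x (F' (Mod mf (Var x)))"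
  have \<psi>: "c k \<in> sem W \<psi> \<rho> \<longleftrightarrow> (\<exists>f. strict_mono f \<and> f 0 = k \<and> range f \<subseteq> D \<and>
      (\<forall>i. h (seg (chain_word W c D X \<rho>) (f i) (f (Suc i))) = e))"
    if ch: "chain mf mb afirst alast W c D" and val: "valuation W \<rho>" "complementary W X \<rho>"
      and k: "k \<in> D" for W :: "('a, 'd) dword" and c D \<rho> k
  proof -
    interpret chain mf mb afirst alast W c D
      by (rule ch)
    define w where "w = chain_word W c D X \<rho>"
    define B where "B U = positions W \<inter> sem W (F' (Mod mf (Var x))) (\<rho>(x := U))" for U
    have sem: "sem W \<psi> \<rho> = gfp B"
      unfolding \<psi>_def B_def by simp
    have mono: "mono B"
      unfolding B_def by (rule mono_sem_body)
    have B: "c k \<in> B U \<longleftrightarrow> (\<exists>j \<in> D. k < j \<and> c j \<in> U \<and> h (seg w k j) = e)"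
      if U: "U \<subseteq> positions W" and k: "k \<in> D" for U k
    proof -
      have val': "valuation W (\<rho>(x := U))" "complementary W X (\<rho>(x := U))"
        using val U x by (simp_all add: valuation_def complementary_fresh)
      have w': "chain_word W c D X (\<rho>(x := U)) = w"
        by (simp add: w_def chain_word_def labelling_fresh[OF x] fun_eq_iff)
      have "c k \<in> B U \<longleftrightarrow> (\<exists>j \<in> D. k \<le> j \<and> c j \<in> sem W (Mod mf (Var x)) (\<rho>(x := U)) \<and>
          h (w k # seg w (Suc k) (Suc j)) = e)"
        using pos[OF k] by (simp add: B_def until_sem[OF F' ch val' k] w')
      also have "\<dots> \<longleftrightarrow> (\<exists>j \<in> D. k \<le> j \<and> Suc j \<in> D \<and> c (Suc j) \<in> U \<and> h (seg w k (Suc j)) = e)"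
      proof (rule bex_cong[OF refl], rule conj_cong[OF refl])
        fix j assume "j \<in> D" "k \<le> j"
        then have "c j \<in> sem W (Mod mf (Var x)) (\<rho>(x := U)) \<longleftrightarrow> Suc j \<in> D \<and> c (Suc j) \<in> U"
          "w k # seg w (Suc k) (Suc j) = seg w k (Suc j)"
          using pos step_iff seg_Cons[of k "Suc j" w] by auto
        then show "(c j \<in> sem W (Mod mf (Var x)) (\<rho>(x := U)) \<and> h (w k # seg w (Suc k) (Suc j)) = e) \<longleftrightarrow>
            (Suc j \<in> D \<and> c (Suc j) \<in> U \<and> h (seg w k (Suc j)) = e)"
          by simp
      qed
      also have "\<dots> \<longleftrightarrow> (\<exists>j \<in> D. k < j \<and> c j \<in> U \<and> h (seg w k j) = e)"
      proof
        assume "\<exists>j \<in> D. k < j \<and> c j \<in> U \<and> h (seg w k j) = e"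
        then obtain j where j: "j \<in> D" "k < j" "c j \<in> U" "h (seg w k j) = e"
          by blast
        then obtain i where "j = Suc i"
          by (cases j) auto
        then show "\<exists>j \<in> D. k \<le> j \<and> Suc j \<in> D \<and> c (Suc j) \<in> U \<and> h (seg w k (Suc j)) = e"
          using j down by (intro bexI[of _ i]) auto
      qed (use less_Suc_eq_le in blast)
      finally show ?thesis .
    qed
    show ?thesis
      unfolding sem w_def[symmetric]
    proof
      assume "c k \<in> gfp B"
      have "gfp B \<subseteq> positions W"
        by (subst gfp_fixpoint[OF mono, symmetric]) (simp add: B_def)
      then have extend: "\<exists>j \<in> D. k < j \<and> c j \<in> gfp B \<and> h (seg w k j) = e" if "k \<in> D" "c k \<in> gfp B" for k
        using B[of "gfp B" k] that by (simp add: gfp_fixpoint[OF mono])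
      \<comment> \<open>Unfolding the fixpoint at the current cut yields the next cut; dependent
        choice collects the cuts.\<close>
      have "\<exists>f. \<forall>n. (f n \<in> D \<and> c (f n) \<in> gfp B \<and> (n = 0 \<longrightarrow> f n = k)) \<and>
          (f n < f (Suc n) \<and> h (seg w (f n) (f (Suc n))) = e)"
      proof (rule dependent_nat_choice)
        show "\<exists>i. i \<in> D \<and> c i \<in> gfp B \<and> (0 = (0 :: nat) \<longrightarrow> i = k)"
          using k \<open>c k \<in> gfp B\<close> by blast
      next
        fix i n assume "i \<in> D \<and> c i \<in> gfp B \<and> (n = (0 :: nat) \<longrightarrow> i = k)"
        then show "\<exists>j. (j \<in> D \<and> c j \<in> gfp B \<and> (Suc n = 0 \<longrightarrow> j = k)) \<and> i < j \<and> h (seg w i j) = e"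
          using extend[of i] by blast
      qed
      then obtain f where f: "\<And>n. f n \<in> D" "f 0 = k" "\<And>n. f n < f (Suc n)"
        "\<And>n. h (seg w (f n) (f (Suc n))) = e"
        by blast
      then show "\<exists>f. strict_mono f \<and> f 0 = k \<and> range f \<subseteq> D \<and> (\<forall>i. h (seg w (f i) (f (Suc i))) = e)"
        by (intro exI[of _ f]) (auto simp: strict_mono_Suc_iff)
    next
      assume "\<exists>f. strict_mono f \<and> f 0 = k \<and> range f \<subseteq> D \<and> (\<forall>i. h (seg w (f i) (f (Suc i))) = e)"
      then obtain f where f: "strict_mono f" "f 0 = k" "range f \<subseteq> D"
        "\<And>i. h (seg w (f i) (f (Suc i))) = e"
        by blast
      \<comment> \<open>Conversely, the positions at the cuts form a postfixed point.\<close>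
      have "range (\<lambda>i. c (f i)) \<subseteq> B (range (\<lambda>i. c (f i)))"
      proof
        fix y assume "y \<in> range (\<lambda>i. c (f i))"
        then obtain i where y: "y = c (f i)"
          by blast
        have "range (\<lambda>i. c (f i)) \<subseteq> positions W" "f i \<in> D"
          using f(3) pos by blast+
        then show "y \<in> B (range (\<lambda>i. c (f i)))"
          unfolding y B[OF \<open>range (\<lambda>i. c (f i)) \<subseteq> positions W\<close> \<open>f i \<in> D\<close>]
          using f by (intro bexI[of _ "f (Suc i)"]) (auto simp: strict_mono_Suc_iff)
      qed
      then have "range (\<lambda>i. c (f i)) \<subseteq> gfp B"
        by (rule gfp_upperbound)
      then show "c k \<in> gfp B"
        using f(2) by blast
    qed
  qed
  have "c k \<in> sem W (F (Mod mf \<psi>)) \<rho> \<longleftrightarrow> D = UNIV \<and> (\<exists>f. strict_mono f \<and> k < f 0 \<and>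
      h (insert b (chain_word W c D X \<rho> k) # seg (chain_word W c D X \<rho>) (Suc k) (f 0)) = s \<and>
      (\<forall>i. h (seg (chain_word W c D X \<rho>) (f i) (f (Suc i))) = e))"
    if ch: "chain mf mb afirst alast W c D" and val: "valuation W \<rho>" "complementary W X \<rho>"
      and k: "k \<in> D" for W :: "('a, 'd) dword" and c D \<rho> k
  proof -
    interpret chain mf mb afirst alast W c D
      by (rule ch)
    have Mod: "c j \<in> sem W (Mod mf \<psi>) \<rho> \<longleftrightarrow> Suc j \<in> D \<and> c (Suc j) \<in> sem W \<psi> \<rho>" if "j \<in> D" for j
      using that pos step_iff by auto
    show ?thesis
      unfolding until_sem[OF F ch val k]
    proof
      assume "\<exists>j \<in> D. k \<le> j \<and> c j \<in> sem W (Mod mf \<psi>) \<rho> \<and>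
        h (insert b (chain_word W c D X \<rho> k) # seg (chain_word W c D X \<rho>) (Suc k) (Suc j)) = s"
      then obtain j where j: "j \<in> D" "k \<le> j" "Suc j \<in> D" "c (Suc j) \<in> sem W \<psi> \<rho>"
        "h (insert b (chain_word W c D X \<rho> k) # seg (chain_word W c D X \<rho>) (Suc k) (Suc j)) = s"
        using Mod by blast
      then obtain f where f: "strict_mono f" "f 0 = Suc j" "range f \<subseteq> D"
        "\<And>i. h (seg (chain_word W c D X \<rho>) (f i) (f (Suc i))) = e"
        using \<psi>[OF ch val j(3)] by blast
      \<comment> \<open>\<open>D\<close> is closed downwards and contains
        \<open>f n \<ge> n\<close>, so the chain is infinite.\<close>
      have "n \<in> D" for n
        using mem_mono[of "f n" n] f(3) strict_mono_imp_increasing[OF f(1), of n] by blast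
      then show "D = UNIV \<and> (\<exists>f. strict_mono f \<and> k < f 0 \<and>
          h (insert b (chain_word W c D X \<rho> k) # seg (chain_word W c D X \<rho>) (Suc k) (f 0)) = s \<and>
          (\<forall>i. h (seg (chain_word W c D X \<rho>) (f i) (f (Suc i))) = e))"
        using f j by (intro conjI exI[of _ f]) auto
    next
      assume "D = UNIV \<and> (\<exists>f. strict_mono f \<and> k < f 0 \<and>
          h (insert b (chain_word W c D X \<rho> k) # seg (chain_word W c D X \<rho>) (Suc k) (f 0)) = s \<and>
          (\<forall>i. h (seg (chain_word W c D X \<rho>) (f i) (f (Suc i))) = e))"
      then obtain f where f: "D = UNIV" "strict_mono f" "k < f 0"
        "h (insert b (chain_word W c D X \<rho> k) # seg (chain_word W c D X \<rho>) (Suc k) (f 0)) = s"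
        "\<And>i. h (seg (chain_word W c D X \<rho>) (f i) (f (Suc i))) = e"
        by blast
      then obtain j where j: "f 0 = Suc j"
        by (cases "f 0") auto
      have "c (Suc j) \<in> sem W \<psi> \<rho>"
        using \<psi>[OF ch val, of "Suc j"] f j by blast
      then show "\<exists>j \<in> D. k \<le> j \<and> c j \<in> sem W (Mod mf \<psi>) \<rho> \<and>
          h (insert b (chain_word W c D X \<rho> k) # seg (chain_word W c D X \<rho>) (Suc k) (Suc j)) = s"
        using Mod[of j] f j by (intro bexI[of _ j]) auto
    qed
  qed
  then have "expresses TYPE(('a, 'd) dword) mf mb afirst alast X (F (Mod mf \<psi>))
      (\<lambda>D w k. D = UNIV \<and> (\<exists>f. strict_mono f \<and> k < f 0 \<and>
        h (insert b (w k) # seg w (Suc k) (f 0)) = s \<and> (\<forall>i. h (seg w (f i) (f (Suc i))) = e)))"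
    by (rule expressesI)
  moreover have "modalities (F (Mod mf \<psi>)) \<subseteq> {mf}"
    using until_modalities[OF F, of "Mod mf \<psi>"] until_modalities[OF F', of "Mod mf (Var x)"] by (auto simp: \<psi>_def)
  moreover have "fv (F (Mod mf \<psi>)) \<subseteq> doubled X"
    using until_fv[OF F, of "Mod mf \<psi>"] until_fv[OF F', of "Mod mf (Var x)"] by (auto simp: \<psi>_def)
  ultimately show ?thesis
    by blast
qed

text \<open>Accepted triples of types become disjuncts for infinite chains, and accepted pairs
  become disjuncts for finite ones. Each future formula also states which kind of chain it speaks
  of, so disjuncts of the wrong kind are false.\<close>

theorem two_way_separation:
  fixes \<phi> :: "'a::finite fm" and afirst alast :: "'a atom"
  assumes opp: "opposite mf mb afirst alast" and \<phi>: "modalities \<phi> \<subseteq> {mf, mb}"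
  shows "\<exists>I. finite I \<and>
    (\<forall>(P, F) \<in> I. modalities P \<subseteq> {mb} \<and> modalities F \<subseteq> {mf} \<and>
      fv P \<subseteq> doubled (fv \<phi>) \<and> fv F \<subseteq> doubled (fv \<phi>)) \<and>
    (\<forall>(W :: ('a, 'd) dword) \<rho>. valuation W \<rho> \<longrightarrow> complementary W (fv \<phi>) \<rho> \<longrightarrow>
      sem W \<phi> (\<lambda>x. \<rho> (2 * x)) = (\<Union>(P, F) \<in> I. sem W P \<rho> \<inter> sem W F \<rho>))"
proof -
  let ?X = "fv \<phi>"
  obtain z where z: "z \<notin> ?X"
    using ex_fresh[OF finite_fv] by blast
  obtain h :: "'a bit set list \<Rightarrow> nat" and G G' where h: "finite (range h)" "multiplicative h"
    and inf: "\<forall>w k. bits w (VarBit z) = {} \<longrightarrow> (k \<in> csem \<phi> w \<longleftrightarrow>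
      (\<exists>s e f. (h (seg w 0 k), s, e) \<in> G \<and> strict_mono f \<and> k < f 0 \<and>
        h (insert (VarBit z) (w k) # seg w (Suc k) (f 0)) = s \<and>
        (\<forall>i. h (seg w (f i) (f (Suc i))) = e)))"
    and fin: "\<forall>w k n. bits w (VarBit z) = {} \<longrightarrow> k < n \<longrightarrow> (\<forall>i \<ge> n. w i = {}) \<longrightarrow>
      (k \<in> csem \<phi> w \<longleftrightarrow> (h (seg w 0 k), h (insert (VarBit z) (w k) # seg w (Suc k) n)) \<in> G')"
    using csem_decomposition[OF z] by (elim exE conjE)
  note inf = inf[rule_format] and fin = fin[rule_format]
  have "\<exists>P. \<forall>t. modalities (P t) \<subseteq> {mb} \<and> fv (P t) \<subseteq> doubled ?X \<and>
      expresses TYPE(('a, 'd) dword) mf mb afirst alast ?X (P t) (\<lambda>D w k. h (seg w 0 k) = t)"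
    by (rule choice, rule allI, rule past_formula[OF opp finite_fv h])
  then obtain P where P: "\<And>t. modalities (P t) \<subseteq> {mb}" "\<And>t. fv (P t) \<subseteq> doubled ?X"
    "\<And>t. expresses TYPE(('a, 'd) dword) mf mb afirst alast ?X (P t) (\<lambda>D w k. h (seg w 0 k) = t)"
    by blast
  have "\<exists>F. \<forall>s. modalities (F s) \<subseteq> {mf} \<and> fv (F s) \<subseteq> doubled ?X \<and>
      expresses TYPE(('a, 'd) dword) mf mb afirst alast ?X (F s) (\<lambda>D w k. \<exists>n. D = {..<n} \<and> k < n \<and>
        h (insert (VarBit z) (w k) # seg w (Suc k) n) = s)"
    by (rule choice, rule allI, rule finite_future_formula[OF opp finite_fv h])
  then obtain F where F: "\<And>s. modalities (F s) \<subseteq> {mf}" "\<And>s. fv (F s) \<subseteq> doubled ?X"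
    "\<And>s. expresses TYPE(('a, 'd) dword) mf mb afirst alast ?X (F s) (\<lambda>D w k. \<exists>n. D = {..<n} \<and> k < n \<and>
      h (insert (VarBit z) (w k) # seg w (Suc k) n) = s)"
    by blast
  have "\<exists>F. \<forall>s. \<forall>e. modalities (F s e) \<subseteq> {mf} \<and> fv (F s e) \<subseteq> doubled ?X \<and>
      expresses TYPE(('a, 'd) dword) mf mb afirst alast ?X (F s e) (\<lambda>D w k. D = UNIV \<and>
        (\<exists>f. strict_mono f \<and> k < f 0 \<and> h (insert (VarBit z) (w k) # seg w (Suc k) (f 0)) = s \<and>
          (\<forall>i. h (seg w (f i) (f (Suc i))) = e)))"
    by (rule choice, rule allI, rule choice, rule allI, rule infinite_future_formula[OF opp finite_fv h])
  then obtain F' where F': "\<And>s e. modalities (F' s e) \<subseteq> {mf}" "\<And>s e. fv (F' s e) \<subseteq> doubled ?X"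
    "\<And>s e. expresses TYPE(('a, 'd) dword) mf mb afirst alast ?X (F' s e) (\<lambda>D w k. D = UNIV \<and>
      (\<exists>f. strict_mono f \<and> k < f 0 \<and> h (insert (VarBit z) (w k) # seg w (Suc k) (f 0)) = s \<and>
        (\<forall>i. h (seg w (f i) (f (Suc i))) = e)))"
    by blast
  \<comment> \<open>The intersections with \<open>range h\<close> make the index sets
    finite.\<close>
  define I where "I = (\<lambda>(t, s, e). (P t, F' s e)) ` (G \<inter> range h \<times> range h \<times> range h) \<union>
    (\<lambda>(t, s). (P t, F s)) ` (G' \<inter> range h \<times> range h)"
  have mem_I: "p \<in> I \<longleftrightarrow> (\<exists>t s e. (t, s, e) \<in> G \<inter> range h \<times> range h \<times> range h \<and> p = (P t, F' s e)) \<or>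
      (\<exists>t s. (t, s) \<in> G' \<inter> range h \<times> range h \<and> p = (P t, F s))" for p
    unfolding I_def Un_iff image_iff Bex_def split_paired_Ex case_prod_conv by (rule refl)
  have range_h: "s \<in> range h" if "h u = s" for u s
    using that by blast
  have "finite I"
    using h(1) unfolding I_def by blast
  moreover have "\<forall>(P, F) \<in> I. modalities P \<subseteq> {mb} \<and> modalities F \<subseteq> {mf} \<and>
      fv P \<subseteq> doubled ?X \<and> fv F \<subseteq> doubled ?X"
    by (simp add: I_def P(1,2) F(1,2) F'(1,2) ball_Un split_beta)
  moreover have "sem W \<phi> (\<lambda>x. \<rho> (2 * x)) = (\<Union>(P, F) \<in> I. sem W P \<rho> \<inter> sem W F \<rho>)"
    if val: "valuation W \<rho>" "complementary W ?X \<rho>" for W :: "('a, 'd) dword" and \<rho>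
  proof -
    have "i \<in> sem W \<phi> (\<lambda>x. \<rho> (2 * x)) \<longleftrightarrow> i \<in> (\<Union>(P, F) \<in> I. sem W P \<rho> \<inter> sem W F \<rho>)"
      if i: "i \<in> positions W" for i
    proof -
      obtain c D k where ch: "chain mf mb afirst alast W c D" and k: "k \<in> D" "c k = i"
        using chain_exists[OF opp i] by blast
      interpret chain mf mb afirst alast W c D
        by (rule ch)
      define w where "w = chain_word W c D ?X \<rho>"
      have w: "bits w (VarBit z) = {}"
        using z by (auto simp: w_def chain_word_def split: if_splits)
      have lhs: "i \<in> sem W \<phi> (\<lambda>x. \<rho> (2 * x)) \<longleftrightarrow> k \<in> csem \<phi> w"
        using csem_chain_word[OF \<phi> order_refl] k by (simp add: w_def)
      have rhs: "i \<in> (\<Union>(P, F) \<in> I. sem W P \<rho> \<inter> sem W F \<rho>) \<longleftrightarrow>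
        (\<exists>s e. (h (seg w 0 k), s, e) \<in> G \<inter> range h \<times> range h \<times> range h \<and> c k \<in> sem W (F' s e) \<rho>) \<or>
        (\<exists>s. (h (seg w 0 k), s) \<in> G' \<inter> range h \<times> range h \<and> c k \<in> sem W (F s) \<rho>)"
      proof -
        have "i \<in> (\<Union>(P, F) \<in> I. sem W P \<rho> \<inter> sem W F \<rho>) \<longleftrightarrow>
            (\<exists>p \<in> I. i \<in> sem W (fst p) \<rho> \<and> i \<in> sem W (snd p) \<rho>)"
          by (simp add: split_beta)
        also have "\<dots> \<longleftrightarrow>
            (\<exists>t s e. (t, s, e) \<in> G \<inter> range h \<times> range h \<times> range h \<and> c k \<in> sem W (P t) \<rho> \<and> c k \<in> sem W (F' s e) \<rho>) \<or>
            (\<exists>t s. (t, s) \<in> G' \<inter> range h \<times> range h \<and> c k \<in> sem W (P t) \<rho> \<and> c k \<in> sem W (F s) \<rho>)"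
          unfolding Bex_def mem_I k(2) by fastforce
        also have "\<dots> \<longleftrightarrow>
            (\<exists>s e. (h (seg w 0 k), s, e) \<in> G \<inter> range h \<times> range h \<times> range h \<and> c k \<in> sem W (F' s e) \<rho>) \<or>
            (\<exists>s. (h (seg w 0 k), s) \<in> G' \<inter> range h \<times> range h \<and> c k \<in> sem W (F s) \<rho>)"
          unfolding expressesD[OF P(3) ch val k(1)] w_def[symmetric] by simp
        finally show ?thesis .
      qed
      show ?thesis
      proof (cases "D = UNIV")
        case True
        then have "\<not> c k \<in> sem W (F s) \<rho>" for s
          unfolding expressesD[OF F(3) ch val k(1)] by (metis infinite_UNIV_nat finite_lessThan)
        then have "i \<in> (\<Union>(P, F) \<in> I. sem W P \<rho> \<inter> sem W F \<rho>) \<longleftrightarrow>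
            (\<exists>s e. (h (seg w 0 k), s, e) \<in> G \<inter> range h \<times> range h \<times> range h \<and>
              (\<exists>f. strict_mono f \<and> k < f 0 \<and>
                h (insert (VarBit z) (w k) # seg w (Suc k) (f 0)) = s \<and>
                (\<forall>i. h (seg w (f i) (f (Suc i))) = e)))"
          unfolding rhs expressesD[OF F'(3) ch val k(1)] w_def[symmetric] using True by simp
        also have "\<dots> \<longleftrightarrow> k \<in> csem \<phi> w"
          unfolding inf[OF w]
        proof (intro iffI; elim exE conjE)
          fix s e f
          assume "(h (seg w 0 k), s, e) \<in> G" "strict_mono f" "k < f 0"
            "h (insert (VarBit z) (w k) # seg w (Suc k) (f 0)) = s"
            "\<forall>i. h (seg w (f i) (f (Suc i))) = e"
          moreover from this have "s \<in> range h" "e \<in> range h"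
            using range_h by blast+
          ultimately show "\<exists>s e. (h (seg w 0 k), s, e) \<in> G \<inter> range h \<times> range h \<times> range h \<and>
              (\<exists>f. strict_mono f \<and> k < f 0 \<and>
                h (insert (VarBit z) (w k) # seg w (Suc k) (f 0)) = s \<and>
                (\<forall>i. h (seg w (f i) (f (Suc i))) = e))"
            by (intro exI[of _ s] exI[of _ e] conjI exI[of _ f]) simp_all
        qed (rule exI, rule exI, rule exI, intro conjI; simp)
        finally show ?thesis
          by (simp only: lhs)
      next
        case False
        then obtain m where "m \<notin> D"
          by blast
        define n where "n = (LEAST n. n \<notin> D)"
        have n: "n \<notin> D" "\<And>j. j < n \<Longrightarrow> j \<in> D"
          using LeastI[of "\<lambda>n. n \<notin> D", OF \<open>m \<notin> D\<close>] not_less_Least[of _ "\<lambda>n. n \<notin> D"]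
          unfolding n_def by blast+
        then have D: "D = {..<n}"
          using mem_mono[of _ n] not_le by blast
        have "k < n"
          using k(1) D by simp
        then have csem: "k \<in> csem \<phi> w \<longleftrightarrow>
            (h (seg w 0 k), h (insert (VarBit z) (w k) # seg w (Suc k) n)) \<in> G'"
          using w by (intro fin) (simp_all add: w_def chain_word_def D)
        have "c k \<in> sem W (F s) \<rho> \<longleftrightarrow> h (insert (VarBit z) (w k) # seg w (Suc k) n) = s" for s
          using expressesD[OF F(3)[of s] ch val k(1)] \<open>k < n\<close> by (auto simp: D w_def)
        then show ?thesis
          unfolding lhs rhs csem expressesD[OF F'(3) ch val k(1)] using False by simp
      qed
    qed
    moreover have "sem W \<phi> (\<lambda>x. \<rho> (2 * x)) \<subseteq> positions W"
      using val(1) by (intro sem_subset_positions) (simp add: valuation_def)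
    moreover have "(\<Union>(P, F) \<in> I. sem W P \<rho> \<inter> sem W F \<rho>) \<subseteq> positions W"
      using sem_subset_positions[OF val(1)] by blast
    ultimately show ?thesis
      by blast
  qed
  ultimately show ?thesis
    by blast
qed

section \<open>Substitution and duality\<close>

lemma fv_subst: "fv (subst \<psi> \<sigma>) \<subseteq> (\<Union>x \<in> fv \<psi>. fv (\<sigma> x))"
proof (induction \<psi> arbitrary: \<sigma>)
  case (Or \<phi> \<psi>)
  show ?case
    using Or.IH[of \<sigma>] by auto
next
  case (And \<phi> \<psi>)
  show ?case
    using And.IH[of \<sigma>] by auto
next
  case (Mu x \<phi>)
  have "fv (subst \<phi> (\<sigma>(x := Var x))) \<subseteq> (\<Union>y \<in> fv \<phi>. fv ((\<sigma>(x := Var x)) y))"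
    by (rule Mu.IH)
  then show ?case
    by (auto split: if_splits)
next
  case (Nu x \<phi>)
  have "fv (subst \<phi> (\<sigma>(x := Var x))) \<subseteq> (\<Union>y \<in> fv \<phi>. fv ((\<sigma>(x := Var x)) y))"
    by (rule Nu.IH)
  then show ?case
    by (auto split: if_splits)
qed auto

lemma sem_subst: "no_capture \<psi> \<sigma> \<Longrightarrow> sem w (subst \<psi> \<sigma>) \<rho> = sem w \<psi> (\<lambda>x. sem w (\<sigma> x) \<rho>)"
proof (induction \<psi> arbitrary: \<sigma> \<rho>)
  case (Mu x \<phi>)
  have "sem w (subst \<phi> (\<sigma>(x := Var x))) (\<rho>(x := U)) = sem w \<phi> ((\<lambda>y. sem w (\<sigma> y) \<rho>)(x := U))" for U
  proof -
    have "sem w (subst \<phi> (\<sigma>(x := Var x))) (\<rho>(x := U)) =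
        sem w \<phi> (\<lambda>y. sem w ((\<sigma>(x := Var x)) y) (\<rho>(x := U)))"
      using Mu.prems by (intro Mu.IH) (simp only: no_capture.simps)
    also have "\<dots> = sem w \<phi> ((\<lambda>y. sem w (\<sigma> y) \<rho>)(x := U))"
    proof (rule sem_cong)
      fix y assume "y \<in> fv \<phi>"
      then have "y \<noteq> x \<Longrightarrow> x \<notin> fv (\<sigma> y)"
        using Mu.prems by simp
      then have "y \<noteq> x \<Longrightarrow> sem w (\<sigma> y) (\<rho>(x := U)) = sem w (\<sigma> y) \<rho>"
        by (intro sem_cong) auto
      then show "sem w ((\<sigma>(x := Var x)) y) (\<rho>(x := U)) = ((\<lambda>y. sem w (\<sigma> y) \<rho>)(x := U)) y"
        by simp
    qed
    finally show ?thesis .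
  qed
  then show ?case
    by simp
next
  case (Nu x \<phi>)
  have "sem w (subst \<phi> (\<sigma>(x := Var x))) (\<rho>(x := U)) = sem w \<phi> ((\<lambda>y. sem w (\<sigma> y) \<rho>)(x := U))" for U
  proof -
    have "sem w (subst \<phi> (\<sigma>(x := Var x))) (\<rho>(x := U)) =
        sem w \<phi> (\<lambda>y. sem w ((\<sigma>(x := Var x)) y) (\<rho>(x := U)))"
      using Nu.prems by (intro Nu.IH) (simp only: no_capture.simps)
    also have "\<dots> = sem w \<phi> ((\<lambda>y. sem w (\<sigma> y) \<rho>)(x := U))"
    proof (rule sem_cong)
      fix y assume "y \<in> fv \<phi>"
      then have "y \<noteq> x \<Longrightarrow> x \<notin> fv (\<sigma> y)"
        using Nu.prems by simp
      then have "y \<noteq> x \<Longrightarrow> sem w (\<sigma> y) (\<rho>(x := U)) = sem w (\<sigma> y) \<rho>"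
        by (intro sem_cong) auto
      then show "sem w ((\<sigma>(x := Var x)) y) (\<rho>(x := U)) = ((\<lambda>y. sem w (\<sigma> y) \<rho>)(x := U)) y"
        by simp
    qed
    finally show ?thesis .
  qed
  then show ?case
    by simp
qed simp_all

text \<open>Closed formulas cannot be captured; the alternative \<open>Var x\<close> is there
  because \<open>subst\<close> sends a bound variable to itself below its binder.\<close>

lemma no_capture_closed: "(\<And>x. x \<in> fv \<psi> \<Longrightarrow> fv (\<sigma> x) = {} \<or> \<sigma> x = Var x) \<Longrightarrow> no_capture \<psi> \<sigma>"
proof (induction \<psi> arbitrary: \<sigma>)
  case (Mu x \<phi>)
  have "no_capture \<phi> (\<sigma>(x := Var x))"
    by (rule Mu.IH) (use Mu.prems in auto)
  then show ?case
    using Mu.prems by fastforce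
next
  case (Nu x \<phi>)
  have "no_capture \<phi> (\<sigma>(x := Var x))"
    by (rule Nu.IH) (use Nu.prems in auto)
  then show ?case
    using Nu.prems by fastforce
qed simp_all

text \<open>Level 0 is empty, so level 1 only allows \<psi> without free variables, and every later
  level replaces all free variables by closed formulas.\<close>

lemma Comp_level_closed: "\<phi> \<in> Comp_level \<Psi> n \<Longrightarrow> fv \<phi> = {}"
proof (induction n arbitrary: \<phi>)
  case (Suc n)
  then show ?case
    using fv_subst by fastforce
qed simp

section \<open>Negation by duality\<close>

primrec end_atom :: "modality \<Rightarrow> 'a atom" where
  "end_atom XG = LastG"
| "end_atom XC = LastC"
| "end_atom YG = FirstG"
| "end_atom YC = FirstC"

lemma holds_end_atom:
  assumes "i \<in> positions w"
  shows "holds_at w (end_atom m) i \<longleftrightarrow> (\<nexists>j. step m w i j)"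
proof -
  have "Suc j \<in> positions w \<Longrightarrow> j \<in> positions w" for j
    by (cases w) auto
  then have "(\<nexists>j. is_pred w i j) \<longleftrightarrow> i = 0"
    using assms by (cases i) (auto simp: is_pred_def)
  then show ?thesis
    using assms by (cases m) (auto simp: is_succ_def)
qed

text \<open>Steps are functional, so \<open>Mod m \<phi>\<close> fails if the step leads to a
  position where \<phi> fails or does not exist; \<open>end_atom\<close> expresses the latter
  without a modality. Variables are kept, and the valuation is complemented instead.\<close>

primrec dual :: "'a fm \<Rightarrow> 'a fm" where
  "dual (Var x) = Var x"
| "dual (Atom A) = NegAtom A"
| "dual (NegAtom A) = Atom A"
| "dual (Mod m \<phi>) = Or (Mod m (dual \<phi>)) (Atom (end_atom m))"
| "dual (Or \<phi> \<psi>) = And (dual \<phi>) (dual \<psi>)"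
| "dual (And \<phi> \<psi>) = Or (dual \<phi>) (dual \<psi>)"
| "dual (Mu x \<phi>) = Nu x (dual \<phi>)"
| "dual (Nu x \<phi>) = Mu x (dual \<phi>)"

lemma fv_dual [simp]: "fv (dual \<phi>) = fv \<phi>"
  by (induction \<phi>) simp_all

lemma modalities_dual [simp]: "modalities (dual \<phi>) = modalities \<phi>"
  by (induction \<phi>) simp_all

lemma dual_subst: "dual (subst \<psi> \<sigma>) = subst (dual \<psi>) (\<lambda>x. dual (\<sigma> x))"
proof (induction \<psi> arbitrary: \<sigma>)
  case (Mu x \<phi>)
  have "(\<lambda>y. dual ((\<sigma>(x := Var x)) y)) = (\<lambda>y. dual (\<sigma> y))(x := Var x)"
    by auto
  then show ?case
    by (simp only: subst.simps dual.simps Mu)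
next
  case (Nu x \<phi>)
  have "(\<lambda>y. dual ((\<sigma>(x := Var x)) y)) = (\<lambda>y. dual (\<sigma> y))(x := Var x)"
    by auto
  then show ?case
    by (simp only: subst.simps dual.simps Nu)
qed simp_all

lemma gfp_eq_compl_lfp:
  fixes f g :: "'b set \<Rightarrow> 'b set"
  assumes "mono f" "mono g" and sub: "\<And>U. f U \<subseteq> P" "\<And>U. g U \<subseteq> P"
    and dual: "\<And>U. U \<subseteq> P \<Longrightarrow> g (P - U) = P - f U"
  shows "gfp g = P - lfp f"
proof
  have lfp: "lfp f \<subseteq> P"
    using sub(1)[of "lfp f"] by (simp add: lfp_fixpoint[OF assms(1)])
  have gfp: "gfp g \<subseteq> P"
    using sub(2)[of "gfp g"] by (simp add: gfp_fixpoint[OF assms(2)])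
  show "P - lfp f \<subseteq> gfp g"
    by (rule gfp_upperbound) (simp add: dual[OF lfp] lfp_fixpoint[OF assms(1)])
  have "P - (P - gfp g) = gfp g"
    using gfp by blast
  then have "gfp g = P - f (P - gfp g)"
    using dual[of "P - gfp g"] by (simp add: gfp_fixpoint[OF assms(2)])
  then have "f (P - gfp g) \<subseteq> P - gfp g"
    using sub(1) by blast
  then have "lfp f \<subseteq> P - gfp g"
    by (rule lfp_lowerbound)
  then show "gfp g \<subseteq> P - lfp f"
    using gfp by blast
qed

lemma sem_dual:
  "valuation w \<rho> \<Longrightarrow> sem w (dual \<phi>) (\<lambda>x. positions w - \<rho> x) = positions w - sem w \<phi> \<rho>"
proof (induction \<phi> arbitrary: \<rho>)
  case (Mod m \<phi>)
  have "step m w i j \<Longrightarrow> step m w i k \<Longrightarrow> j = k" for i j k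
  proof (cases m)
    case XG
    moreover assume "step m w i j" "step m w i k"
    ultimately show ?thesis
      using step_functional[of XG YG FirstG LastG] by (simp add: opposite_def)
  next
    case XC
    moreover assume "step m w i j" "step m w i k"
    ultimately show ?thesis
      using step_functional[of XC YC FirstC LastC] by (simp add: opposite_def)
  next
    case YG
    moreover assume "step m w i j" "step m w i k"
    ultimately show ?thesis
      using step_injective[of XG YG FirstG LastG w j i k] step_opposite[of XG YG FirstG LastG w]
      by (simp add: opposite_def)
  next
    case YC
    moreover assume "step m w i j" "step m w i k"
    ultimately show ?thesis
      using step_injective[of XC YC FirstC LastC w j i k] step_opposite[of XC YC FirstC LastC w]
      by (simp add: opposite_def)
  qed
  then show ?case
    using Mod step_positions[of m w] by (auto simp: holds_end_atom) blast
next
  case (Mu x \<phi>)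
  have upd: "(\<lambda>y. positions w - (\<rho>(x := U)) y) = (\<lambda>y. positions w - \<rho> y)(x := positions w - U)" for U
    by (rule ext) simp
  have "sem w (dual \<phi>) ((\<lambda>y. positions w - \<rho> y)(x := positions w - U)) =
      positions w - sem w \<phi> (\<rho>(x := U))" if "U \<subseteq> positions w" for U
    unfolding upd[symmetric] by (rule Mu.IH) (use Mu.prems that in \<open>simp add: valuation_def\<close>)
  then show ?case
    unfolding dual.simps sem.simps
    by (intro gfp_eq_compl_lfp mono_sem_body) auto
next
  case (Nu x \<phi>)
  have upd: "(\<lambda>y. positions w - (\<rho>(x := U)) y) = (\<lambda>y. positions w - \<rho> y)(x := positions w - U)" for U
    by (rule ext) simp
  let ?f = "\<lambda>U. positions w \<inter> sem w \<phi> (\<rho>(x := U))"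
  let ?g = "\<lambda>U. positions w \<inter> sem w (dual \<phi>) ((\<lambda>y. positions w - \<rho> y)(x := U))"
  have "?f (positions w - U) = positions w - ?g U" if U: "U \<subseteq> positions w" for U
  proof -
    have "valuation w (\<rho>(x := positions w - U))"
      using Nu.prems by (simp add: valuation_def)
    then have "sem w (dual \<phi>) (\<lambda>y. positions w - (\<rho>(x := positions w - U)) y) =
        positions w - sem w \<phi> (\<rho>(x := positions w - U))"
      by (rule Nu.IH)
    then have "sem w (dual \<phi>) ((\<lambda>y. positions w - \<rho> y)(x := U)) =
        positions w - sem w \<phi> (\<rho>(x := positions w - U))"
      unfolding upd double_diff[OF U order_refl] .
    then show ?thesis
      by blast
  qed
  \<comment> \<open>The lemma is applied with the roles of the two operators exchanged;
    complementing once more requires that \<open>lfp ?g\<close> consists of positions.\<close>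
  then have "gfp ?f = positions w - lfp ?g"
    by (intro gfp_eq_compl_lfp mono_sem_body) auto
  moreover have "lfp ?g \<subseteq> positions w"
    by (subst lfp_unfold[OF mono_sem_body]) blast
  ultimately show ?case
    unfolding dual.simps sem.simps by blast
qed (auto simp: valuation_def)

lemma sem_dual_closed:
  assumes "fv \<phi> = {}" "valuation w \<rho>"
  shows "sem w (dual \<phi>) \<rho> = positions w - sem w \<phi> \<rho>"
proof -
  have "sem w (dual \<phi>) \<rho> = sem w (dual \<phi>) (\<lambda>x. positions w - \<rho> x)"
    by (rule sem_cong) (simp add: assms(1))
  then show ?thesis
    by (simp add: sem_dual[OF assms(2)])
qed

lemma dual_Comp_level:
  assumes "\<And>\<psi>. \<psi> \<in> \<Psi> \<Longrightarrow> dual \<psi> \<in> \<Psi>"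
  shows "\<phi> \<in> Comp_level \<Psi> n \<Longrightarrow> dual \<phi> \<in> Comp_level \<Psi> n"
proof (induction n arbitrary: \<phi>)
  case (Suc n)
  then obtain \<psi> \<sigma> where \<psi>: "\<phi> = subst \<psi> \<sigma>" "\<psi> \<in> \<Psi>" "\<forall>x \<in> fv \<psi>. \<sigma> x \<in> Comp_level \<Psi> n"
    by auto
  have "no_capture (dual \<psi>) (\<lambda>x. dual (\<sigma> x))"
    using \<psi>(3) Comp_level_closed[of _ \<Psi> n] by (intro no_capture_closed) auto
  then show ?case
    using \<psi> assms Suc.IH by (auto simp: dual_subst intro!: exI[of _ "dual \<psi>"])
qed simp

section \<open>Headed formulas\<close>

text \<open>\<open>headed M S \<phi>\<close> means that \<open>\<phi>\<close> arises from a formula over the modalities \<open>M\<close> by substituting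
  closed formulas in \<open>S\<close>. Unlike the image of \<open>subst\<close>, it is visibly closed under
  conjunction and disjunction, since no variables have to be renamed apart.\<close>

inductive headed :: "modality set \<Rightarrow> 'a fm set \<Rightarrow> 'a fm \<Rightarrow> bool" for M S where
  leaf: "\<phi> \<in> S \<Longrightarrow> fv \<phi> = {} \<Longrightarrow> headed M S \<phi>"
| var: "headed M S (Var x)"
| atom: "headed M S (Atom A)"
| neg_atom: "headed M S (NegAtom A)"
| modal: "m \<in> M \<Longrightarrow> headed M S \<phi> \<Longrightarrow> headed M S (Mod m \<phi>)"
| disj: "headed M S \<phi> \<Longrightarrow> headed M S \<psi> \<Longrightarrow> headed M S (Or \<phi> \<psi>)"
| conj: "headed M S \<phi> \<Longrightarrow> headed M S \<psi> \<Longrightarrow> headed M S (And \<phi> \<psi>)"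
| mu: "headed M S \<phi> \<Longrightarrow> headed M S (Mu x \<phi>)"
| nu: "headed M S \<phi> \<Longrightarrow> headed M S (Nu x \<phi>)"

lemma headed_subst:
  "modalities \<psi> \<subseteq> M \<Longrightarrow> (\<And>x. x \<in> fv \<psi> \<Longrightarrow> headed M S (\<sigma> x)) \<Longrightarrow> headed M S (subst \<psi> \<sigma>)"
proof (induction \<psi> arbitrary: \<sigma>)
  case (Mu x \<phi>)
  have "headed M S (subst \<phi> (\<sigma>(x := Var x)))"
    by (rule Mu.IH) (use Mu.prems in \<open>auto intro: headed.var\<close>)
  then show ?case
    by (simp add: headed.mu)
next
  case (Nu x \<phi>)
  have "headed M S (subst \<phi> (\<sigma>(x := Var x)))"
    by (rule Nu.IH) (use Nu.prems in \<open>auto intro: headed.var\<close>)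
  then show ?case
    by (simp add: headed.nu)
qed (auto intro: headed.intros)

instance atom :: (countable) countable
  by countable_datatype

instance modality :: countable
  by countable_datatype

instance fm :: (countable) countable
  by countable_datatype

text \<open>All formulas being countably many, one substitution serves all leaves: variables from
  \<open>N\<close> on are codes of formulas.\<close>

definition decode :: "nat \<Rightarrow> nat \<Rightarrow> 'a::countable fm" where
  "decode N x = (if x < N then Var x else from_nat (x - N))"

definition decomposes :: "modality set \<Rightarrow> 'a::countable fm set \<Rightarrow> nat \<Rightarrow> 'a fm \<Rightarrow> 'a fm \<Rightarrow> bool" where
  "decomposes M S N \<phi> \<psi> \<longleftrightarrow> modalities \<psi> \<subseteq> M \<and> subst \<psi> (decode N) = \<phi> \<and> no_capture \<psi> (decode N) \<and>
    (\<forall>x \<in> fv \<psi>. x < N \<and> x \<in> fv \<phi> \<or> \<not> x < N \<and> decode N x \<in> S \<and> fv (decode N x :: 'a fm) = {})"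

text \<open>The base \<open>N\<close> of the codes must lie above the variables of \<phi>, and both
  arguments of a binary connective need the same base; hence the claim is made for all large
  \<open>N\<close>.\<close>

lemma headed_decomposes:
  fixes \<phi> :: "'a::countable fm"
  assumes "headed M S \<phi>"
  shows "\<exists>N\<^sub>0. \<forall>N \<ge> N\<^sub>0. \<exists>\<psi>. decomposes M S N \<phi> \<psi>"
  using assms
proof (induction rule: headed.induct)
  case (leaf \<phi>)
  then have "decomposes M S N \<phi> (Var (N + to_nat \<phi>))" for N
    by (simp add: decomposes_def decode_def)
  then show ?case
    by blast
next
  case (var x)
  have "decomposes M S N (Var x) (Var x)" if "N \<ge> Suc x" for N
    using that by (simp add: decomposes_def decode_def)
  then show ?case
    by blast
next
  case (atom A)
  have "decomposes M S N (Atom A) (Atom A)" for N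
    by (simp add: decomposes_def)
  then show ?case
    by blast
next
  case (neg_atom A)
  have "decomposes M S N (NegAtom A) (NegAtom A)" for N
    by (simp add: decomposes_def)
  then show ?case
    by blast
next
  case (modal m \<phi>)
  then have "decomposes M S N (Mod m \<phi>) (Mod m \<psi>)" if "decomposes M S N \<phi> \<psi>" for N \<psi>
    using that by (simp add: decomposes_def)
  then show ?case
    using modal.IH by meson
next
  case (disj \<phi> \<phi>')
  have "decomposes M S N (Or \<phi> \<phi>') (Or \<psi> \<psi>')" if "decomposes M S N \<phi> \<psi>" "decomposes M S N \<phi>' \<psi>'" for N \<psi> \<psi>'
    using that by (auto simp: decomposes_def)
  moreover obtain N\<^sub>0 N\<^sub>1 where "\<forall>N \<ge> N\<^sub>0. \<exists>\<psi>. decomposes M S N \<phi> \<psi>" "\<forall>N \<ge> N\<^sub>1. \<exists>\<psi>. decomposes M S N \<phi>' \<psi>"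
    using disj.IH by blast
  ultimately show ?case
    by (intro exI[of _ "max N\<^sub>0 N\<^sub>1"]) (metis max.bounded_iff)
next
  case (conj \<phi> \<phi>')
  have "decomposes M S N (And \<phi> \<phi>') (And \<psi> \<psi>')" if "decomposes M S N \<phi> \<psi>" "decomposes M S N \<phi>' \<psi>'" for N \<psi> \<psi>'
    using that by (auto simp: decomposes_def)
  moreover obtain N\<^sub>0 N\<^sub>1 where "\<forall>N \<ge> N\<^sub>0. \<exists>\<psi>. decomposes M S N \<phi> \<psi>" "\<forall>N \<ge> N\<^sub>1. \<exists>\<psi>. decomposes M S N \<phi>' \<psi>"
    using conj.IH by blast
  ultimately show ?case
    by (intro exI[of _ "max N\<^sub>0 N\<^sub>1"]) (metis max.bounded_iff)
next
  case (mu \<phi> x)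
  have "decomposes M S N (Mu x \<phi>) (Mu x \<psi>)" if "decomposes M S N \<phi> \<psi>" "N \<ge> Suc x" for N \<psi>
  proof -
    \<comment> \<open>Since x < N, decoding fixes the bound variable, and codes decode to closed
      formulas, so nothing is captured.\<close>
    have "(decode N)(x := Var x) = (decode N :: nat \<Rightarrow> 'a fm)"
      using that(2) by (auto simp: decode_def)
    moreover have "x \<notin> fv (decode N y :: 'a fm)" if "y \<in> fv \<psi> - {x}" for y
      using \<open>decomposes M S N \<phi> \<psi>\<close> that by (cases "y < N") (auto simp: decomposes_def decode_def)
    ultimately show ?thesis
      using that by (auto simp: decomposes_def)
  qed
  moreover obtain N\<^sub>0 where "\<forall>N \<ge> N\<^sub>0. \<exists>\<psi>. decomposes M S N \<phi> \<psi>"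
    using mu.IH by blast
  ultimately show ?case
    by (intro exI[of _ "max N\<^sub>0 (Suc x)"]) (metis max.bounded_iff)
next
  case (nu \<phi> x)
  have "decomposes M S N (Nu x \<phi>) (Nu x \<psi>)" if "decomposes M S N \<phi> \<psi>" "N \<ge> Suc x" for N \<psi>
  proof -
    have "(decode N)(x := Var x) = (decode N :: nat \<Rightarrow> 'a fm)"
      using that(2) by (auto simp: decode_def)
    moreover have "x \<notin> fv (decode N y :: 'a fm)" if "y \<in> fv \<psi> - {x}" for y
      using \<open>decomposes M S N \<phi> \<psi>\<close> that by (cases "y < N") (auto simp: decomposes_def decode_def)
    ultimately show ?thesis
      using that by (auto simp: decomposes_def)
  qed
  moreover obtain N\<^sub>0 where "\<forall>N \<ge> N\<^sub>0. \<exists>\<psi>. decomposes M S N \<phi> \<psi>"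
    using nu.IH by blast
  ultimately show ?case
    by (intro exI[of _ "max N\<^sub>0 (Suc x)"]) (metis max.bounded_iff)
qed

text \<open>As \<phi> is closed, only codes of leaves are free in the decomposed \<psi>, and all of
  them decode to formulas of level n.\<close>

lemma headed_Comp_level:
  fixes \<phi> :: "'a::countable fm"
  assumes "headed M (Comp_level \<Psi> n) \<phi>" "fv \<phi> = {}" "Formulas M \<subseteq> \<Psi>"
  shows "\<phi> \<in> Comp_level \<Psi> (Suc n)"
proof -
  obtain N \<psi> where "decomposes M (Comp_level \<Psi> n) N \<phi> \<psi>"
    using headed_decomposes[OF assms(1)] by blast
  then have "\<phi> = subst \<psi> (decode N)" "\<psi> \<in> \<Psi>" "\<forall>x \<in> fv \<psi>. decode N x \<in> Comp_level \<Psi> n"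
    "no_capture \<psi> (decode N)"
    using assms(2,3) by (auto simp: decomposes_def Formulas_def)
  then show ?thesis
    by auto
qed

lemma headed_Union:
  fixes f :: "'i \<Rightarrow> 'a fm"
  assumes "finite I" "\<And>i. i \<in> I \<Longrightarrow> headed M S (f i) \<and> fv (f i) = {}"
  shows "\<exists>\<phi>. headed M S \<phi> \<and> fv \<phi> = {} \<and>
    (\<forall>(W :: ('a, 'd) dword) \<rho>. sem W \<phi> \<rho> = (\<Union>i \<in> I. sem W (f i) \<rho>))"
  using assms
proof (induction I)
  case empty
  have "headed M S bot_fm"
    by (auto simp: bot_fm_def intro: headed.intros)
  then show ?case
    by (intro exI[of _ bot_fm]) simp
next
  case (insert i I)
  then obtain \<phi> where "headed M S \<phi>" "fv \<phi> = {}"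
    "\<forall>(W :: ('a, 'd) dword) \<rho>. sem W \<phi> \<rho> = (\<Union>i \<in> I. sem W (f i) \<rho>)"
    by auto
  then show ?case
    using insert.prems by (intro exI[of _ "Or (f i) \<phi>"]) (simp add: headed.disj)
qed

section \<open>From BMA levels to BR levels\<close>

definition equivalent :: "('a, 'd) dword itself \<Rightarrow> 'a fm \<Rightarrow> 'a fm \<Rightarrow> bool" where
  "equivalent _ \<phi> \<psi> \<longleftrightarrow> (\<forall>(W :: ('a, 'd) dword) \<rho>. valuation W \<rho> \<longrightarrow> sem W \<phi> \<rho> = sem W \<psi> \<rho>)"

abbreviation BR_level :: "nat \<Rightarrow> 'a fm set" where
  "BR_level \<equiv> Comp_level BR_base"

abbreviation future :: "modality set" where
  "future \<equiv> {XC, XG}"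

abbreviation past :: "modality set" where
  "past \<equiv> {YC, YG}"

lemma headed_BR_level:
  fixes \<phi> :: "'a::countable fm"
  assumes "headed M (BR_level n) \<phi>" "fv \<phi> = {}" "M \<in> {future, past}"
  shows "\<phi> \<in> BR_level (Suc n)"
  by (rule headed_Comp_level[OF assms(1,2)]) (use assms(3) in \<open>auto simp: BR_base_def\<close>)

text \<open>Substituting into a formula with the same direction as the arguments costs no height, and
  substituting into a formula with the other direction costs one level.\<close>

lemma headed_alternate:
  fixes \<sigma> :: "nat \<Rightarrow> 'a::countable fm"
  assumes M: "(M, M') = (future, past) \<or> (M, M') = (past, future)"
    and \<psi>: "modalities \<psi> \<subseteq> future \<or> modalities \<psi> \<subseteq> past"
    and \<sigma>: "\<And>x. x \<in> fv \<psi> \<Longrightarrow> headed M' (BR_level n) (\<sigma> x) \<and> fv (\<sigma> x) = {}"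
  shows "headed M (BR_level (Suc n)) (subst \<psi> \<sigma>) \<and> fv (subst \<psi> \<sigma>) = {}"
proof
  show closed: "fv (subst \<psi> \<sigma>) = {}"
    using fv_subst[of \<psi> \<sigma>] \<sigma> by auto
  consider "modalities \<psi> \<subseteq> M" | "modalities \<psi> \<subseteq> M'"
    using M \<psi> by auto
  then show "headed M (BR_level (Suc n)) (subst \<psi> \<sigma>)"
  proof cases
    case 1
    then show ?thesis
    proof (rule headed_subst)
      fix x assume "x \<in> fv \<psi>"
      then have "headed M' (BR_level n) (\<sigma> x)" "fv (\<sigma> x) = {}"
        using \<sigma> by simp_all
      moreover from this have "\<sigma> x \<in> BR_level (Suc n)"
        by (rule headed_BR_level) (use M in auto)
      ultimately show "headed M (BR_level (Suc n)) (\<sigma> x)"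
        by (simp only: headed.leaf)
    qed
  next
    case 2
    then have "headed M' (BR_level n) (subst \<psi> \<sigma>)"
      by (rule headed_subst) (use \<sigma> in simp)
    then have "subst \<psi> \<sigma> \<in> BR_level (Suc n)"
      using closed by (rule headed_BR_level) (use M in auto)
    then show ?thesis
      using closed by (rule headed.leaf)
  qed
qed

text \<open>The separated formulas for \<psi> receive \<open>\<tau>\<close> at even variables and
  the negative copies \<open>\<tau>'\<close> at odd ones. The arguments are headed by the direction
  opposite to the desired head, as \<open>headed_alternate\<close> requires.\<close>

lemma separate_substitution:
  fixes \<psi> :: "'a::finite fm"
  assumes \<psi>: "\<psi> \<in> BMA_base"
    and M: "(M, M') = (future, past) \<or> (M, M') = (past, future)"
    and \<sigma>: "\<And>x. x \<in> fv \<psi> \<Longrightarrow> fv (\<sigma> x) = {}"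
    and pos: "\<And>x. x \<in> fv \<psi> \<Longrightarrow> headed M' (BR_level n) (\<tau> x) \<and> fv (\<tau> x) = {} \<and>
      equivalent TYPE(('a, 'd) dword) (\<tau> x) (\<sigma> x)"
    and neg: "\<And>x. x \<in> fv \<psi> \<Longrightarrow> headed M' (BR_level n) (\<tau>' x) \<and> fv (\<tau>' x) = {} \<and>
      equivalent TYPE(('a, 'd) dword) (\<tau>' x) (dual (\<sigma> x))"
  shows "\<exists>\<phi>. headed M (BR_level (Suc n)) \<phi> \<and> fv \<phi> = {} \<and>
    equivalent TYPE(('a, 'd) dword) \<phi> (subst \<psi> \<sigma>)"
proof -
  define \<theta> where "\<theta> v = (if even v then \<tau> (v div 2) else \<tau>' (v div 2))" for v
  have \<theta>: "headed M' (BR_level n) (\<theta> v) \<and> fv (\<theta> v) = {}" if "v \<in> doubled (fv \<psi>)" for v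
    using that pos neg by (auto simp: \<theta>_def doubled_def)
  obtain mf mb and afirst alast :: "'a atom" where opp: "opposite mf mb afirst alast"
    and m: "modalities \<psi> \<subseteq> {mf, mb}"
  proof -
    consider "modalities \<psi> \<subseteq> {XG, YG}" | "modalities \<psi> \<subseteq> {XC, YC}"
      using \<psi> by (auto simp: BMA_base_def Formulas_def)
    then show thesis
      by cases (use that[of XG YG FirstG LastG] that[of XC YC FirstC LastC] in \<open>simp_all add: opposite_def\<close>)
  qed
  obtain I where I: "finite I"
    "\<forall>(P, F) \<in> I. modalities P \<subseteq> {mb} \<and> modalities F \<subseteq> {mf} \<and>
      fv P \<subseteq> doubled (fv \<psi>) \<and> fv F \<subseteq> doubled (fv \<psi>)"
    "\<forall>(W :: ('a, 'd) dword) \<rho>. valuation W \<rho> \<longrightarrow> complementary W (fv \<psi>) \<rho> \<longrightarrow>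
      sem W \<psi> (\<lambda>x. \<rho> (2 * x)) = (\<Union>(P, F) \<in> I. sem W P \<rho> \<inter> sem W F \<rho>)"
    using two_way_separation[OF opp m] by blast
  have mfb: "mf \<in> future" "mb \<in> past"
    using opp by (auto simp: opposite_def)
  define f where "f p = And (subst (fst p) \<theta>) (subst (snd p) \<theta>)" for p
  have f: "headed M (BR_level (Suc n)) (f p) \<and> fv (f p) = {}" if "p \<in> I" for p
  proof -
    obtain P F where p: "p = (P, F)"
      by (cases p)
    with I(2) that have PF: "modalities P \<subseteq> {mb}" "modalities F \<subseteq> {mf}"
      "fv P \<subseteq> doubled (fv \<psi>)" "fv F \<subseteq> doubled (fv \<psi>)"
      by auto
    have "headed M (BR_level (Suc n)) (subst P \<theta>) \<and> fv (subst P \<theta>) = {}"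
      using PF mfb \<theta> by (intro headed_alternate[OF M]) auto
    moreover have "headed M (BR_level (Suc n)) (subst F \<theta>) \<and> fv (subst F \<theta>) = {}"
      using PF mfb \<theta> by (intro headed_alternate[OF M]) auto
    ultimately show ?thesis
      by (simp add: f_def p headed.conj)
  qed
  from headed_Union[OF I(1), of M "BR_level (Suc n)" f, OF f] obtain \<phi> where \<phi>: "headed M (BR_level (Suc n)) \<phi>" "fv \<phi> = {}"
    "\<forall>(W :: ('a, 'd) dword) \<rho>. sem W \<phi> \<rho> = (\<Union>p \<in> I. sem W (f p) \<rho>)"
    by blast
  have "sem W \<phi> \<rho> = sem W (subst \<psi> \<sigma>) \<rho>" if val: "valuation W \<rho>" for W :: "('a, 'd) dword" and \<rho>
  proof -
    define \<rho>' where "\<rho>' v = (if v \<in> doubled (fv \<psi>) then sem W (\<theta> v) \<rho> else \<rho> v)" for v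
    have val': "valuation W \<rho>'"
      using val sem_subset_positions[OF val] by (simp add: \<rho>'_def valuation_def)
    have even: "\<rho>' (2 * x) = sem W (\<sigma> x) \<rho>" if "x \<in> fv \<psi>" for x
      using pos[OF that] that val by (auto simp: \<rho>'_def doubled_def \<theta>_def equivalent_def)
    have odd: "\<rho>' (2 * x + 1) = positions W - sem W (\<sigma> x) \<rho>" if "x \<in> fv \<psi>" for x
      using neg[OF that] that val sem_dual_closed[OF \<sigma>[OF that] val]
      by (auto simp: \<rho>'_def doubled_def \<theta>_def equivalent_def)
    have compl: "complementary W (fv \<psi>) \<rho>'"
      unfolding complementary_def using even odd by simp
    have subst: "sem W (subst Q \<theta>) \<rho> = sem W Q \<rho>'" if "fv Q \<subseteq> doubled (fv \<psi>)" for Q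
    proof -
      have "sem W (subst Q \<theta>) \<rho> = sem W Q (\<lambda>v. sem W (\<theta> v) \<rho>)"
        by (intro sem_subst no_capture_closed) (use \<theta> that in auto)
      also have "\<dots> = sem W Q \<rho>'"
        by (rule sem_cong) (use that in \<open>auto simp: \<rho>'_def\<close>)
      finally show ?thesis .
    qed
    have "sem W \<phi> \<rho> = (\<Union>p \<in> I. sem W (fst p) \<rho>' \<inter> sem W (snd p) \<rho>')"
    proof -
      have "sem W (f p) \<rho> = sem W (fst p) \<rho>' \<inter> sem W (snd p) \<rho>'" if "p \<in> I" for p
        using I(2) that by (auto simp: f_def subst)
      then show ?thesis
        by (simp add: \<phi>(3))
    qed
    also have "\<dots> = sem W \<psi> (\<lambda>x. \<rho>' (2 * x))"
      using I(3) val' compl by (simp add: case_prod_beta)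
    also have "\<dots> = sem W \<psi> (\<lambda>x. sem W (\<sigma> x) \<rho>)"
      by (rule sem_cong) (rule even)
    also have "\<dots> = sem W (subst \<psi> \<sigma>) \<rho>"
      by (intro sem_subst[symmetric] no_capture_closed) (simp add: \<sigma>)
    finally show ?thesis .
  qed
  then show ?thesis
    using \<phi>(1,2) unfolding equivalent_def by blast
qed

text \<open>Both directions are proved at once, since a head in direction \<open>M\<close> takes
  arguments with the opposite head. A closed headed formula over \<open>BR_level n\<close> has level
  n + 1 itself, which is the additional level.\<close>

lemma BMA_level_to_BR_level:
  fixes \<phi> :: "'a::finite fm"
  assumes "\<phi> \<in> Comp_level BMA_base n" "M = future \<or> M = past"
  shows "\<exists>\<phi>'. headed M (BR_level n) \<phi>' \<and> fv \<phi>' = {} \<and> equivalent TYPE(('a, 'd) dword) \<phi>' \<phi>"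
  using assms
proof (induction n arbitrary: \<phi> M)
  case (Suc n)
  then obtain \<psi> \<sigma> where \<psi>: "\<phi> = subst \<psi> \<sigma>" "\<psi> \<in> BMA_base" "\<forall>x \<in> fv \<psi>. \<sigma> x \<in> Comp_level BMA_base n"
    by auto
  obtain M' where M': "(M, M') = (future, past) \<or> (M, M') = (past, future)"
    using Suc.prems(2) by blast
  then have M'_cases: "M' = future \<or> M' = past"
    by auto
  have dual: "dual (\<sigma> x) \<in> Comp_level BMA_base n" if "x \<in> fv \<psi>" for x
    by (rule dual_Comp_level) (use \<psi>(3) that in \<open>auto simp: BMA_base_def Formulas_def\<close>)
  have "\<forall>x \<in> fv \<psi>. \<exists>\<chi>. headed M' (BR_level n) \<chi> \<and> fv \<chi> = {} \<and>
      equivalent TYPE(('a, 'd) dword) \<chi> (\<sigma> x)"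
    using Suc.IH \<psi>(3) M'_cases by blast
  then obtain \<tau> where \<tau>: "\<And>x. x \<in> fv \<psi> \<Longrightarrow> headed M' (BR_level n) (\<tau> x) \<and> fv (\<tau> x) = {} \<and>
      equivalent TYPE(('a, 'd) dword) (\<tau> x) (\<sigma> x)"
    by metis
  have "\<forall>x \<in> fv \<psi>. \<exists>\<chi>. headed M' (BR_level n) \<chi> \<and> fv \<chi> = {} \<and>
      equivalent TYPE(('a, 'd) dword) \<chi> (dual (\<sigma> x))"
    using Suc.IH dual M'_cases by blast
  then obtain \<tau>' where \<tau>': "\<And>x. x \<in> fv \<psi> \<Longrightarrow> headed M' (BR_level n) (\<tau>' x) \<and> fv (\<tau>' x) = {} \<and>
      equivalent TYPE(('a, 'd) dword) (\<tau>' x) (dual (\<sigma> x))"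
    by metis
  show ?case
    unfolding \<psi>(1)
    using \<psi>(3) Comp_level_closed[of _ BMA_base n]
    by (intro separate_substitution[OF \<psi>(2) M' _ \<tau> \<tau>']) auto
qed simp

section \<open>Lower bound on the height\<close>

text \<open>The largest number of changes of direction along a branch when starting in direction \<open>b\<close>,
  where \<open>True\<close> is the future. Each level of \<open>BR\<close> adds at most one change.\<close>

primrec alternations :: "'a fm \<Rightarrow> bool \<Rightarrow> nat" where
  "alternations (Var x) = (\<lambda>b. 0)"
| "alternations (Atom A) = (\<lambda>b. 0)"
| "alternations (NegAtom A) = (\<lambda>b. 0)"
| "alternations (Mod m \<phi>) = (\<lambda>b. if (m \<in> future) = b then alternations \<phi> b else Suc (alternations \<phi> (\<not> b)))"
| "alternations (Or \<phi> \<psi>) = (\<lambda>b. max (alternations \<phi> b) (alternations \<psi> b))"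
| "alternations (And \<phi> \<psi>) = (\<lambda>b. max (alternations \<phi> b) (alternations \<psi> b))"
| "alternations (Mu x \<phi>) = alternations \<phi>"
| "alternations (Nu x \<phi>) = alternations \<phi>"

text \<open>One change at the root makes up for the other starting direction.\<close>

lemma alternations_switch: "alternations \<phi> b \<le> Suc (alternations \<phi> (\<not> b))"
proof (induction \<phi> arbitrary: b)
  case (Or \<phi> \<psi>)
  show ?case
    using Or.IH(1)[of b] Or.IH(2)[of b] by (auto simp: max_def)
next
  case (And \<phi> \<psi>)
  show ?case
    using And.IH(1)[of b] And.IH(2)[of b] by (auto simp: max_def)
next
  case (Mod m \<phi>)
  show ?case
    using Mod.IH[of b] Mod.IH[of "\<not> b"] by (cases b) auto
qed simp_all

lemma alternations_subst:
  "modalities \<psi> \<subseteq> (if b then future else past) \<Longrightarrow> (\<And>x. x \<in> fv \<psi> \<Longrightarrow> alternations (\<sigma> x) b \<le> n) \<Longrightarrow>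
    alternations (subst \<psi> \<sigma>) b \<le> n"
proof (induction \<psi> arbitrary: \<sigma>)
  case (Mu x \<phi>)
  have "alternations (subst \<phi> (\<sigma>(x := Var x))) b \<le> n"
    by (rule Mu.IH) (use Mu.prems in auto)
  then show ?case
    by simp
next
  case (Nu x \<phi>)
  have "alternations (subst \<phi> (\<sigma>(x := Var x))) b \<le> n"
    by (rule Nu.IH) (use Nu.prems in auto)
  then show ?case
    by simp
next
  case (Mod m \<phi>)
  have "alternations (subst \<phi> \<sigma>) b \<le> n"
    by (rule Mod.IH) (use Mod.prems in auto)
  moreover have "(m \<in> future) = b"
    using Mod.prems(1) by (cases b) auto
  ultimately show ?case
    by simp
qed auto

text \<open>Counted from its own direction, the outermost layer costs no change, so only its
  arguments matter. By induction an argument of level n has at most n - 1 changes from some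
  direction, hence at most n from either.\<close>

lemma alternations_BR_level: "\<phi> \<in> BR_level n \<Longrightarrow> \<exists>b. alternations \<phi> b < n"
proof (induction n arbitrary: \<phi>)
  case (Suc n)
  then obtain \<psi> \<sigma> where \<psi>: "\<phi> = subst \<psi> \<sigma>" "\<psi> \<in> BR_base" "\<forall>x \<in> fv \<psi>. \<sigma> x \<in> BR_level n"
    by auto
  have le: "alternations (\<sigma> x) b \<le> n" if x: "x \<in> fv \<psi>" for x b
  proof -
    obtain b' where "alternations (\<sigma> x) b' < n"
      using Suc.IH \<psi>(3) x by blast
    then show ?thesis
      using alternations_switch[of "\<sigma> x" b] by (cases "b = b'") auto
  qed
  obtain b where "modalities \<psi> \<subseteq> (if b then future else past)"
    using \<psi>(2) that[of True] that[of False] by (auto simp: BR_base_def Formulas_def)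
  then have "alternations \<phi> b \<le> n"
    unfolding \<psi>(1) by (rule alternations_subst) (rule le)
  then show ?case
    by (auto simp: less_Suc_eq_le)
qed simp

text \<open>An unsatisfiable formula with many alternations. Adding it as a disjunct makes the height of
  a formula exact.\<close>

primrec alternating :: "nat \<Rightarrow> bool \<Rightarrow> 'a fm" where
  "alternating 0 = (\<lambda>b. bot_fm)"
| "alternating (Suc n) = (\<lambda>b. Mod (if b then XG else YG) (alternating n (\<not> b)))"

lemma fv_alternating [simp]: "fv (alternating n b) = {}"
  by (induction n arbitrary: b) simp_all

lemma sem_alternating [simp]: "sem w (alternating n b) \<rho> = {}"
  by (induction n arbitrary: b) simp_all

lemma headed_alternating:
  "headed (if b then future else past) (BR_level n) (alternating (Suc n) b :: 'a::countable fm)"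
proof (induction n arbitrary: b)
  case 0
  have "headed M S bot_fm" for M and S :: "'a fm set"
    by (auto simp: bot_fm_def intro: headed.intros)
  then show ?case
    by (auto intro: headed.modal)
next
  case (Suc n)
  have "(alternating (Suc n) (\<not> b) :: 'a fm) \<in> BR_level (Suc n)"
    by (rule headed_BR_level[OF Suc.IH]) simp_all
  then have "headed M (BR_level (Suc n)) (alternating (Suc n) (\<not> b) :: 'a fm)" for M
    by (rule headed.leaf) simp
  then show ?case
    by (subst alternating.simps(2)) (auto intro: headed.modal)
qed

text \<open>Either starting direction yields at least n changes, so
  \<open>alternations_BR_level\<close> excludes all levels up to n.\<close>

lemma alternations_alternating:
  "alternations (alternating (Suc n) b :: 'a fm) b = n"
  "alternations (alternating (Suc n) b :: 'a fm) (\<not> b) = Suc n"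
proof (induction n arbitrary: b)
  case 0
  {
    case 1
    show ?case
      by (simp add: bot_fm_def)
  next
    case 2
    show ?case
      by (simp add: bot_fm_def)
  }
next
  case (Suc n)
  {
    case 1
    show ?case
      using Suc(2)[of "\<not> b"] by (subst alternating.simps(2)) (cases b; simp del: alternating.simps)
  next
    case 2
    show ?case
      using Suc(2)[of "\<not> b"] by (subst alternating.simps(2)) (cases b; simp del: alternating.simps)
  }
qed

theorem theorem5:
  fixes \<phi> :: "'a::finite fm" and k :: nat
  assumes "infinite (UNIV :: 'd set)"
    and "\<phi> \<in> BMA" and "comp_height BMA_base \<phi> = k"
  shows "\<exists>\<phi>' :: 'a fm. \<phi>' \<in> BR \<and> comp_height BR_base \<phi>' = k + 1 \<and>
           equiv_over (data_words :: ('a, 'd) dword set) \<phi> \<phi>' \<and>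
           equiv_over (data_omega_words :: ('a, 'd) dword set) \<phi> \<phi>'"
proof -
  obtain n where "\<phi> \<in> Comp_level BMA_base n"
    using assms(2) unfolding BMA_def Comp_def by blast
  then have "\<phi> \<in> Comp_level BMA_base k"
    using assms(3) unfolding comp_height_def by (metis LeastI)
  then obtain \<phi>\<^sub>X where \<phi>\<^sub>X: "headed future (BR_level k) \<phi>\<^sub>X" "fv \<phi>\<^sub>X = {}"
    "equivalent TYPE(('a, 'd) dword) \<phi>\<^sub>X \<phi>"
    using BMA_level_to_BR_level[of \<phi> k future] by blast
  \<comment> \<open>The second disjunct denotes the empty set. It has a future head like the first
    one, so no level is added, and its \<open>Suc k\<close> alternating modalities exclude all
    levels up to k.\<close>
  define \<phi>' where "\<phi>' = Or \<phi>\<^sub>X (alternating (Suc k) True)"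
  have "headed future (BR_level k) \<phi>'"
    unfolding \<phi>'_def by (rule headed.disj[OF \<phi>\<^sub>X(1)]) (use headed_alternating[of True k] in simp)
  then have level: "\<phi>' \<in> BR_level (Suc k)"
    by (rule headed_BR_level) (simp_all add: \<phi>'_def \<phi>\<^sub>X(2))
  have "Suc k \<le> i" if "\<phi>' \<in> BR_level i" for i
  proof -
    obtain b where "alternations \<phi>' b < i"
      using alternations_BR_level[OF \<open>\<phi>' \<in> BR_level i\<close>] by blast
    moreover have "k \<le> alternations \<phi>' b"
      using alternations_alternating[of k True, where ?'a = 'a]
      by (cases b) (simp_all add: \<phi>'_def le_max_iff_disj del: alternating.simps)
    ultimately show ?thesis
      by simp
  qed
  then have "comp_height BR_base \<phi>' = k + 1"
    unfolding comp_height_def using level by (intro Least_equality) simp_all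
  moreover have "\<phi>' \<in> BR"
    using level unfolding BR_def Comp_def by blast
  moreover have "sem W \<phi> \<rho> = sem W \<phi>' \<rho>" if "valuation W \<rho>" for W :: "('a, 'd) dword" and \<rho>
    using \<phi>\<^sub>X(3) that unfolding \<phi>'_def equivalent_def sem.simps sem_alternating by simp
  ultimately show ?thesis
    unfolding equiv_over_def by blast
qed

end
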